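(* Let $\ell>3$ be a prime and $1\le k\le \ell-2$. The following are equivalent: (i) $\det(D_k)=0$; (ii) $k$ is not a primitive cubic root of unity modulo $\ell$ and $\mathcal F_0$ is non-empty; (iii) (a) $k$ is not a primitive cubic root of unity modulo $\ell$; (b) $\operatorname{ord}(-k^2-k)$ and $\operatorname{ord}(k)$ are odd; (c) $v_3(\operatorname{ord}(k))>v_3(\operatorname{ord}(-k^2-k))$. In this case, $\mathcal F_0$ is exactly the set of odd divisors of $\ell-1$ that are multiples of $N_k/3$ but not of $N_k$, where $N_k=\operatorname{lcm}(\operatorname{ord}(-k^2-k),\operatorname{ord}(k))$, and $\operatorname{rk}(D_k)=\frac{\ell-1}{2}\left(1-\frac{2}{N_k}\right)$.
   Context: $G=(\mathbb{Z}/\ell\mathbb{Z})^*$; $\operatorname{ord}$ denotes order in $G$ and $v_3$ the $3$-adic valuation. For $a\in G$, $\langle a\rangle\in\{0,\dots,\ell-1\}$ is its representative. $M_k=\{j\in G:\langle j\rangle+\langle kj\rangle<\ell\}$, $W_k=\{w\in G:wM_k=M_k\}$. $E_k(a)=0$ if $a\in M_k$, $1$ otherwise; $D_k=(E_k(-c^{-1}a)-\frac12)_{c,a\in M_k/W_k}$, rows and columns indexed by the $W_k$-cosets contained in $M_k$. For a divisor $f$ of $\ell-1$: $H_f$ is the subgroup of $G$ of order $f$, $E_{k,f}(a)=\sum_{h\in H_f}E_k(ah)$, $W_{k,f}=\{w\in G:E_{k,f}(aw)=E_{k,f}(a)\ \forall a\in G\}$. $\mathcal F_0$ is the set of odd divisors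 $f$ of $\ell-1$ with $W_{k,f}=H_{3f}$. *)

theory Defs
  imports "HOL-Number_Theory.Residues" "Jordan_Normal_Form.DL_Rank"
begin

text \<open>
  The group \<open>(\<int>/l\<int>)\<^sup>*\<close>. For prime \<open>l\<close> its carrier is \<open>{1..l-1}\<close>, so an element coincides
  with its representative \<open>\<langle>a\<rangle>\<close>.
\<close>

definition GG :: "nat \<Rightarrow> int monoid" where
  "GG l = units_of (residue_ring (int l))"

definition G_neg :: "nat \<Rightarrow> int \<Rightarrow> int" where
  "G_neg l a = \<ominus>\<^bsub>residue_ring (int l)\<^esub> a"

definition G_ord :: "nat \<Rightarrow> int \<Rightarrow> nat" where
  "G_ord l a = group.ord (GG l) a"

definition M_set :: "nat \<Rightarrow> nat \<Rightarrow> int set" where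
  "M_set l k = {j \<in> carrier (GG l). j + int k \<otimes>\<^bsub>GG l\<^esub> j < int l}"

definition W_grp :: "nat \<Rightarrow> nat \<Rightarrow> int set" where
  "W_grp l k = {w \<in> carrier (GG l). w <#\<^bsub>GG l\<^esub> M_set l k = M_set l k}"

definition E_fun :: "nat \<Rightarrow> nat \<Rightarrow> int \<Rightarrow> nat" where
  "E_fun l k a = (if a \<in> M_set l k then 0 else 1)"

definition M_mod_W :: "nat \<Rightarrow> nat \<Rightarrow> int set set" where
  "M_mod_W l k = {C \<in> rcosets\<^bsub>GG l\<^esub> (W_grp l k). C \<subseteq> M_set l k}"

text \<open>
  Entries are evaluated at arbitrary coset representatives; lemma \<open>D_entry_eq\<close> below shows that
  the choice is irrelevant.
\<close>

definition D_entry :: "nat \<Rightarrow> nat \<Rightarrow> int set \<Rightarrow> int set \<Rightarrow> real" where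
  "D_entry l k C A =
     real (E_fun l k (G_neg l (inv\<^bsub>GG l\<^esub> (SOME c. c \<in> C) \<otimes>\<^bsub>GG l\<^esub> (SOME a. a \<in> A)))) - 1/2"

text \<open>
  The matrix \<open>D\<^sub>k\<close> relative to an enumeration \<open>cs\<close> of the cosets, used for both rows and columns.
\<close>

definition D_mat :: "nat \<Rightarrow> nat \<Rightarrow> int set list \<Rightarrow> real mat" where
  "D_mat l k cs = mat (length cs) (length cs) (\<lambda>(i, j). D_entry l k (cs ! i) (cs ! j))"

definition H_grp :: "nat \<Rightarrow> nat \<Rightarrow> int set" where
  "H_grp l f = (THE H. subgroup H (GG l) \<and> card H = f)"

definition Ef_fun :: "nat \<Rightarrow> nat \<Rightarrow> nat \<Rightarrow> int \<Rightarrow> nat" where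
  "Ef_fun l k f a = (\<Sum>h\<in>H_grp l f. E_fun l k (a \<otimes>\<^bsub>GG l\<^esub> h))"

definition Wf_grp :: "nat \<Rightarrow> nat \<Rightarrow> nat \<Rightarrow> int set" where
  "Wf_grp l k f =
     {w \<in> carrier (GG l).
        \<forall>a\<in>carrier (GG l). Ef_fun l k f (a \<otimes>\<^bsub>GG l\<^esub> w) = Ef_fun l k f a}"

text \<open>
  The conjunct \<open>3 * f dvd l - 1\<close> makes explicit that \<open>H\<^bsub>3f\<^esub>\<close> exists.
\<close>

definition F0_set :: "nat \<Rightarrow> nat \<Rightarrow> nat set" where
  "F0_set l k =
     {f. odd f \<and> f dvd l - 1 \<and> 3 * f dvd l - 1 \<and> Wf_grp l k f = H_grp l (3 * f)}"

definition N_num :: "nat \<Rightarrow> nat \<Rightarrow> nat" where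
  "N_num l k = lcm (G_ord l ((- (int k)\<^sup>2 - int k) mod int l)) (G_ord l (int k))"

definition primitive_cubic_root :: "nat \<Rightarrow> nat \<Rightarrow> bool" where
  "primitive_cubic_root l k \<longleftrightarrow> G_ord l (int k) = 3"

lemma comm_group_GG: "prime l \<Longrightarrow> comm_group (GG l)"
proof -
  assume "prime l"
  then interpret residues_prime l "residue_ring (int l)"
    by unfold_locales auto
  show ?thesis unfolding GG_def by (rule units_comm_group)
qed

lemma carrier_GG: "prime l \<Longrightarrow> carrier (GG l) = {1..int l - 1}"
proof -
  assume "prime l"
  then interpret residues_prime l "residue_ring (int l)"
    by unfold_locales auto
  show ?thesis unfolding GG_def using \<open>prime l\<close>[THEN prime_gt_1_nat]
    by (simp add: units_of_carrier res_prime_units_eq of_nat_diff)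
qed

lemma mult_GG: "x \<otimes>\<^bsub>GG l\<^esub> y = (x * y) mod int l"
  by (simp add: GG_def units_of_def residue_ring_def)

lemma G_neg_eq: "prime l \<Longrightarrow> G_neg l x = (- x) mod int l"
proof -
  assume "prime l"
  then interpret residues_prime l "residue_ring (int l)"
    by unfold_locales auto
  show ?thesis unfolding G_neg_def by (rule res_neg_eq)
qed

lemma G_neg_in_carrier:
  assumes "prime l" "x \<in> carrier (GG l)"
  shows "G_neg l x \<in> carrier (GG l)"
proof -
  have x: "1 \<le> x" "x \<le> int l - 1" using assms by (auto simp: carrier_GG)
  then have "(- x) mod int l = int l - x"
    by (simp add: zmod_zminus1_eq_if)
  then show ?thesis using assms x by (simp add: G_neg_eq carrier_GG)
qed

lemma G_neg_mult:
  assumes "prime l"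
  shows "G_neg l (x \<otimes>\<^bsub>GG l\<^esub> y) = x \<otimes>\<^bsub>GG l\<^esub> G_neg l y"
  using assms by (simp add: G_neg_eq mult_GG mod_simps)

lemma subgroup_W_grp:
  assumes "prime l"
  shows "subgroup (W_grp l k) (GG l)"
proof -
  interpret comm_group "GG l" by (rule comm_group_GG[OF assms])
  have M: "M_set l k \<subseteq> carrier (GG l)" by (auto simp: M_set_def)
  show ?thesis
  proof (rule subgroupI)
    show "W_grp l k \<subseteq> carrier (GG l)" by (auto simp: W_grp_def)
    show "W_grp l k \<noteq> {}" using lcos_mult_one[OF M] by (auto simp: W_grp_def)
  next
    fix a assume "a \<in> W_grp l k"
    then have a: "a \<in> carrier (GG l)" "a <#\<^bsub>GG l\<^esub> M_set l k = M_set l k"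
      by (auto simp: W_grp_def)
    then have "inv\<^bsub>GG l\<^esub> a <#\<^bsub>GG l\<^esub> M_set l k
        = inv\<^bsub>GG l\<^esub> a <#\<^bsub>GG l\<^esub> (a <#\<^bsub>GG l\<^esub> M_set l k)" by simp
    also have "\<dots> = M_set l k" using a(1) M by (simp add: lcos_m_assoc lcos_mult_one)
    finally show "inv\<^bsub>GG l\<^esub> a \<in> W_grp l k" using a by (simp add: W_grp_def)
  next
    fix a b assume "a \<in> W_grp l k" "b \<in> W_grp l k"
    then show "a \<otimes>\<^bsub>GG l\<^esub> b \<in> W_grp l k"
      using M by (auto simp: W_grp_def lcos_m_assoc[symmetric])
  qed
qed

lemma E_fun_W_invariant:
  assumes "prime l" "w \<in> W_grp l k" "x \<in> carrier (GG l)"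
  shows "E_fun l k (w \<otimes>\<^bsub>GG l\<^esub> x) = E_fun l k x"
proof -
  interpret comm_group "GG l" by (rule comm_group_GG[OF assms(1)])
  have w: "w \<in> carrier (GG l)" "w <#\<^bsub>GG l\<^esub> M_set l k = M_set l k"
    using assms by (auto simp: W_grp_def)
  have M: "M_set l k \<subseteq> carrier (GG l)" by (auto simp: M_set_def)
  have "w \<otimes>\<^bsub>GG l\<^esub> x \<in> M_set l k \<longleftrightarrow> w \<otimes>\<^bsub>GG l\<^esub> x \<in> w <#\<^bsub>GG l\<^esub> M_set l k"
    by (simp add: w)
  also have "\<dots> \<longleftrightarrow> x \<in> M_set l k"
    using w(1) M assms(3) by (auto simp: l_coset_def subset_iff)
  finally show ?thesis by (simp add: E_fun_def)
qed

lemma D_entry_eq: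
  assumes "prime l" "C \<in> M_mod_W l k" "A \<in> M_mod_W l k" "c \<in> C" "a \<in> A"
  shows "D_entry l k C A = real (E_fun l k (G_neg l (inv\<^bsub>GG l\<^esub> c \<otimes>\<^bsub>GG l\<^esub> a))) - 1/2"
proof -
  interpret comm_group "GG l" by (rule comm_group_GG[OF assms(1)])
  interpret W: subgroup "W_grp l k" "GG l" by (rule subgroup_W_grp[OF assms(1)])
  have rep: "\<exists>w\<in>W_grp l k. y = w \<otimes>\<^bsub>GG l\<^esub> x"
    if X: "X \<in> M_mod_W l k" "x \<in> X" "y \<in> X" for X x y
  proof -
    from X obtain g where g: "g \<in> carrier (GG l)" "X = W_grp l k #>\<^bsub>GG l\<^esub> g"
      by (auto simp: M_mod_W_def RCOSETS_def)
    with X obtain u v where uv: "u \<in> W_grp l k" "v \<in> W_grp l k"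
      "x = u \<otimes>\<^bsub>GG l\<^esub> g" "y = v \<otimes>\<^bsub>GG l\<^esub> g"
      by (auto simp: r_coset_def)
    have "(v \<otimes>\<^bsub>GG l\<^esub> inv\<^bsub>GG l\<^esub> u) \<otimes>\<^bsub>GG l\<^esub> x
        = v \<otimes>\<^bsub>GG l\<^esub> ((inv\<^bsub>GG l\<^esub> u \<otimes>\<^bsub>GG l\<^esub> u) \<otimes>\<^bsub>GG l\<^esub> g)"
      using uv g by (simp add: m_assoc del: l_inv Units_l_inv)
    also have "\<dots> = y" using uv g by simp
    finally show ?thesis using uv by (intro bexI[of _ "v \<otimes>\<^bsub>GG l\<^esub> inv\<^bsub>GG l\<^esub> u"]) auto
  qed
  have sub: "x \<in> carrier (GG l)" if "X \<in> M_mod_W l k" "x \<in> X" for X x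
    using that by (auto simp: M_mod_W_def M_set_def)
  define c' a' where "c' = (SOME c. c \<in> C)" and "a' = (SOME a. a \<in> A)"
  have c': "c' \<in> C" and a': "a' \<in> A"
    unfolding c'_def a'_def using assms by (auto intro: someI)
  obtain u where u: "u \<in> W_grp l k" "c' = u \<otimes>\<^bsub>GG l\<^esub> c"
    using rep[OF assms(2,4) c'] by blast
  obtain v where v: "v \<in> W_grp l k" "a' = v \<otimes>\<^bsub>GG l\<^esub> a"
    using rep[OF assms(3,5) a'] by blast
  note car = sub[OF assms(2,4)] sub[OF assms(3,5)]
  have "inv\<^bsub>GG l\<^esub> c' \<otimes>\<^bsub>GG l\<^esub> a'
      = (inv\<^bsub>GG l\<^esub> u \<otimes>\<^bsub>GG l\<^esub> v) \<otimes>\<^bsub>GG l\<^esub> (inv\<^bsub>GG l\<^esub> c \<otimes>\<^bsub>GG l\<^esub> a)"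
    using u v car by (simp add: inv_mult m_ac)
  moreover have "inv\<^bsub>GG l\<^esub> u \<otimes>\<^bsub>GG l\<^esub> v \<in> W_grp l k" using u v by simp
  ultimately have "E_fun l k (G_neg l (inv\<^bsub>GG l\<^esub> c' \<otimes>\<^bsub>GG l\<^esub> a'))
      = E_fun l k (G_neg l (inv\<^bsub>GG l\<^esub> c \<otimes>\<^bsub>GG l\<^esub> a))"
    using car assms(1)
    by (simp add: G_neg_mult[of _ "inv\<^bsub>GG l\<^esub> u \<otimes>\<^bsub>GG l\<^esub> v"] E_fun_W_invariant
        G_neg_in_carrier)
  then show ?thesis by (simp add: D_entry_def c'_def a'_def)
qed

end

theory Submission
  imports "HOL-Complex_Analysis.Complex_Analysis" "HOL-Number_Theory.Number_Theory" Defs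
begin

text \<open>
  Put \<open>F = E\<^sub>k - 1/2\<close>, an odd function on \<open>G\<close>. Since \<open>F(a) = B(a) + B(ka) - B((k+1)a)\<close> with
  \<open>B(a) = \<langle>a\<rangle>/l - 1/2\<close>, the Fourier coefficient of \<open>F\<close> at an odd character \<open>\<chi>\<close> is
  \<open>(1 + \<chi>(k)\<^sup>-\<^sup>1 - \<chi>(k+1)\<^sup>-\<^sup>1) B\<^sub>\<chi>\<close>, where \<open>B\<^sub>\<chi> \<noteq> 0\<close> because \<open>L(1, \<chi>) \<noteq> 0\<close>. Two roots of unity
  satisfy \<open>1 + u = v\<close> only if \<open>u\<close> is a primitive cube root of unity and \<open>v = -u\<^sup>2\<close>, so the coefficient
  vanishes iff \<open>\<chi>(-k\<^sup>2 - k) = 1\<close> and \<open>\<chi>(k)\<close> has order 3. Writing \<open>\<chi> = \<chi>\<^sub>1\<^sup>t\<close> for a generator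
  \<open>\<chi>\<^sub>1\<close> of the character group, this is a divisibility condition on \<open>t\<close> (called \<open>bad t\<close> below). The same
  condition describes \<open>\<F>\<^sub>0\<close>, because the kernel of \<open>\<chi>\<^sub>1\<^sup>f\<close> is \<open>H\<^sub>f\<close>; and when \<open>W\<^sub>k\<close> is trivial, i.e. when
  \<open>k\<close> is not a primitive cube root of unity, the corank of \<open>D\<^sub>k\<close> is the number of bad \<open>t < l - 1\<close>.
\<close>

unbundle no vec_syntax
hide_const (open) Determinants.det

section \<open>Dirichlet series and non-vanishing at 1\<close>

text \<open>The element -k^2 - k comes from v = -u^2: once u^3 = 1 this says -uv = 1, and for an odd
  character the sign is the value at -1, so -uv is the value at -k(k+1). Non-vanishing of the
  moments of odd characters takes two arguments: the 3-4-1 inequality needs \<chi>^2 to be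
  non-trivial, so that its L-function has no pole at 1, and quadratic \<chi> are treated by parity.

  Averaging over H_f keeps exactly the coefficients at exponents divisible by f, and W_{k,f} is the
  common kernel of the surviving characters. If the exponent f survives, this kernel is H_f; if f is
  bad, all surviving exponents are multiples of 3f and 3f survives, so it is H_{3f}.

  D_k is convolution by an odd function on G modulo sign and W_k, so only odd characters trivial on
  W_k act on it. If k is a primitive cube root of unity, W_k = H_3 contains k, and no character
  trivial on k is bad: the determinant is non-zero although F_0 contains 1. Otherwise the bad
  exponents, if any, are (N_k/3) s with s prime to 6; there are (l - 1)/N_k of them below l - 1,
  whence the factor 1 - 2/N_k.\<close>

lemma norm_powr_diff_Suc_le:
  fixes s :: complex
  assumes "Re s > 0" "n > 0"
  shows "norm (of_nat n powr (-s) - of_nat (Suc n) powr (-s)) \<le> norm s * real n powr (- Re s - 1)"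
proof -
  let ?S = "closed_segment (of_real (real n) :: complex) (of_real (real (Suc n)))"
  have S: "\<exists>x. z = of_real x \<and> real n \<le> x" if "z \<in> ?S" for z
    using that unfolding closed_segment_of_real by (auto simp: closed_segment_eq_real_ivl)
  have "norm (of_real (real n) powr (-s) - of_real (real (Suc n)) powr (-s)) \<le>
     (norm s * real n powr (- Re s - 1)) * norm (of_real (real n) - of_real (real (Suc n)) :: complex)"
  proof (rule field_differentiable_bound[where S = "?S" and f' = "\<lambda>z. - s * z powr (-s - 1)"])
    fix z assume "z \<in> ?S"
    then obtain x where x: "z = of_real x" "real n \<le> x" using S by blast
    with assms have x0: "x > 0" by (auto intro: less_le_trans)
    then have nz: "z \<notin> \<real>\<^sub>\<le>\<^sub>0" using x by simp
    show "((\<lambda>z. z powr - s) has_field_derivative - s * z powr (- s - 1)) (at z within ?S)"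
      by (rule has_field_derivative_at_within[OF has_field_derivative_powr[OF nz]])
    have "norm (z powr (-s - 1)) = x powr (- Re s - 1)"
      using x x0 by (simp add: norm_powr_real_powr)
    also have "\<dots> \<le> real n powr (- Re s - 1)"
      using x assms by (intro powr_mono2') auto
    finally show "norm (- s * z powr (- s - 1)) \<le> norm s * real n powr (- Re s - 1)"
      by (simp add: norm_mult mult_left_mono)
  qed auto
  then show ?thesis by simp
qed

lemma DERIV_nat_powr_minus:
  assumes "n > 0"
  shows "((\<lambda>s. of_nat n powr (-s) :: complex) has_field_derivative
           - (of_real (ln (real n)) * of_nat n powr (-s))) (at s)"
proof -
  have "((\<lambda>s. exp (-s * of_real (ln (real n))) :: complex) has_field_derivative
           - (of_real (ln (real n)) * exp (-s * of_real (ln (real n))))) (at s)"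
    by (rule derivative_eq_intros refl | simp)+
  then show ?thesis using assms by (simp add: powr_def Ln_of_nat)
qed

text \<open>Abel summation, used below for \<open>b\<close> a power of the index and for
  \<open>b n = r ^ n\<close>; in both cases the partial sums of \<open>a\<close> are under control
  while the series may converge only conditionally.\<close>

lemma sum_by_parts:
  fixes a b :: "nat \<Rightarrow> 'a :: comm_ring"
  shows "(\<Sum>k<N. a k * b k) = (\<Sum>k<N. sum a {..k} * (b k - b (Suc k))) + sum a {..<N} * b N"
  by (induction N) (simp_all add: algebra_simps lessThan_Suc_atMost[symmetric])

text \<open>Summation by parts turns a possibly conditionally convergent series into one with terms
  of size at most \<open>B * norm s * real (Suc n) powr (- Re s - 1)\<close>, which is dominated on
  small balls in the half-plane. The shift to \<open>Suc n\<close> keeps 0 out of the base of the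
  powers.\<close>

lemma dirichlet_series_bounded_sums:
  fixes a :: "nat \<Rightarrow> complex"
  assumes bd: "\<And>N. norm (sum a {..N}) \<le> B"
  obtains F where "F holomorphic_on {s. Re s > 0}"
    "\<And>s. Re s > 0 \<Longrightarrow> (\<lambda>n. a n * of_nat (Suc n) powr (-s)) sums F s"
proof -
  define f where "f = (\<lambda>n s. sum a {..n} * (of_nat (Suc n) powr (-s) - of_nat (Suc (Suc n)) powr (-s)) :: complex)"
  have B: "B \<ge> 0" using bd[of 0] norm_ge_zero order_trans by blast
  have op: "open {s. Re s > 0}" by (simp add: open_halfspace_Re_gt)
  have df: "f n field_differentiable at s" for n s
  proof -
    have "(\<lambda>s. of_nat (Suc j) powr (-s) :: complex) field_differentiable at s" for j
      using DERIV_nat_powr_minus[of "Suc j"] unfolding field_differentiable_def by blast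
    then show ?thesis unfolding f_def by (intro derivative_intros)
  qed
  obtain F where F: "\<And>s. Re s > 0 \<Longrightarrow> (\<lambda>n. f n s) sums F s \<and> F field_differentiable (at s)"
  proof (rule series_differentiable_comparison_complex[OF op, of f])
    fix x :: complex assume x: "x \<in> {s. Re s > 0}"
    define h where "h = (\<lambda>n. of_real (B * ((norm x + Re x) * real (Suc n) powr (- (Re x / 2) - 1))) :: complex)"
    have bound: "norm (f n y) \<le> norm (h n)" if y: "y \<in> ball x (Re x / 2)" for n y
    proof -
      have "\<bar>Re (x - y)\<bar> \<le> norm (x - y)" by (rule abs_Re_le_cmod)
      then have Re: "Re y > Re x / 2" using y x by (auto simp: dist_norm)
      have "norm y \<le> norm x + norm (x - y)" by (metis norm_minus_commute norm_triangle_sub add.commute)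
      then have ny: "norm y \<le> norm x + Re x" using y x by (auto simp: dist_norm)
      have "norm (f n y) \<le> B * (norm y * real (Suc n) powr (- Re y - 1))"
        unfolding f_def norm_mult using x Re
        by (intro mult_mono bd norm_powr_diff_Suc_le B) auto
      also have "\<dots> \<le> B * ((norm x + Re x) * real (Suc n) powr (- (Re x / 2) - 1))"
        using Re ny B x by (intro mult_left_mono mult_mono powr_mono) auto
      also have "\<dots> = norm (h n)" unfolding h_def norm_of_real using B x by simp
      finally show ?thesis .
    qed
    have "summable (\<lambda>n. real (Suc n) powr (- (Re x / 2) - 1))"
      using x by (subst summable_Suc_iff) (simp add: summable_real_powr_iff)
    then have "summable h" unfolding h_def by (intro summable_of_real summable_mult)
    then show "\<exists>d h. 0 < d \<and> summable h \<and> range h \<subseteq> \<real>\<^sub>\<ge>\<^sub>0 \<and>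
        (\<forall>\<^sub>F n in sequentially. \<forall>y\<in>ball x d \<inter> {s. 0 < Re s}. cmod (f n y) \<le> cmod (h n))"
      using x bound B by (intro exI[of _ "Re x / 2"] exI[of _ h]) (auto simp: h_def)
  qed (auto simp: df)
  show ?thesis
  proof (rule that[of F])
    show "F holomorphic_on {s. Re s > 0}"
      using F by (auto simp: holomorphic_on_def intro: field_differentiable_at_within)
    fix s :: complex assume s: "Re s > 0"
    let ?b = "\<lambda>n. of_nat (Suc n) powr (-s) :: complex"
    have "(\<lambda>N. (\<Sum>n<N. f n s)) \<longlonglongrightarrow> F s" using F s by (simp add: sums_def)
    moreover have "(\<lambda>N. sum a {..<N} * ?b N) \<longlonglongrightarrow> 0"
    proof (rule Lim_null_comparison)
      show "\<forall>\<^sub>F N in sequentially. norm (sum a {..<N} * ?b N) \<le> B * real (Suc N) powr (- Re s)"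
      proof (rule always_eventually, rule allI)
        fix N
        have "norm (sum a {..<N}) \<le> B"
          using bd[of "N - 1"] B by (cases N) (auto simp: lessThan_Suc_atMost)
        then show "norm (sum a {..<N} * ?b N) \<le> B * real (Suc N) powr (- Re s)"
          by (simp only: norm_mult) (simp add: norm_powr_real_powr mult_right_mono)
      qed
      have "(\<lambda>N. real (Suc N) powr (- Re s)) \<longlonglongrightarrow> 0"
        using s by real_asymp
      then show "(\<lambda>N. B * real (Suc N) powr (- Re s)) \<longlonglongrightarrow> 0"
        by (rule tendsto_mult_right_zero)
    qed
    ultimately have "(\<lambda>N. (\<Sum>n<N. f n s) + sum a {..<N} * ?b N) \<longlonglongrightarrow> F s + 0"
      by (rule tendsto_add)
    then show "(\<lambda>n. a n * ?b n) sums F s"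
      unfolding sums_def f_def by (subst sum_by_parts) simp
  qed
qed

section \<open>Absolutely convergent Dirichlet series and their logarithmic derivatives\<close>

lemma norm_dirichlet_term_le:
  fixes c s :: complex
  assumes "norm c \<le> 1"
  shows "norm (c * of_nat n powr (-s)) \<le> real n powr (- Re s)"
  using assms by (simp add: norm_mult norm_powr_real_powr mult_left_le_one_le)

lemma summable_norm_dirichlet:
  fixes f :: "nat \<Rightarrow> complex"
  assumes "\<And>n. norm (f n) \<le> 1" "Re s > 1"
  shows "summable (\<lambda>n. norm (f n * of_nat n powr (-s)))"
proof (rule summable_comparison_test')
  show "summable (\<lambda>n. real n powr (- Re s))" using assms(2) by (simp add: summable_real_powr_iff)
  show "norm (norm (f n * of_nat n powr (-s))) \<le> real n powr (- Re s)" for n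
    using norm_dirichlet_term_le[OF assms(1)] by simp
qed

lemma summable_norm_dirichlet_ln:
  fixes f :: "nat \<Rightarrow> complex"
  assumes "\<And>n. norm (f n) \<le> ln (real n)" "f 0 = 0" "Re s > 1"
  shows "summable (\<lambda>n. norm (f n * of_nat n powr (-s)))"
proof (rule summable_comparison_test')
  \<comment> \<open>Half of the room above 1 pays for the logarithm via
    \<open>ln n \<le> n powr a / a\<close>; the other half keeps the series convergent.\<close>
  define a where "a = (Re s - 1) / 2"
  have a: "a > 0" "- Re s + a < -1" using assms(3) by (auto simp: a_def field_simps)
  show "summable (\<lambda>n. real n powr (- Re s + a) / a)"
    using a by (intro summable_divide) (simp add: summable_real_powr_iff)
  show "norm (norm (f n * of_nat n powr (-s))) \<le> real n powr (- Re s + a) / a" for n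
  proof (cases "n = 0")
    case False
    have "norm (f n * of_nat n powr (-s)) \<le> ln (real n) * real n powr (- Re s)"
      using assms(1)[of n] by (simp add: norm_mult norm_powr_real_powr mult_right_mono)
    also have "\<dots> \<le> (real n powr a / a) * real n powr (- Re s)"
      using a False by (intro mult_right_mono ln_powr_bound) auto
    finally show ?thesis by (simp add: powr_diff powr_minus field_simps)
  qed (use assms(2) in auto)
qed

lemma summable_norm_mangoldt_series:
  fixes f :: "nat \<Rightarrow> complex"
  assumes f: "\<And>n. norm (f n) \<le> 1" and s: "Re s > 1"
  shows "summable (\<lambda>n. norm (f n * mangoldt n * of_nat n powr (-s)))"
proof (rule summable_norm_dirichlet_ln[OF _ _ s])
  fix n :: nat
  show "norm (f n * mangoldt n) \<le> ln (real n)"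
  proof (cases "n = 0")
    case False
    have "norm (f n) * mangoldt n \<le> 1 * mangoldt n"
      using f mangoldt_nonneg by (intro mult_right_mono)
    also have "\<dots> \<le> ln (real n)" using mangoldt_le[of n] False by simp
    finally show ?thesis by (simp add: norm_mult)
  qed simp
qed simp

text \<open>Dominating the terms themselves on a small ball suffices, since locally uniform limits
  of holomorphic functions may be differentiated term by term.\<close>

lemma DERIV_dirichlet:
  fixes f :: "nat \<Rightarrow> complex"
  assumes f: "\<And>n. norm (f n) \<le> 1" and s: "Re s > 1"
  shows "((\<lambda>s. \<Sum>n. f n * of_nat n powr (-s)) has_field_derivative
           - (\<Sum>n. f n * of_real (ln (real n)) * of_nat n powr (-s))) (at s)"
proof -
  let ?S = "{s :: complex. Re s > 1}"
  have op: "open ?S" by (simp add: open_halfspace_Re_gt)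
  have "\<exists>g g'. \<forall>x \<in> ?S. ((\<lambda>n. f n * of_nat n powr (-x)) sums g x) \<and>
     ((\<lambda>n. - (f n * of_real (ln (real n)) * of_nat n powr (-x))) sums g' x) \<and> (g has_field_derivative g' x) (at x)"
  proof (rule series_and_derivative_comparison_local[OF op])
    fix n and x :: complex
    show "((\<lambda>x. f n * of_nat n powr (-x)) has_field_derivative
             - (f n * of_real (ln (real n)) * of_nat n powr (-x))) (at x)"
    proof (cases "n = 0")
      case False
      then show ?thesis
        using DERIV_cmult[OF DERIV_nat_powr_minus, of n "f n" x] by (simp add: mult.assoc)
    qed simp
  next
    fix x :: complex assume x: "x \<in> ?S"
    define d where "d = (Re x - 1) / 2"
    have d: "d > 0" "- (Re x - d) < -1" using x by (auto simp: d_def field_simps)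
    show "\<exists>d h. 0 < d \<and> summable h \<and> (\<forall>\<^sub>F n in sequentially. \<forall>y\<in>ball x d \<inter> ?S. norm (f n * of_nat n powr (-y)) \<le> h n)"
    proof (intro exI conjI always_eventually allI ballI)
      show "summable (\<lambda>n. real n powr (- (Re x - d)))" using d by (simp add: summable_real_powr_iff)
      fix n y assume y: "y \<in> ball x d \<inter> ?S"
      have "\<bar>Re (x - y)\<bar> \<le> norm (x - y)" by (rule abs_Re_le_cmod)
      then have "Re y \<ge> Re x - d" using y by (auto simp: dist_norm)
      then have "real n powr (- Re y) \<le> real n powr (- (Re x - d))"
        by (cases "n = 0") (auto intro: powr_mono)
      then show "norm (f n * of_nat n powr (-y)) \<le> real n powr (- (Re x - d))"
        using norm_dirichlet_term_le[OF f, of n n y] by linarith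
    qed (rule d)
  qed
  then obtain g g' where g: "\<And>x. Re x > 1 \<Longrightarrow> (\<lambda>n. f n * of_nat n powr (-x)) sums g x"
    "\<And>x. Re x > 1 \<Longrightarrow> (\<lambda>n. - (f n * of_real (ln (real n)) * of_nat n powr (-x))) sums g' x"
    "\<And>x. Re x > 1 \<Longrightarrow> (g has_field_derivative g' x) (at x)" by blast
  have "g' s = - (\<Sum>n. f n * of_real (ln (real n)) * of_nat n powr (-s))"
    using g(2)[OF s, THEN sums_minus] by (simp add: sums_iff)
  then have "(g has_field_derivative - (\<Sum>n. f n * of_real (ln (real n)) * of_nat n powr (-s))) (at s)"
    using g(3)[OF s] by simp
  then show ?thesis
    by (rule has_field_derivative_transform_within_open[OF _ op]) (use s g(1) in \<open>auto simp: sums_iff\<close>)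
qed

lemma has_sum_product:
  fixes u :: "'a \<Rightarrow> complex" and v :: "'b \<Rightarrow> complex"
  assumes "(\<lambda>x. norm (u x)) summable_on A" "(\<lambda>y. norm (v y)) summable_on B" "(u has_sum U) A" "(v has_sum V) B"
  shows "((\<lambda>(x, y). u x * v y) has_sum (U * V)) (A \<times> B)"
proof (rule has_sum_SigmaI)
  show "((\<lambda>y. case (x, y) of (x, y) \<Rightarrow> u x * v y) has_sum (u x * V)) B" for x
    using has_sum_cmult_right[OF assms(4)] by simp
  show "((\<lambda>x. u x * V) has_sum (U * V)) A" by (rule has_sum_cmult_left[OF assms(3)])
  have "(\<lambda>z. norm (case z of (x, y) \<Rightarrow> u x * v y)) summable_on (A \<times> B)"
    unfolding Infinite_Sum.abs_summable_on_Sigma_iff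
    using assms(1,2)
    by (auto simp: norm_mult infsum_cmult_right' infsum_nonneg abs_mult
        intro!: summable_on_cmult_left summable_on_cmult_right)
  then show "(\<lambda>(x, y). u x * v y) summable_on (A \<times> B)" by (rule Infinite_Sum.abs_summable_summable)
qed

text \<open>The identity L * (-L'/L) = -L' in coefficients: a completely multiplicative
  \<open>f\<close> factors out of the convolution, and what remains is the divisor sum of
  \<open>mangoldt\<close>, equal to \<open>ln N\<close>. The double series is regrouped by the
  product N of the two indices.\<close>

lemma mangoldt_convolution:
  fixes f :: "nat \<Rightarrow> complex"
  assumes mult: "\<And>m n. f (m * n) = f m * f n" and f: "\<And>n. norm (f n) \<le> 1" and s: "Re s > 1"
  shows "(\<Sum>n. f n * of_nat n powr (-s)) * (\<Sum>n. f n * mangoldt n * of_nat n powr (-s)) =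
         (\<Sum>n. f n * of_real (ln (real n)) * of_nat n powr (-s))"
proof -
  define u where "u = (\<lambda>n. f n * mangoldt n * of_nat n powr (-s))"
  define v where "v = (\<lambda>n. f n * of_nat n powr (-s))"
  have su: "summable (\<lambda>n. norm (u n))" unfolding u_def by (rule summable_norm_mangoldt_series[OF f s])
  have sv: "summable (\<lambda>n. norm (v n))" unfolding v_def by (rule summable_norm_dirichlet[OF f s])
  have hu: "(u has_sum suminf u) UNIV" and hv: "(v has_sum suminf v) UNIV"
    using su sv by (auto intro!: norm_summable_imp_has_sum summable_sums summable_norm_cancel)
  have au: "(\<lambda>n. norm (u n)) summable_on UNIV" and av: "(\<lambda>n. norm (v n)) summable_on UNIV"
    using su sv by (auto intro!: norm_summable_imp_summable_on)
  have "((\<lambda>(d, m). u d * v m) has_sum (suminf u * suminf v)) (UNIV \<times> UNIV)"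
    by (rule has_sum_product[OF au av hu hv])
  \<comment> \<open>Index 0 is dropped, where all terms vanish: 0 has infinitely many divisors, and
    a pair is recovered from its product and first factor only for positive indices.\<close>
  then have "((\<lambda>(d, m). u d * v m) has_sum (suminf u * suminf v)) ({1..} \<times> {1..})"
    by (rule has_sum_cong_neutral[THEN iffD1, rotated -1]) (auto simp: u_def v_def not_le)
  then have "((\<lambda>(N, d). u d * v (N div d)) has_sum (suminf u * suminf v)) (Sigma {1..} (\<lambda>N. {d. d dvd N}))"
    by (rule has_sum_reindex_bij_witness[where i = "\<lambda>(N, d). (d, N div d)" and j = "\<lambda>(d, m). (d * m, d)", THEN iffD1, rotated -1])
       (auto elim!: dvdE)
  moreover have "((\<lambda>d. case (N, d) of (N, d) \<Rightarrow> u d * v (N div d)) has_sum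
        (f N * of_real (ln (real N)) * of_nat N powr (-s))) {d. d dvd N}" if "N \<in> {1..}" for N
  proof -
    have N: "N > 0" using that by simp
    have "u d * v (N div d) = f N * of_nat N powr (-s) * mangoldt d" if "d dvd N" for d
      using that
    proof (elim dvdE)
      fix m assume m: "N = d * m"
      have "(of_nat (d * m) :: complex) powr (-s) = of_nat d powr (-s) * of_nat m powr (-s)"
        unfolding of_nat_mult by (rule powr_times_real) auto
      then show ?thesis using m N by (simp add: u_def v_def mult del: of_nat_mult)
    qed
    then have "(\<Sum>d | d dvd N. u d * v (N div d)) = f N * of_nat N powr (-s) * (\<Sum>d | d dvd N. mangoldt d)"
      by (simp add: sum_distrib_left)
    also have "\<dots> = f N * of_real (ln (real N)) * of_nat N powr (-s)"
      using N by (simp add: mangoldt_sum)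
    finally show ?thesis using has_sum_finite[of "{d. d dvd N}" "\<lambda>d. u d * v (N div d)"] N by simp
  qed
  ultimately have "((\<lambda>N. f N * of_real (ln (real N)) * of_nat N powr (-s)) has_sum (suminf u * suminf v)) {1..}"
    by (rule has_sum_SigmaD)
  then have "((\<lambda>N. f N * of_real (ln (real N)) * of_nat N powr (-s)) has_sum (suminf u * suminf v)) UNIV"
    by (rule has_sum_cong_neutral[THEN iffD1, rotated -1]) (auto simp: not_le)
  then show ?thesis
    by (simp add: u_def v_def mult.commute sums_iff has_sum_imp_sums sums_unique[OF has_sum_imp_sums])
qed

text \<open>The squared norm is differentiable even at zeros of the series, so no logarithm has to
  be chosen. Its derivative is 2 Re (cnj L * L'), and L' is -L times the \<open>mangoldt\<close>
  series by the convolution identity.\<close>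

lemma DERIV_norm_dirichlet_sq:
  fixes f :: "nat \<Rightarrow> complex" and x :: real
  assumes mult: "\<And>m n. f (m * n) = f m * f n" and f: "\<And>n. norm (f n) \<le> 1" and x: "x > 1"
  shows "((\<lambda>x. (norm (\<Sum>n. f n * of_nat n powr (- of_real x)))\<^sup>2) has_real_derivative
          - 2 * (norm (\<Sum>n. f n * of_nat n powr (- of_real x)))\<^sup>2 * Re (\<Sum>n. f n * mangoldt n * of_nat n powr (- of_real x))) (at x)"
proof -
  define L where "L = (\<lambda>s. \<Sum>n. f n * of_nat n powr (-s))"
  define La where "La = (\<Sum>n. f n * mangoldt n * of_nat n powr (- of_real x))"
  have "(L has_field_derivative - (L (of_real x) * La)) (at (of_real x))"
    using DERIV_dirichlet[OF f, of "of_real x"] mangoldt_convolution[OF mult f, of "of_real x"] x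
    unfolding L_def La_def by simp
  then have v: "((\<lambda>x. L (of_real x)) has_vector_derivative - (L (of_real x) * La)) (at x)"
    by (rule has_vector_derivative_real_field)
  have r: "((\<lambda>x. Re (L (of_real x))) has_real_derivative Re (- (L (of_real x) * La))) (at x)"
    using bounded_linear.has_vector_derivative[OF bounded_linear_Re v]
    by (simp add: has_real_derivative_iff_has_vector_derivative)
  have i: "((\<lambda>x. Im (L (of_real x))) has_real_derivative Im (- (L (of_real x) * La))) (at x)"
    using bounded_linear.has_vector_derivative[OF bounded_linear_Im v]
    by (simp add: has_real_derivative_iff_has_vector_derivative)
  have "((\<lambda>x. (Re (L (of_real x)))\<^sup>2 + (Im (L (of_real x)))\<^sup>2) has_real_derivative
         - 2 * (norm (L (of_real x)))\<^sup>2 * Re La) (at x)"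
    using DERIV_add[OF DERIV_power[OF r, of 2] DERIV_power[OF i, of 2]]
    by (rule DERIV_cong) (simp only: cmod_power2, simp add: algebra_simps power2_eq_square)
  then show ?thesis by (simp add: L_def La_def cmod_power2)
qed

text \<open>Comparison with the integral of y^(-x) from 1 gives 1 + 1/(x - 1). This controls both
  the pole of the zeta function at 1 and its tail at 3.\<close>

lemma zeta_real_le:
  fixes x :: real
  assumes x: "x > 1"
  shows "summable (\<lambda>n. real n powr (-x))" "(\<Sum>n. real n powr (-x)) \<le> x / (x - 1)"
proof -
  show S: "summable (\<lambda>n. real n powr (-x))" using x by (simp add: summable_real_powr_iff)
  \<comment> \<open>Mean value theorem for y^(1 - x) between n and n + 1; the right-hand sides
    telescope.\<close>
  have step: "real (Suc n) powr (-x) \<le> (real n powr (1 - x) - real (Suc n) powr (1 - x)) / (x - 1)"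
    if "n > 0" for n
  proof -
    have "\<exists>z. real n < z \<and> z < real (Suc n) \<and>
       real (Suc n) powr (1 - x) - real n powr (1 - x) = (real (Suc n) - real n) * ((1 - x) * z powr (- x))"
    proof (rule MVT2)
      fix y assume "real n \<le> y"
      then have "y > 0" using that by (auto intro: less_le_trans)
      then show "((\<lambda>y. y powr (1 - x)) has_real_derivative (1 - x) * y powr (- x)) (at y)"
        using has_real_derivative_powr[of y "1 - x"] by simp
    qed simp
    then obtain z where z: "real n < z" "z < real (Suc n)"
      "real n powr (1 - x) - real (Suc n) powr (1 - x) = (x - 1) * z powr (- x)"
      by (auto simp: algebra_simps)
    have "real (Suc n) powr (-x) \<le> z powr (-x)"
      using z x that by (intro powr_mono2') (auto intro: less_trans)
    then show ?thesis using z x by simp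
  qed
  have "(\<Sum>n<Suc (Suc N). real n powr (-x)) \<le> 1 + (1 - real (Suc N) powr (1 - x)) / (x - 1)" for N
  proof (induction N)
    case (Suc N)
    then show ?case using step[of "Suc N"] by (simp add: diff_divide_distrib)
  qed (simp add: lessThan_Suc)
  moreover have "1 + (1 - real (Suc N) powr (1 - x)) / (x - 1) \<le> x / (x - 1)" for N
    using x by (simp add: field_simps)
  ultimately have bd: "(\<Sum>n<Suc (Suc N). real n powr (-x)) \<le> x / (x - 1)" for N
    using order_trans by blast
  have "(\<Sum>n<N. real n powr (-x)) \<le> x / (x - 1)" for N
    by (rule order_trans[OF sum_mono2 bd[of N]]) auto
  then show "(\<Sum>n. real n powr (-x)) \<le> x / (x - 1)"
    using S by (intro suminf_le_const) auto
qed

text \<open>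
  The logarithmic derivative of the product is \<open>-2 \<Sum> \<Lambda>(n) n\<^sup>-\<^sup>x (3 + 4 cos \<theta>\<^sub>n + cos 2\<theta>\<^sub>n) \<le> 0\<close>
  with \<open>f n = e\<^bsup>i\<theta>\<^sub>n\<^esup>\<close>. If \<open>f\<close> had \<open>L(1) = 0\<close>, the product would tend to 0 at 1.
\<close>

lemma three_four_one_antimono:
  fixes f :: "nat \<Rightarrow> complex" and x y :: real
  assumes mult: "\<And>m n. f (m * n) = f m * f n" and f01: "\<And>n. f n = 0 \<or> norm (f n) = 1"
    and xy: "1 < x" "x \<le> y"
  defines "P \<equiv> \<lambda>h (x::real). (norm (\<Sum>n. (h n :: complex) * of_nat n powr (- of_real x)))\<^sup>2"
  shows "P (\<lambda>_. 1) y ^ 3 * P f y ^ 4 * P (\<lambda>n. f n ^ 2) y \<le> P (\<lambda>_. 1) x ^ 3 * P f x ^ 4 * P (\<lambda>n. f n ^ 2) x"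
proof (rule DERIV_nonpos_imp_nonincreasing[OF xy(2)])
  fix t assume "x \<le> t"
  then have t: "t > 1" using xy by simp
  define La where "La = (\<lambda>h. \<Sum>n. (h n :: complex) * mangoldt n * of_nat n powr (- of_real t))"
  have f: "norm (f n) \<le> 1" for n using f01[of n] by auto
  then have f2: "norm (f n ^ 2) \<le> 1" for n by (simp add: norm_power power_le_one)
  have D: "(P h has_real_derivative - 2 * P h t * Re (La h)) (at t)"
    if "\<And>m n. h (m * n) = h m * h n" "\<And>n. norm (h n) \<le> 1" for h
    unfolding P_def La_def by (rule DERIV_norm_dirichlet_sq[OF that t])
  have D1: "(P (\<lambda>_. 1) has_real_derivative - 2 * P (\<lambda>_. 1) t * Re (La (\<lambda>_. 1))) (at t)"
    by (rule D) auto
  have Df: "(P f has_real_derivative - 2 * P f t * Re (La f)) (at t)"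
    by (rule D[OF mult f])
  have D2: "(P (\<lambda>n. f n ^ 2) has_real_derivative - 2 * P (\<lambda>n. f n ^ 2) t * Re (La (\<lambda>n. f n ^ 2))) (at t)"
    by (rule D[OF _ f2]) (simp add: mult power_mult_distrib)
  let ?Q = "P (\<lambda>_. 1) t ^ 3 * P f t ^ 4 * P (\<lambda>n. f n ^ 2) t"
  let ?K = "3 * Re (La (\<lambda>_. 1)) + 4 * Re (La f) + Re (La (\<lambda>n. f n ^ 2))"
  have "((\<lambda>x. P (\<lambda>_. 1) x ^ 3 * P f x ^ 4 * P (\<lambda>n. f n ^ 2) x) has_real_derivative - 2 * ?Q * ?K) (at t)"
    using DERIV_mult[OF DERIV_mult[OF DERIV_power[OF D1, of 3] DERIV_power[OF Df, of 4]] D2]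
    by (rule DERIV_cong) (simp add: algebra_simps power_numeral_reduce)
  moreover have "?K \<ge> 0"
  proof -
    define c where "c = (\<lambda>n. mangoldt n * real n powr (-t) :: real)"
    have S: "(\<lambda>n. Re (h n) * c n) sums Re (La h)" if "\<And>n. norm (h n) \<le> 1" for h
    proof -
      have "(\<lambda>n. h n * mangoldt n * of_nat n powr (- of_real t)) sums La h"
        unfolding La_def using summable_norm_mangoldt_series[of h "of_real t"] that t
        by (simp add: summable_sums summable_norm_cancel)
      then have "(\<lambda>n. Re (h n * mangoldt n * of_nat n powr (- of_real t))) sums Re (La h)"
        by (rule sums_Re)
      moreover have "Re (h n * mangoldt n * of_nat n powr (- of_real t)) = Re (h n) * c n" for n
      proof -
        have "h n * mangoldt n * of_nat n powr (- of_real t) = of_real (c n) * h n"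
          using powr_of_real[of "real n" "-t"] by (simp add: c_def mult_ac)
        then show ?thesis by (simp only: Re_complex_of_real times_complex.sel Im_complex_of_real) simp
      qed
      ultimately show ?thesis by (simp only:)
    qed
    have sK: "(\<lambda>n. 3 * (Re 1 * c n) + 4 * (Re (f n) * c n) + Re (f n ^ 2) * c n) sums ?K"
      by (intro sums_add sums_mult S f f2) auto
    have "0 \<le> 3 * (Re 1 * c n) + 4 * (Re (f n) * c n) + Re (f n ^ 2) * c n" for n
    proof -
      have "0 \<le> 3 + 4 * Re (f n) + Re (f n ^ 2)"
      proof (cases "f n = 0")
        case False
        then have "norm (f n) = 1" using f01[of n] by simp
        then have "(Re (f n))\<^sup>2 + (Im (f n))\<^sup>2 = 1" by (metis cmod_power2 one_power2)
        then have "3 + 4 * Re (f n) + Re (f n ^ 2) = 2 * (1 + Re (f n))\<^sup>2"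
          by (simp add: power2_eq_square algebra_simps)
        then show ?thesis by simp
      qed simp
      moreover have "c n \<ge> 0" by (simp add: c_def mangoldt_nonneg)
      ultimately have "0 \<le> (3 + 4 * Re (f n) + Re (f n ^ 2)) * c n" by simp
      then show ?thesis by (simp add: algebra_simps)
    qed
    then show ?thesis by (rule sums_le[OF _ sums_zero sK])
  qed
  moreover have "?Q \<ge> 0" by (simp add: P_def)
  ultimately show "\<exists>D. ((\<lambda>x. P (\<lambda>_. 1) x ^ 3 * P f x ^ 4 * P (\<lambda>n. f n ^ 2) x) has_real_derivative D) (at t) \<and> D \<le> 0"
    by (intro exI[of _ "- 2 * ?Q * ?K"]) (simp add: mult_nonneg_nonneg)
qed

text \<open>The term at 1 equals 1 and the term at 0 vanishes, while the rest is at most 3/2 - 1.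
  The point 3 works because x/(x - 1) - 1 = 1/(x - 1) is below 1 there; it is the reference point at
  which the monotone product is positive.\<close>

lemma dirichlet_series_at_3_nonzero:
  fixes f :: "nat \<Rightarrow> complex"
  assumes f: "\<And>n. norm (f n) \<le> 1" and f1: "f 1 = 1"
  shows "(\<Sum>n. f n * of_nat n powr (- of_real 3)) \<noteq> 0"
proof
  assume 0: "(\<Sum>n. f n * of_nat n powr (- of_real 3)) = 0"
  let ?t = "\<lambda>n. f n * of_nat n powr (- of_real 3)"
  have s3: "Re (of_real 3) > 1" by simp
  have sn: "summable (\<lambda>n. norm (?t n))" using summable_norm_dirichlet[OF f s3] .
  have "suminf ?t = (\<Sum>n. ?t (n + 2)) + sum ?t {..<2}"
    by (rule suminf_split_initial_segment) (rule summable_norm_cancel[OF sn])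
  moreover have "sum ?t {..<2} = 1" using f1 by (simp add: numeral_2_eq_2)
  ultimately have "norm (\<Sum>n. ?t (n + 2)) = 1" using 0 by (simp add: eq_neg_iff_add_eq_0[symmetric])
  moreover have "norm (\<Sum>n. ?t (n + 2)) \<le> (\<Sum>n. real (n + 2) powr (- 3))"
  proof (rule norm_suminf_le)
    show "norm (?t (n + 2)) \<le> real (n + 2) powr (- 3)" for n
      using norm_dirichlet_term_le[OF f, of "n + 2" "n + 2" "of_real 3"] by simp
    show "summable (\<lambda>n. real (n + 2) powr (- 3))"
      using summable_ignore_initial_segment[OF zeta_real_le(1)[of 3], of 2] by simp
  qed
  moreover have "(\<Sum>n. real n powr (- 3)) = (\<Sum>n. real (n + 2) powr (- 3)) + (\<Sum>n<2. real n powr (- 3))"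
    by (rule suminf_split_initial_segment) (use zeta_real_le(1)[of 3] in simp)
  moreover have "(\<Sum>n<2. real n powr (- 3)) = 1" by (simp add: numeral_2_eq_2)
  moreover have "(\<Sum>n. real n powr (- 3)) \<le> 3 / 2" using zeta_real_le(2)[of 3] by simp
  ultimately show False by simp
qed

text \<open>Orders at 1, in squared norms: the cube of the zeta function has a pole of order at most
  6, a zero of the series of f contributes at least 8 through its fourth power, and the series of
  f^2 stays bounded because its coefficients have bounded partial sums. The product would be O((x -
  1)^2), whereas by monotonicity it is at least its value at 3.\<close>

lemma nonreal_dirichlet_L1_nonzero:
  fixes f :: "nat \<Rightarrow> complex"
  assumes mult: "\<And>m n. f (m * n) = f m * f n" and f01: "\<And>n. f n = 0 \<or> norm (f n) = 1"
    and f1: "f 1 = 1" and f0: "f 0 = 0"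
    and bd: "\<And>N. norm (\<Sum>n\<le>N. f (Suc n)) \<le> B" and bd2: "\<And>N. norm (\<Sum>n\<le>N. f (Suc n) ^ 2) \<le> B2"
    and L: "(\<lambda>n. f (Suc n) / of_nat (Suc n)) sums L"
  shows "L \<noteq> 0"
proof
  assume L0: "L = 0"
  have f: "norm (f n) \<le> 1" for n using f01[of n] by auto
  then have f2: "norm (f n ^ 2) \<le> 1" for n by (simp add: norm_power power_le_one)
  obtain F where F: "F holomorphic_on {s. Re s > 0}"
    "\<And>s. Re s > 0 \<Longrightarrow> (\<lambda>n. f (Suc n) * of_nat (Suc n) powr (-s)) sums F s"
    using dirichlet_series_bounded_sums[OF bd] by blast
  obtain G where G: "G holomorphic_on {s. Re s > 0}"
    "\<And>s. Re s > 0 \<Longrightarrow> (\<lambda>n. f (Suc n) ^ 2 * of_nat (Suc n) powr (-s)) sums G s"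
    using dirichlet_series_bounded_sums[OF bd2] by blast
  define P where "P = (\<lambda>h (x::real). (norm (\<Sum>n. (h n :: complex) * of_nat n powr (- of_real x)))\<^sup>2)"
  have op: "open {s :: complex. Re s > 0}" by (simp add: open_halfspace_Re_gt)
  have "(\<lambda>n. f (Suc n) * of_nat (Suc n) powr (-1)) sums F 1" by (rule F) simp
  then have "(\<lambda>n. f (Suc n) / of_nat (Suc n)) sums F 1"
    by (simp add: powr_minus divide_inverse del: of_nat_Suc)
  then have F1: "F 1 = 0" using L L0 sums_unique2 by blast
  have PF: "P f x = (norm (F (of_real x)))\<^sup>2" if "x > 0" for x
    using F(2)[of "of_real x"] that sums_Suc_imp[of "\<lambda>n. f n * of_nat n powr (- of_real x)"]
    by (auto simp: P_def sums_iff f0)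
  have PG: "P (\<lambda>n. f n ^ 2) x = (norm (G (of_real x)))\<^sup>2" if "x > 0" for x
    using G(2)[of "of_real x"] that sums_Suc_imp[of "\<lambda>n. f n ^ 2 * of_nat n powr (- of_real x)"]
    by (auto simp: P_def sums_iff f0)
  have P1: "P (\<lambda>_. 1) x * (x - 1)\<^sup>2 \<le> x\<^sup>2" if "x > 1" for x
  proof -
    have "norm (\<Sum>n. 1 * of_nat n powr (- of_real x) :: complex) \<le> (\<Sum>n. real n powr (-x))"
    proof (rule norm_suminf_le)
      show "norm (1 * of_nat n powr (- of_real x) :: complex) \<le> real n powr (-x)" for n
        using norm_dirichlet_term_le[of 1 n "of_real x"] by simp
    qed (rule zeta_real_le[OF that])
    also have "\<dots> \<le> x / (x - 1)" by (rule zeta_real_le[OF that])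
    finally have "norm (\<Sum>n. 1 * of_nat n powr (- of_real x) :: complex) * (x - 1) \<le> x"
      using that by (simp add: field_simps)
    then have "(norm (\<Sum>n. 1 * of_nat n powr (- of_real x) :: complex) * (x - 1))\<^sup>2 \<le> x\<^sup>2"
      using that by (intro power_mono) auto
    then show ?thesis by (simp add: P_def power_mult_distrib)
  qed
  define Q where "Q = (\<lambda>x. P (\<lambda>_. 1) x ^ 3 * P f x ^ 4 * P (\<lambda>n. f n ^ 2) x)"
  have Q3: "Q 3 > 0"
    using dirichlet_series_at_3_nonzero[of "\<lambda>_. 1"] dirichlet_series_at_3_nonzero[of f, OF f f1]
      dirichlet_series_at_3_nonzero[of "\<lambda>n. f n ^ 2", OF f2] f1
    by (simp add: Q_def P_def)
  have "(F has_field_derivative deriv F 1) (at 1)"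
    by (rule holomorphic_derivI[OF F(1) op]) simp
  then have F': "((\<lambda>z. (F z - F 1) / (z - 1)) \<longlongrightarrow> deriv F 1) (at 1)"
    by (simp add: has_field_derivative_iff)
  have inj: "filterlim complex_of_real (at 1) (at_right 1)"
    unfolding filterlim_at
    by (auto simp: eventually_at_filter intro!: tendsto_eq_intros)
  have lim1: "((\<lambda>x. (norm (F (of_real x) / (of_real x - 1)))\<^sup>2) \<longlongrightarrow> (norm (deriv F 1))\<^sup>2) (at_right (1::real))"
    using filterlim_compose[OF F' inj] by (intro tendsto_intros) (simp add: F1)
  have "G field_differentiable (at 1)"
    by (rule holomorphic_on_imp_differentiable_at[OF G(1) op]) simp
  then have "isCont G 1" by (rule field_differentiable_imp_continuous_at)
  then have lim2: "((\<lambda>x. (norm (G (of_real x)))\<^sup>2) \<longlongrightarrow> (norm (G 1))\<^sup>2) (at_right (1::real))"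
    using filterlim_compose[OF _ inj, of G "nhds (G 1)"] by (intro tendsto_intros) (simp add: isCont_def)
  have "((\<lambda>x. (x\<^sup>2) ^ 3 * ((norm (F (of_real x) / (of_real x - 1)))\<^sup>2) ^ 4 * (norm (G (of_real x)))\<^sup>2 * (x - 1)\<^sup>2)
      \<longlongrightarrow> (1\<^sup>2) ^ 3 * ((norm (deriv F 1))\<^sup>2) ^ 4 * (norm (G 1))\<^sup>2 * (1 - 1)\<^sup>2) (at_right (1::real))"
    by (intro tendsto_intros lim1 lim2)
  then have lim: "((\<lambda>x. (x\<^sup>2) ^ 3 * ((norm (F (of_real x) / (of_real x - 1)))\<^sup>2) ^ 4 * (norm (G (of_real x)))\<^sup>2 * (x - 1)\<^sup>2)
      \<longlongrightarrow> 0) (at_right (1::real))" by simp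
  have "\<forall>\<^sub>F x in at_right 1. Q 3 \<le> (x\<^sup>2) ^ 3 * ((norm (F (of_real x) / (of_real x - 1)))\<^sup>2) ^ 4 * (norm (G (of_real x)))\<^sup>2 * (x - 1)\<^sup>2"
    unfolding eventually_at_right_field
  proof (intro exI[of _ 3] conjI allI impI)
    fix x :: real assume x: "1 < x" "x < 3"
    define a where "a = (norm (F (of_real x)))\<^sup>2 / (x - 1)\<^sup>2"
    have "norm (of_real x - 1 :: complex) = x - 1"
      using x by (metis norm_of_real of_real_1 of_real_diff abs_of_pos diff_gt_0_iff_gt)
    then have a: "(norm (F (of_real x) / (of_real x - 1)))\<^sup>2 = a"
      by (simp add: a_def norm_divide power_divide)
    have a': "P f x = a * (x - 1)\<^sup>2" using x by (simp add: a_def PF)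
    have "Q 3 \<le> Q x" unfolding Q_def P_def
      using three_four_one_antimono[OF mult f01, of x 3] x by simp
    \<comment> \<open>Of the four factors (x - 1)^2 supplied by \<open>P f x\<close>, three cancel
      the poles of the zeta factor and one is left over.\<close>
    also have "Q x = (P (\<lambda>_. 1) x * (x - 1)\<^sup>2) ^ 3 * a ^ 4 * (norm (G (of_real x)))\<^sup>2 * (x - 1)\<^sup>2"
    proof -
      have eq: "A ^ 3 * (a * y) ^ 4 * g = (A * y) ^ 3 * a ^ 4 * g * y" for A y g :: real
        by (simp add: power_mult_distrib power_numeral_reduce)
      have g: "P (\<lambda>n. f n ^ 2) x = (norm (G (of_real x)))\<^sup>2" using x by (simp add: PG)
      show ?thesis unfolding Q_def a' g by (rule eq)
    qed
    also have "\<dots> \<le> (x\<^sup>2) ^ 3 * a ^ 4 * (norm (G (of_real x)))\<^sup>2 * (x - 1)\<^sup>2"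
      using P1[of x] x by (intro mult_right_mono power_mono) (auto simp: P_def a_def)
    finally show "Q 3 \<le> (x\<^sup>2) ^ 3 * ((norm (F (of_real x) / (of_real x - 1)))\<^sup>2) ^ 4 * (norm (G (of_real x)))\<^sup>2 * (x - 1)\<^sup>2"
      by (simp only: a)
  qed simp
  then have "Q 3 \<le> 0" using tendsto_lowerbound[OF lim] by simp
  then show False using Q3 by simp
qed

text \<open>Abel's theorem: with \<open>e n\<close> the error of the partial sums, the difference to
  \<open>A\<close> is the average of the \<open>e n\<close> with weights
  \<open>(1 - r) * r ^ n\<close> of total mass 1. As r tends to 1, the first N weights become
  negligible, and the later errors are small.\<close>

lemma abel_limit_at_left_1:
  fixes a :: "nat \<Rightarrow> complex"
  assumes A: "a sums A"
  shows "((\<lambda>r. \<Sum>n. a n * of_real r ^ n) \<longlongrightarrow> A) (at_left (1::real))"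
proof -
  define e where "e = (\<lambda>n. sum a {..n} - A)"
  have "(\<lambda>n. sum a {..n}) \<longlonglongrightarrow> A" using A by (simp add: sums_def_le)
  then have e0: "e \<longlonglongrightarrow> 0" unfolding e_def by (simp add: LIM_zero_iff)
  then obtain K where K: "\<And>n. norm (e n) \<le> K" using convergent_imp_Bseq[of e]
    by (auto simp: convergent_def Bseq_def)
  have K0: "K \<ge> 0" using K[of 0] norm_ge_zero order_trans by blast
  have rep: "(\<lambda>n. e n * ((1 - of_real r) * of_real r ^ n)) sums ((\<Sum>n. a n * of_real r ^ n) - A)"
    if r: "0 < r" "r < 1" for r :: real
  proof -
    have geo: "(\<lambda>n. (1 - of_real r) * of_real r ^ n) sums (1 :: complex)"
    proof -
      have "(\<lambda>n. (of_real r :: complex) ^ n) sums (1 / (1 - of_real r))"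
        using r by (intro geometric_sums) simp
      from sums_mult[OF this, of "1 - of_real r"] show ?thesis using r by simp
    qed
    have "summable (\<lambda>n. norm (e n * ((1 - of_real r) * of_real r ^ n)))"
    proof (rule summable_comparison_test')
      show "summable (\<lambda>n. (K * norm (1 - of_real r :: complex)) * r ^ n)"
        using r by (intro summable_mult summable_geometric) auto
      show "norm (norm (e n * ((1 - of_real r) * of_real r ^ n))) \<le> (K * norm (1 - of_real r :: complex)) * r ^ n" for n
        using mult_right_mono[OF K[of n], of "norm (1 - of_real r :: complex) * r ^ n"] r
        by (simp add: norm_mult norm_power mult.assoc)
    qed
    then have S: "(\<lambda>n. e n * ((1 - of_real r) * of_real r ^ n)) sums (\<Sum>n. e n * ((1 - of_real r) * of_real r ^ n))"
      by (rule summable_sums[OF summable_norm_cancel])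
    have "(\<lambda>n. e n * ((1 - of_real r) * of_real r ^ n) + A * ((1 - of_real r) * of_real r ^ n)) sums
       ((\<Sum>n. e n * ((1 - of_real r) * of_real r ^ n)) + A * 1)"
      by (intro sums_add S sums_mult geo)
    then have S2: "(\<lambda>n. sum a {..n} * (of_real r ^ n - of_real r ^ Suc n)) sums
       ((\<Sum>n. e n * ((1 - of_real r) * of_real r ^ n)) + A)"
      by (simp add: e_def algebra_simps)
    have "(\<lambda>N. sum a {..<N} * of_real r ^ N) \<longlonglongrightarrow> A * 0"
      using A r by (intro tendsto_mult) (auto simp: sums_def intro!: LIMSEQ_power_zero)
    with S2 have "(\<lambda>N. (\<Sum>n<N. sum a {..n} * (of_real r ^ n - of_real r ^ Suc n)) + sum a {..<N} * of_real r ^ N)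
        \<longlonglongrightarrow> ((\<Sum>n. e n * ((1 - of_real r) * of_real r ^ n)) + A) + A * 0"
      unfolding sums_def by (rule tendsto_add)
    then have "(\<lambda>n. a n * of_real r ^ n) sums ((\<Sum>n. e n * ((1 - of_real r) * of_real r ^ n)) + A)"
      unfolding sums_def by (subst sum_by_parts) simp
    with S show ?thesis by (simp add: sums_iff)
  qed
  show ?thesis
  proof (rule tendstoI)
    fix \<epsilon> :: real assume eps: "\<epsilon> > 0"
    then obtain N where N: "\<And>n. n \<ge> N \<Longrightarrow> norm (e n) < \<epsilon> / 2"
      using e0[THEN LIMSEQ_D, of "\<epsilon> / 2"] by auto
    have bound: "norm ((\<Sum>n. a n * of_real r ^ n) - A) \<le> real N * (K * (1 - r)) + \<epsilon> / 2"
      if r: "0 < r" "r < 1" for r :: real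
    proof -
      let ?g = "\<lambda>n. (if n < N then K * (1 - r) else 0) + \<epsilon> / 2 * ((1 - r) * r ^ n)"
      have "(\<lambda>n. r ^ n) sums (1 / (1 - r))" using r by (intro geometric_sums) simp
      from sums_mult[OF this, of "1 - r"] have "(\<lambda>n. (1 - r) * r ^ n) sums 1" using r by simp
      moreover have "(\<lambda>n. if n < N then K * (1 - r) else 0) sums (\<Sum>n | n < N. K * (1 - r))"
        using sums_If_finite[of "\<lambda>n. n < N" "\<lambda>_. K * (1 - r)"] by simp
      ultimately have g: "?g sums ((\<Sum>n | n < N. K * (1 - r)) + \<epsilon> / 2 * 1)"
        by (intro sums_add sums_mult)
      have "norm (\<Sum>n. e n * ((1 - of_real r) * of_real r ^ n)) \<le> suminf ?g"
      proof (rule norm_suminf_le)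
        fix n
        have nr: "norm (1 - of_real r :: complex) = 1 - r"
          using r by (metis norm_of_real of_real_1 of_real_diff abs_of_pos diff_gt_0_iff_gt)
        have eq: "norm (e n * ((1 - of_real r) * of_real r ^ n)) = norm (e n) * ((1 - r) * r ^ n)"
          using r by (simp add: norm_mult norm_power nr)
        have p: "0 \<le> (1 - r) * r ^ n" "(1 - r) * r ^ n \<le> 1 - r"
          using r by (auto simp: mult_left_le power_le_one)
        show "norm (e n * ((1 - of_real r) * of_real r ^ n)) \<le> ?g n"
        proof (cases "n < N")
          case True
          have "norm (e n) * ((1 - r) * r ^ n) \<le> K * (1 - r)"
            using K K0 p by (intro mult_mono) auto
          moreover have "0 \<le> \<epsilon> / 2 * ((1 - r) * r ^ n)" using eps p by simp
          ultimately show ?thesis using True unfolding eq by simp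
        next
          case False
          then have "norm (e n) * ((1 - r) * r ^ n) \<le> \<epsilon> / 2 * ((1 - r) * r ^ n)"
            using N[of n] p by (intro mult_right_mono) auto
          then show ?thesis using False unfolding eq by simp
        qed
      qed (rule sums_summable[OF g])
      then show ?thesis using rep[OF r] g by (simp add: sums_iff)
    qed
    have "((\<lambda>r. real N * (K * (1 - r)) + \<epsilon> / 2) \<longlongrightarrow> real N * (K * (1 - 1)) + \<epsilon> / 2) (at_left (1::real))"
      by (intro tendsto_intros)
    then have "\<forall>\<^sub>F r in at_left (1::real). real N * (K * (1 - r)) + \<epsilon> / 2 < \<epsilon>"
      by (rule order_tendstoD(2)) (use eps in simp)
    moreover have "\<forall>\<^sub>F r in at_left (1::real). 0 < r \<and> r < 1"
      unfolding eventually_at_left_field by (intro exI[of _ 0]) auto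
    ultimately show "\<forall>\<^sub>F r in at_left 1. dist (\<Sum>n. a n * of_real r ^ n) A < \<epsilon>"
    proof eventually_elim
      case (elim r)
      then show ?case using bound[of r] by (simp add: dist_norm)
    qed
  qed
qed

section \<open>Dirichlet characters modulo a prime\<close>

lemma bij_betw_mult_mod:
  fixes a l :: nat
  assumes "coprime a l" "l > 0"
  shows "bij_betw (\<lambda>n. a * n mod l) {..<l} {..<l}"
proof -
  have "inj_on (\<lambda>n. a * n mod l) {..<l}"
  proof (rule inj_onI)
    fix x y assume xy: "x \<in> {..<l}" "y \<in> {..<l}" "a * x mod l = a * y mod l"
    then have "[a * x = a * y] (mod l)" by (simp add: cong_def)
    then have "[x = y] (mod l)" using assms(1) by (simp add: cong_mult_lcancel_nat)
    then show "x = y" using xy by (simp add: cong_def)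
  qed
  moreover have "(\<lambda>n. a * n mod l) ` {..<l} \<subseteq> {..<l}" using assms by auto
  ultimately show ?thesis
    using endo_inj_surj[OF finite_lessThan] by (simp add: bij_betw_def)
qed

lemma primroot_power_half:
  fixes l g :: nat
  assumes "prime l" "odd l" "residue_primroot l g"
  shows "g ^ ((l - 1) div 2) mod l = l - 1"
proof -
  define h where "h = (l - 1) div 2"
  have l: "l > 2" using assms prime_ge_2_nat[of l] by (cases "l = 2") auto
  have m: "l - 1 = 2 * h" "h > 0" using assms(2) l by (auto simp: h_def elim!: oddE)
  have o: "ord l g = l - 1" "coprime l g"
    using assms by (auto simp: residue_primroot_def totient_prime)
  have "[g ^ (l - 1) = 1] (mod l)" using o by (metis ord)
  then have "l dvd g ^ (l - 1) - 1"
    using assms l by (metis cong_altdef_nat' coprime_commute o(2) cong_to_1_nat)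
  moreover have "g \<noteq> 0" using o l by (metis coprime_0_right_iff nat_dvd_1_iff_1 less_irrefl one_less_numeral_iff semiring_norm(76) order.strict_trans)
  ultimately have "int l dvd int (g ^ h) ^ 2 - 1"
    by (metis int_dvd_int_iff int_ops(2) m(1) of_nat_diff of_nat_power one_le_power Suc_leI neq0_conv One_nat_def power_mult mult.commute)
  then have "int l dvd (int (g ^ h) - 1) * (int (g ^ h) + 1)"
    by (simp add: power2_eq_square algebra_simps)
  moreover have "prime (int l)" using assms by simp
  ultimately consider "int l dvd int (g ^ h) - 1" | "int l dvd int (g ^ h) + 1"
    using prime_dvd_mult_iff by blast
  then show ?thesis
  proof cases
    case 1
    then have "[int (g ^ h) = int 1] (mod int l)" by (simp add: cong_iff_dvd_diff)
    then have "[g ^ h = 1] (mod l)" by (simp only: cong_int_iff)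
    then have "ord l g dvd h" by (simp add: ord_divides')
    then have "l - 1 \<le> h" using o m by (auto dest: dvd_imp_le)
    then show ?thesis using m by simp
  next
    case 2
    then have "[int (g ^ h) = int (l - 1)] (mod int l)"
      using l by (simp add: cong_iff_dvd_diff of_nat_diff)
         (metis add_diff_eq diff_diff_eq2 dvd_diff_right_iff dvd_refl diff_add_eq)
    then have "[g ^ h = l - 1] (mod l)" by (simp only: cong_int_iff)
    then show ?thesis using l by (simp add: cong_def h_def)
  qed
qed

text \<open>A character is kept as a periodic function on the natural numbers, so that it is at once
  the coefficient sequence of a Dirichlet series. \<open>zero_iff\<close> excludes the zero function
  and thereby forces the value 1 at 1.\<close>

locale dirichlet_char =
  fixes l :: nat and X :: "nat \<Rightarrow> complex"
  assumes prime_l: "prime l"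
    and mult: "X (m * n) = X m * X n"
    and periodic: "X (n mod l) = X n"
    and zero_iff: "X n = 0 \<longleftrightarrow> l dvd n"
begin

lemma l_gt_1: "l > 1" using prime_l prime_gt_1_nat by blast

lemma X_0 [simp]: "X 0 = 0" by (simp add: zero_iff)

lemma X_1 [simp]: "X (Suc 0) = 1"
proof -
  have "X 1 = X 1 * X 1" using mult[of 1 1] by simp
  moreover have "X 1 \<noteq> 0" using l_gt_1 by (simp add: zero_iff)
  ultimately show ?thesis by simp
qed

lemma X_power: "X (n ^ j) = X n ^ j"
  by (induction j) (auto simp: mult)

lemma norm_X: "\<not> l dvd n \<Longrightarrow> norm (X n) = 1"
proof -
  assume n: "\<not> l dvd n"
  have "X n ^ (l - 1) = X (n ^ (l - 1) mod l)" by (simp add: X_power periodic)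
  also have "n ^ (l - 1) mod l = 1"
    using fermat_theorem[OF prime_l n] l_gt_1 by (simp add: cong_def)
  finally show ?thesis using power_eq_1_iff[of "X n" "l - 1"] l_gt_1 by auto
qed

lemma X_01: "X n = 0 \<or> norm (X n) = 1"
  using norm_X zero_iff by blast

lemma norm_X_le: "norm (X n) \<le> 1"
  using X_01[of n] by auto

lemma cnj_char: "dirichlet_char l (\<lambda>n. cnj (X n))"
  by unfold_locales (auto simp: prime_l mult periodic zero_iff)

lemma square_char: "dirichlet_char l (\<lambda>n. X n ^ 2)"
  by unfold_locales (auto simp: prime_l mult periodic zero_iff power_mult_distrib)

lemma coprime_l: "\<not> l dvd a \<Longrightarrow> coprime a l"
  by (metis prime_l prime_imp_coprime coprime_commute)

lemma sum_period:
  assumes "\<not> l dvd a" "X a \<noteq> 1"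
  shows "(\<Sum>n<l. X n) = 0"
proof -
  have "(\<Sum>n<l. X n) = (\<Sum>n<l. X (a * n mod l))"
    using sum.reindex_bij_betw[OF bij_betw_mult_mod[OF coprime_l[OF assms(1)]], of X] l_gt_1 by simp
  also have "\<dots> = X a * (\<Sum>n<l. X n)" by (simp add: periodic mult sum_distrib_left)
  finally show ?thesis using assms(2) by simp
qed

text \<open>Full periods cancel, and fewer than l terms of norm at most 1 are left. The witness
  \<open>a\<close> expresses that the character is non-trivial.\<close>

lemma norm_sum_le:
  assumes "\<not> l dvd a" "X a \<noteq> 1"
  shows "norm (\<Sum>n\<le>N. X (Suc n)) \<le> real l"
proof -
  \<comment> \<open>The terms at 1, ..., N + 1 together with the vanishing term at 0 are those below
    N + 2.\<close>
  define M where "M = Suc (Suc N)"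
  have per: "X (i + q * l) = X i" for i q
    by (metis periodic mod_mult_self1)
  have "(\<Sum>n<(M div l) * l. X n) = (\<Sum>q<M div l. sum X {q * l..<q * l + l})"
    by (simp add: sum.nat_group)
  also have "\<dots> = (\<Sum>q<M div l. \<Sum>n<l. X n)"
  proof (rule sum.cong[OF refl])
    fix q
    have "sum X {q * l..<q * l + l} = (\<Sum>n=0..<l. X (n + q * l))"
      using sum.shift_bounds_nat_ivl[of X 0 "q * l" l] by (simp only: add_0 add.commute[of "q * l" l])
    then show "sum X {q * l..<q * l + l} = (\<Sum>n<l. X n)" by (simp add: per atLeast0LessThan)
  qed
  also have "\<dots> = 0" using sum_period[OF assms] by simp
  finally have 0: "(\<Sum>n<(M div l) * l. X n) = 0" .
  have "(\<Sum>n<M. X n) = (\<Sum>n<(M div l) * l. X n) + sum X {(M div l) * l..<M}"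
    using sum.atLeastLessThan_concat[of 0 "M div l * l" M X] by (simp add: lessThan_atLeast0)
  then have "norm (\<Sum>n<M. X n) \<le> (\<Sum>n\<in>{(M div l) * l..<M}. norm (X n))"
    using 0 by (simp add: sum_norm_le)
  also have "\<dots> \<le> (\<Sum>n\<in>{(M div l) * l..<M}. 1)" by (intro sum_mono norm_X_le)
  also have "\<dots> \<le> real l" using l_gt_1 mod_less_divisor[of l M]
    by (simp add: minus_div_mult_eq_mod)
  also have "(\<Sum>n<M. X n) = (\<Sum>n\<le>N. X (Suc n))"
    using sum.lessThan_Suc_shift[of X "Suc N"] by (simp only: M_def lessThan_Suc_atMost X_0 add_0)
  finally show ?thesis .
qed

section \<open>Additive characters and Gauss sums\<close>

definition unit_e :: "nat \<Rightarrow> complex" where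
  "unit_e n = cis (2 * pi * real n / real l)"

lemma unit_e_add: "unit_e (m + n) = unit_e m * unit_e n"
  by (simp add: unit_e_def cis_mult add_divide_distrib ring_distribs)

lemma unit_e_power: "unit_e b ^ n = unit_e (n * b)"
  by (induction n) (simp_all add: unit_e_add, simp add: unit_e_def)

lemma unit_e_eq_1_iff: "unit_e n = 1 \<longleftrightarrow> l dvd n"
proof -
  have "unit_e n = 1 \<longleftrightarrow> (\<exists>k::int. 2 * pi * real n / real l = of_int (2 * k) * pi)"
    unfolding unit_e_def cis_conv_exp using exp_eq_1 by simp
  also have "\<dots> \<longleftrightarrow> (\<exists>k::int. int n = k * int l)"
  proof (intro ex_cong1)
    fix k :: int
    have "2 * pi * real n / real l = of_int (2 * k) * pi \<longleftrightarrow> real n = of_int k * real l"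
      using l_gt_1 by (simp add: field_simps)
    also have "\<dots> \<longleftrightarrow> of_int (int n) = (of_int (k * int l) :: real)" by simp
    also have "\<dots> \<longleftrightarrow> int n = k * int l" by (rule of_int_eq_iff)
    finally show "2 * pi * real n / real l = of_int (2 * k) * pi \<longleftrightarrow> int n = k * int l" .
  qed
  also have "\<dots> \<longleftrightarrow> l dvd n" by (metis dvd_def int_dvd_int_iff mult.commute)
  finally show ?thesis .
qed

lemma unit_e_mod: "unit_e (n mod l) = unit_e n"
proof -
  have "unit_e n = unit_e (n div l * l) * unit_e (n mod l)"
    by (metis unit_e_add div_mult_mod_eq)
  moreover have "unit_e (n div l * l) = 1" by (simp add: unit_e_eq_1_iff)
  ultimately show ?thesis by simp
qed

lemma sum_unit_e: "(\<Sum>n<l. unit_e (n * c)) = (if l dvd c then of_nat l else 0)"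
proof (cases "l dvd c")
  case False
  have "(\<Sum>n<l. unit_e (n * c)) = (\<Sum>n<l. unit_e c ^ n)" by (simp add: unit_e_power)
  also have "\<dots> = (unit_e c ^ l - 1) / (unit_e c - 1)"
    using False by (intro geometric_sum) (simp add: unit_e_eq_1_iff)
  also have "unit_e c ^ l = 1" by (simp add: unit_e_power unit_e_eq_1_iff)
  finally show ?thesis using False by simp
next
  case True
  then have "unit_e (n * c) = 1" for n by (simp add: unit_e_eq_1_iff)
  then show ?thesis using True by simp
qed

definition gauss :: "nat \<Rightarrow> complex" where
  "gauss n = (\<Sum>b<l. X b * unit_e (n * b))"

text \<open>For n prime to l, b is replaced by n b. For l dividing n both sides vanish, the left one
  as a sum of \<open>X\<close> over a full period. As l is prime, there is no third case.\<close>

lemma gauss_eq: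
  assumes "\<not> l dvd a" "X a \<noteq> 1"
  shows "gauss n = cnj (X n) * gauss 1"
proof (cases "l dvd n")
  case True
  then have "unit_e (n * b) = 1" for b by (simp add: unit_e_eq_1_iff)
  then show ?thesis using sum_period[OF assms] zero_iff[of n] True by (simp add: gauss_def)
next
  case False
  have "gauss 1 = (\<Sum>b<l. X (n * b mod l) * unit_e (n * b mod l))"
    unfolding gauss_def
    using sum.reindex_bij_betw[OF bij_betw_mult_mod[OF coprime_l[OF False]], of "\<lambda>b. X b * unit_e b"] l_gt_1
    by simp
  also have "\<dots> = X n * gauss n"
    by (simp add: gauss_def periodic unit_e_mod mult sum_distrib_left mult.assoc)
  finally have "cnj (X n) * gauss 1 = (X n * cnj (X n)) * gauss n" by simp
  also have "X n * cnj (X n) = 1" using norm_X[OF False] by (simp add: complex_norm_square[symmetric])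
  finally show ?thesis by simp
qed

text \<open>If it vanished, all \<open>gauss n\<close> would; yet inverting the finite Fourier
  transform, with \<open>l - 1\<close> in the role of -1, recovers l * X(1) = l.\<close>

lemma gauss_nonzero:
  assumes "\<not> l dvd a" "X a \<noteq> 1"
  shows "gauss 1 \<noteq> 0"
proof
  assume 0: "gauss 1 = 0"
  have "gauss n = 0" for n using gauss_eq[OF assms, of n] 0 by simp
  then have "0 = (\<Sum>n<l. gauss n * unit_e (n * (l - 1)))" by simp
  also have "\<dots> = (\<Sum>n<l. \<Sum>b<l. X b * unit_e (n * (b + (l - 1))))"
    by (simp only: gauss_def sum_distrib_right mult.assoc distrib_left unit_e_add)
  also have "\<dots> = (\<Sum>b<l. X b * (\<Sum>n<l. unit_e (n * (b + (l - 1)))))"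
    by (subst sum.swap) (simp add: sum_distrib_left)
  also have "\<dots> = (\<Sum>b<l. if b = 1 then X b * of_nat l else 0)"
  proof (intro sum.cong refl)
    fix b assume b: "b \<in> {..<l}"
    have "l dvd b + (l - 1) \<longleftrightarrow> b = 1"
    proof
      assume "l dvd b + (l - 1)"
      then obtain k where k: "b + (l - 1) = l * k" by (elim dvdE)
      have "k = 1"
      proof (rule ccontr)
        assume "k \<noteq> 1"
        then consider "k = 0" | "k \<ge> 2" by linarith
        then show False
        proof cases
          case 2
          then have "l * 2 \<le> l * k" by simp
          moreover have "b < l" using b by simp
          ultimately show ?thesis using k by linarith
        qed (use k l_gt_1 in simp)
      qed
      then show "b = 1" using k l_gt_1 by simp
    qed (use l_gt_1 in simp)
    then show "X b * (\<Sum>n<l. unit_e (n * (b + (l - 1)))) = (if b = 1 then X b * of_nat l else 0)"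
      by (simp only: sum_unit_e) simp
  qed
  also have "\<dots> = of_nat l" using l_gt_1 by (simp add: sum.delta)
  finally show False using l_gt_1 by simp
qed

end

section \<open>The first moment of an odd character\<close>

context dirichlet_char
begin

text \<open>With t = pi b / l, 1 - e^(2it) = 2 sin t * e^(i(t - pi/2)); for 0 < t < pi the sine is
  positive and t - pi/2 lies in the principal range.\<close>

lemma Ln_one_minus_unit_e:
  assumes "0 < b" "b < l"
  shows "Ln (1 - unit_e b) =
    of_real (ln (2 * sin (pi * real b / real l))) + \<i> * of_real (pi * real b / real l - pi / 2)"
proof -
  define t where "t = pi * real b / real l"
  have t: "0 < t" "t < pi" using assms by (auto simp: t_def field_simps)
  then have s: "sin t > 0" by (rule sin_gt_zero)
  have "exp (of_real (ln (2 * sin t)) + \<i> * of_real (t - pi / 2)) = of_real (2 * sin t) * cis (t - pi / 2)"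
    using s by (simp add: exp_add exp_of_real cis_conv_exp)
  also have "\<dots> = 1 - unit_e b"
  proof -
    have u: "unit_e b = cis (2 * t)" by (simp add: unit_e_def t_def mult.assoc)
    show ?thesis unfolding u
      by (rule complex_eqI) (auto simp: cos_diff sin_diff cos_double_sin sin_double power2_eq_square)
  qed
  finally have "1 - unit_e b = exp (of_real (ln (2 * sin t)) + \<i> * of_real (t - pi / 2))" ..
  then show ?thesis using t Ln_exp[of "of_real (ln (2 * sin t)) + \<i> * of_real (t - pi / 2)"]
    unfolding t_def[symmetric] by (simp del: of_real_diff)
qed

lemma X_reflect:
  assumes "X (l - 1) = -1" "0 < b" "b < l"
  shows "X (l - b) = - X b"
proof -
  have "(l - 1) * b = l - b + (b - 1) * l"
    using assms by (cases b; cases l) (auto simp: algebra_simps)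
  then have "X (l - b) = X ((l - 1) * b)" by (metis periodic mod_mult_self1)
  then show ?thesis using assms(1) by (simp add: mult)
qed

text \<open>The reflection of b to l - b fixes the real parts of the logarithms and negates
  \<open>X\<close>, so these cancel. The imaginary parts are affine in b and leave only multiples of
  the first moment and of the plain sum of \<open>X\<close>.\<close>

lemma sum_Ln_eq_0:
  assumes odd: "X (l - 1) = -1" and S: "(\<Sum>a<l. of_nat a * X a) = 0"
  shows "(\<Sum>b<l. X b * Ln (1 - unit_e b)) = 0"
proof -
  define \<rho> where "\<rho> b = (of_real (ln (2 * sin (pi * real b / real l))) :: complex)" for b
  have \<rho>: "\<rho> (l - b) = \<rho> b" if "b \<in> {1..<l}" for b
  proof -
    have "pi * real (l - b) / real l = pi - pi * real b / real l"
      using that by (simp add: of_nat_diff field_simps)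
    then show ?thesis by (simp add: \<rho>_def)
  qed
  have nt: "\<not> l dvd l - 1" "X (l - 1) \<noteq> 1"
    using l_gt_1 odd by (auto dest: dvd_imp_le)
  have sub: "(\<Sum>b\<in>{1..<l}. X b * h b) = (\<Sum>b<l. X b * h b)" for h
    by (rule sum.mono_neutral_left) (auto simp: Suc_le_eq)
  have "(\<Sum>b\<in>{1..<l}. X b * \<rho> b) = (\<Sum>b\<in>{1..<l}. X (l - b) * \<rho> (l - b))"
    by (rule sum.reindex_bij_witness[of _ "\<lambda>b. l - b" "\<lambda>b. l - b"]) auto
  also have "\<dots> = - (\<Sum>b\<in>{1..<l}. X b * \<rho> b)"
    using X_reflect[OF odd] \<rho> by (simp add: sum_negf[symmetric])
  finally have 0: "(\<Sum>b\<in>{1..<l}. X b * \<rho> b) = 0" by simp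
  have "(\<Sum>b<l. X b * Ln (1 - unit_e b)) = (\<Sum>b\<in>{1..<l}. X b * Ln (1 - unit_e b))"
    by (rule sub[symmetric])
  also have "\<dots> = (\<Sum>b\<in>{1..<l}. X b * \<rho> b + (\<i> * of_real pi / of_nat l) * (X b * of_nat b) - (\<i> * of_real pi / 2) * (X b * 1))"
    using l_gt_1 by (intro sum.cong refl) (auto simp: Ln_one_minus_unit_e \<rho>_def algebra_simps)
  also have "\<dots> = (\<i> * of_real pi / of_nat l) * (\<Sum>b<l. X b * of_nat b) - (\<i> * of_real pi / 2) * (\<Sum>b<l. X b * 1)"
    by (simp only: sum.distrib sum_subtractf sum_distrib_left[symmetric] 0 sub add_0)
  also have "\<dots> = 0" using S sum_period[OF nt] by (simp add: mult.commute)
  finally show ?thesis .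
qed

lemma tendsto_sum_Ln:
  "((\<lambda>r. \<Sum>b<l. X b * Ln (1 - of_real r * unit_e b)) \<longlongrightarrow> (\<Sum>b<l. X b * Ln (1 - unit_e b))) (at_left (1::real))"
proof (rule tendsto_sum)
  fix b assume "b \<in> {..<l}"
  show "((\<lambda>r. X b * Ln (1 - of_real r * unit_e b)) \<longlongrightarrow> X b * Ln (1 - unit_e b)) (at_left (1::real))"
  \<comment> \<open>At b = 0 the logarithm has no limit, but the factor \<open>X 0\<close> is 0.
    Otherwise \<open>1 - unit_e b\<close> has positive real part and stays away from the branch
    cut.\<close>
  proof (cases "b = 0")
    case False
    have "unit_e b \<noteq> 1" using False \<open>b \<in> {..<l}\<close> by (auto simp: unit_e_eq_1_iff dest: dvd_imp_le)
    moreover have "norm (unit_e b) = 1" by (simp add: unit_e_def)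
    ultimately have "Re (1 - unit_e b) > 0"
      using complex_Re_le_cmod[of "unit_e b"] complex_eq_iff[of "unit_e b" 1] cmod_power2[of "unit_e b"]
      by (cases "Re (unit_e b) = 1") auto
    then have "1 - unit_e b \<notin> \<real>\<^sub>\<le>\<^sub>0" by (auto simp: complex_nonpos_Reals_iff)
    moreover have "((\<lambda>r. 1 - of_real r * unit_e b) \<longlongrightarrow> 1 - of_real 1 * unit_e b) (at_left (1::real))"
      by (intro tendsto_intros)
    ultimately show ?thesis by (intro tendsto_mult tendsto_const tendsto_Ln) simp_all
  qed simp
qed

text \<open>
  Expanding \<open>Ln (1 - r e(b/l))\<close> into powers of \<open>r\<close> and summing against \<open>X\<close> gives
  \<open>-\<tau> \<Sum> cnj (X n) r\<^sup>n / n\<close> with the Gauss sum \<open>\<tau>\<close>; as \<open>r \<rightarrow> 1\<close>, a vanishing sum forces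
  \<open>L(1, cnj X) = 0\<close>.
\<close>

lemma sum_mult_X_nonzero_nonreal:
  assumes odd: "X (l - 1) = -1" and nr: "\<not> l dvd a" "X a ^ 2 \<noteq> 1"
  shows "(\<Sum>a<l. of_nat a * X a) \<noteq> 0"
proof
  assume S: "(\<Sum>a<l. of_nat a * X a) = 0"
  have X1: "X a \<noteq> 1" using nr(2) by auto
  then have C1: "cnj (X a) \<noteq> 1" by (metis complex_cnj_cnj complex_cnj_one)
  have C2: "cnj (X a) ^ 2 \<noteq> 1" using nr(2) by (metis complex_cnj_cnj complex_cnj_one complex_cnj_power)
  interpret C: dirichlet_char l "\<lambda>n. cnj (X n)" by (rule cnj_char)
  interpret CC: dirichlet_char l "\<lambda>n. cnj (X n) ^ 2" by (rule C.square_char)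
  obtain F where F: "\<And>s. Re s > 0 \<Longrightarrow> (\<lambda>n. cnj (X (Suc n)) * of_nat (Suc n) powr (-s)) sums F s"
    using dirichlet_series_bounded_sums[of "\<lambda>n. cnj (X (Suc n))", OF C.norm_sum_le[OF nr(1) C1]] by blast
  define c where "c n = cnj (X n) / of_nat n" for n
  have "(\<lambda>n. cnj (X (Suc n)) * of_nat (Suc n) powr (-1)) sums F 1" by (rule F) simp
  then have L: "(\<lambda>n. cnj (X (Suc n)) / of_nat (Suc n)) sums F 1"
    by (simp add: powr_minus divide_inverse del: of_nat_Suc)
  have L0: "F 1 \<noteq> 0"
    by (rule nonreal_dirichlet_L1_nonzero[of "\<lambda>n. cnj (X n)", OF C.mult C.X_01 _ _ C.norm_sum_le[OF nr(1) C1] CC.norm_sum_le[OF nr(1) C2] L])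
       simp_all
  have "c sums F 1" by (rule sums_Suc_imp) (use L in \<open>simp_all add: c_def\<close>)
  then have abel: "((\<lambda>r. \<Sum>n. c n * of_real r ^ n) \<longlongrightarrow> F 1) (at_left (1::real))"
    by (rule abel_limit_at_left_1)
  define T where "T r = (\<Sum>b<l. X b * Ln (1 - of_real r * unit_e b))" for r :: real
  have g: "gauss 1 \<noteq> 0" by (rule gauss_nonzero[OF nr(1) X1])
  have ser: "(\<Sum>n. c n * of_real r ^ n) = - T r / gauss 1" if r: "0 < r" "r < 1" for r :: real
  proof -
    have "(\<lambda>n. X b * (- ((of_real r * unit_e b) ^ n) / of_nat n)) sums (X b * Ln (1 - of_real r * unit_e b))" for b
    proof (rule sums_mult)
      have "norm (- (of_real r * unit_e b)) < 1" using r by (simp add: norm_mult unit_e_def)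
      from Ln_series[OF this] have "(\<lambda>n. (-1) ^ Suc n / of_nat n * (- (of_real r * unit_e b)) ^ n) sums Ln (1 - of_real r * unit_e b)"
        by simp
      moreover have "(-1) ^ Suc n / of_nat n * (- (of_real r * unit_e b)) ^ n = - ((of_real r * unit_e b) ^ n) / of_nat n" for n
      proof -
        have "(-1) ^ n * (-1) ^ n = (1 :: complex)" by (simp add: power_mult_distrib[symmetric])
        then have "(-1) ^ Suc n / of_nat n * ((-1) ^ n * z) = - z / of_nat n" for z :: complex
          by (simp add: field_simps)
        then show ?thesis by (subst power_minus)
      qed
      ultimately show "(\<lambda>n. - ((of_real r * unit_e b) ^ n) / of_nat n) sums Ln (1 - of_real r * unit_e b)"
        by (simp only:)
    qed
    then have "(\<lambda>n. \<Sum>b<l. X b * (- ((of_real r * unit_e b) ^ n) / of_nat n)) sums T r"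
      unfolding T_def by (rule sums_sum)
    moreover have "(\<Sum>b<l. X b * (- ((of_real r * unit_e b) ^ n) / of_nat n)) = - gauss 1 * (c n * of_real r ^ n)" for n
    proof -
      have "(\<Sum>b<l. X b * (- ((of_real r * unit_e b) ^ n) / of_nat n)) = (\<Sum>b<l. - (of_real r ^ n / of_nat n) * (X b * unit_e (n * b)))"
        by (intro sum.cong refl) (simp add: power_mult_distrib unit_e_power)
      also have "\<dots> = - (of_real r ^ n / of_nat n) * gauss n"
        by (simp only: gauss_def sum_distrib_left)
      also have "gauss n = cnj (X n) * gauss 1" by (rule gauss_eq[OF nr(1) X1])
      finally show ?thesis by (simp add: c_def)
    qed
    ultimately have "(\<lambda>n. - gauss 1 * (c n * of_real r ^ n)) sums T r" by simp
    from sums_divide[OF this, of "- gauss 1"] g have "(\<lambda>n. c n * of_real r ^ n) sums (- T r / gauss 1)"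
      by simp
    then show ?thesis by (simp add: sums_iff)
  qed
  have "((\<lambda>r. - T r / gauss 1) \<longlongrightarrow> - 0 / gauss 1) (at_left 1)"
    using tendsto_sum_Ln unfolding T_def sum_Ln_eq_0[OF odd S] by (intro tendsto_intros g)
  then have "((\<lambda>r. \<Sum>n. c n * of_real r ^ n) \<longlongrightarrow> - 0 / gauss 1) (at_left (1::real))"
  proof (rule Lim_transform_eventually)
    have "\<forall>\<^sub>F r in at_left (1::real). 0 < r \<and> r < 1"
      unfolding eventually_at_left_field by (intro exI[of _ 0]) auto
    then show "\<forall>\<^sub>F r in at_left 1. - T r / gauss 1 = (\<Sum>n. c n * of_real r ^ n)"
      by eventually_elim (simp add: ser)
  qed
  then have "F 1 = - 0 / gauss 1" using abel by (intro tendsto_unique[OF _ abel]) auto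
  then show False using L0 by simp
qed

text \<open>
  A quadratic odd character exists only for \<open>l\<close> congruent to 3 modulo 4, and then the sum is an
  integer of the same parity as \<open>l (l - 1) / 2\<close>, hence odd.
\<close>

lemma sum_mult_X_nonzero_real:
  assumes odd: "X (l - 1) = -1" and real: "\<And>a. \<not> l dvd a \<Longrightarrow> X a ^ 2 = 1"
  shows "(\<Sum>a<l. of_nat a * X a) \<noteq> 0"
proof
  assume S: "(\<Sum>a<l. of_nat a * X a) = 0"
  have "l \<noteq> 2" using odd by auto
  then have ol: "Parity.odd l" using prime_l primes_dvd_imp_eq two_is_prime_nat by blast
  define h where "h = (l - 1) div 2"
  have lh: "l = 2 * h + 1" using ol by (auto simp: h_def elim!: oddE)
  obtain g where g: "residue_primroot l g" using prime_primitive_root_exists[OF l_gt_1 prime_l] by blast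
  have "X g ^ h = X (g ^ h mod l)" by (simp add: X_power periodic)
  also have "\<dots> = -1" unfolding h_def primroot_power_half[OF prime_l ol g] by (rule odd)
  finally have Xg: "X g ^ h = -1" .
  have "\<not> l dvd g"
    using g prime_l l_gt_1 by (metis coprime_absorb_left nat_dvd_1_iff_1 not_prime_unit residue_primroot_def dvd_refl is_unit_gcd coprime_iff_gcd_eq_1 gcd_nat.absorb_iff1 less_irrefl)
  then have "X g ^ 2 = 1" by (rule real)
  have oh: "Parity.odd h"
  proof
    assume "even h"
    then obtain j where "h = 2 * j" by (elim evenE)
    then have "X g ^ h = 1" using \<open>X g ^ 2 = 1\<close> by (simp add: power_mult)
    then show False using Xg by simp
  qed
  define e :: "nat \<Rightarrow> int" where "e a = (if X a = 0 then 0 else if X a = 1 then 1 else -1)" for a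
  have e: "X a = of_int (e a)" for a
    using real[of a] zero_iff[of a] by (auto simp: e_def power2_eq_1_iff)
  have "of_int (\<Sum>a<l. int a * e a) = (\<Sum>a<l. of_nat a * X a)" by (simp add: e)
  then have "of_int (\<Sum>a<l. int a * e a) = (0 :: complex)" using S by simp
  then have S0: "(\<Sum>a<l. int a * e a) = 0" by (simp only: of_int_eq_0_iff)
  have "even (int a * e a - int a)" if "a < l" for a
  proof (cases "a = 0")
    case False
    then have "X a \<noteq> 0" using that by (auto simp: zero_iff dest: dvd_imp_le)
    then have "e a = 1 \<or> e a = -1" by (simp add: e_def)
    then show ?thesis by auto
  qed simp
  then have "even (\<Sum>a<l. int a * e a - int a)" by (intro dvd_sum) auto
  then have "even (int (\<Sum>a<l. a))" using S0 by (simp add: sum_subtractf)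
  then have "even (\<Sum>a<l. a)" by (simp only: even_of_nat)
  moreover have "(\<Sum>a<l. a) = h * (2 * h + 1)"
  proof -
    have "(\<Sum>a\<le>2 * h. a) = 2 * h * (2 * h + 1) div 2" using gauss_sum_nat[of "2 * h"] by (simp add: atMost_atLeast0)
    then show ?thesis by (simp add: lh lessThan_Suc_atMost)
  qed
  ultimately show False using oh by simp
qed

theorem sum_mult_X_nonzero:
  assumes "X (l - 1) = -1"
  shows "(\<Sum>a<l. of_nat a * X a) \<noteq> 0"
  using sum_mult_X_nonzero_real[OF assms] sum_mult_X_nonzero_nonreal[OF assms] by blast

end

section \<open>The character group modulo a prime\<close>

locale primroot_mod =
  fixes l g :: nat
  assumes prime_l: "prime l" and l_gt_3: "l > 3" and primroot: "residue_primroot l g"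
begin

lemma odd_l: "odd l"
  using prime_odd_nat[OF prime_l] l_gt_3 by simp

text \<open>Besides being the order of G, \<open>m\<close> represents -1 modulo l; products
  \<open>m * n\<close> stand for -n without leaving the natural numbers.\<close>

definition m :: nat where "m = l - 1"

lemma Suc_m: "Suc m = l" using l_gt_3 by (simp add: m_def)

lemma m_less: "m < l" using Suc_m by simp

lemma even_m: "even m" using odd_l by (simp add: m_def)

lemma m_pos: "m > 0" using l_gt_3 by (simp add: m_def)

lemma dvd_mult_l_iff [simp]: "l dvd a * b \<longleftrightarrow> l dvd a \<or> l dvd b"
  using prime_l by (simp add: prime_dvd_mult_iff)

lemma not_dvd_m: "\<not> l dvd m"
  using m_pos m_less by (auto dest: dvd_imp_le)

lemma not_dvd_Suc_0: "\<not> l dvd Suc 0"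
  using l_gt_3 by simp

lemma ord_g: "ord l g = m"
  using primroot prime_l by (simp add: residue_primroot_def totient_prime m_def)

lemma coprime_l_iff: "coprime l a \<longleftrightarrow> \<not> l dvd a"
  using prime_l l_gt_3
  by (metis coprime_absorb_left is_unit_gcd nat_dvd_1_iff_1 prime_imp_coprime coprime_iff_gcd_eq_1 gcd_nat.absorb1 not_prime_1)

lemma not_dvd_g_power: "\<not> l dvd g ^ i"
  using primroot coprime_l_iff[of "g ^ i"] by (simp add: residue_primroot_def)

definition dlog :: "nat \<Rightarrow> nat" where
  "dlog n = (THE i. i < m \<and> g ^ i mod l = n mod l)"

lemma dlog_ex1:
  assumes "\<not> l dvd n"
  shows "\<exists>!i. i < m \<and> g ^ i mod l = n mod l"
proof -
  have b: "bij_betw (\<lambda>i. g ^ i mod l) {..<m} (totatives l)"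
    using residue_primroot_is_generator[OF _ primroot] l_gt_3 prime_l by (simp add: totient_prime m_def)
  have "n mod l \<in> totatives l"
    using assms l_gt_3 coprime_l_iff[of n] by (auto simp: totatives_def dvd_eq_mod_eq_0 coprime_commute less_imp_le)
  then show ?thesis using b unfolding bij_betw_def inj_on_def by (smt (verit, best) imageE image_iff lessThan_iff)
qed

lemma dlog_less: "\<not> l dvd n \<Longrightarrow> dlog n < m"
  and g_power_dlog: "\<not> l dvd n \<Longrightarrow> g ^ dlog n mod l = n mod l"
  using theI'[OF dlog_ex1, of n] by (auto simp: dlog_def)

lemma g_power_cong_iff: "g ^ i mod l = g ^ j mod l \<longleftrightarrow> [i = j] (mod m)"
  using order_divides_expdiff[of l g i j] coprime_l_iff[of g] not_dvd_g_power[of 1] ord_g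
  by (simp add: cong_def)

lemma dlog_unique: "\<lbrakk>\<not> l dvd n; g ^ i mod l = n mod l\<rbrakk> \<Longrightarrow> [dlog n = i] (mod m)"
  using g_power_cong_iff[of "dlog n" i] g_power_dlog[of n] by simp

lemma dlog_mult:
  assumes "\<not> l dvd a" "\<not> l dvd b"
  shows "[dlog (a * b) = dlog a + dlog b] (mod m)"
proof (rule dlog_unique)
  have "g ^ (dlog a + dlog b) mod l = ((g ^ dlog a mod l) * (g ^ dlog b mod l)) mod l"
    by (simp add: power_add mod_mult_eq)
  also have "\<dots> = a * b mod l" using assms by (simp add: g_power_dlog mod_mult_eq)
  finally show "g ^ (dlog a + dlog b) mod l = a * b mod l" .
qed (use assms in simp)

lemma dlog_mod: "dlog (n mod l) = dlog n" by (simp add: dlog_def)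

definition zeta :: complex where "zeta = cis (2 * pi / real m)"

lemma zeta_power: "zeta ^ n = cis (real n * (2 * pi / real m))"
  unfolding zeta_def by (rule Complex.DeMoivre)

lemma zeta_power_eq_1_iff: "zeta ^ n = 1 \<longleftrightarrow> m dvd n"
proof -
  have "zeta ^ n = 1 \<longleftrightarrow> (\<exists>k::int. real n * (2 * pi / real m) = of_int (2 * k) * pi)"
    unfolding zeta_power cis_conv_exp by (subst exp_eq_1) simp
  also have "\<dots> \<longleftrightarrow> (\<exists>k::int. int n = k * int m)"
  proof (intro ex_cong1)
    fix k :: int
    have "real n * (2 * pi / real m) = of_int (2 * k) * pi \<longleftrightarrow> real n = of_int k * real m"
      using m_pos by (simp add: field_simps del: of_nat_diff)
    also have "\<dots> \<longleftrightarrow> of_int (int n) = (of_int (k * int m) :: real)" by simp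
    also have "\<dots> \<longleftrightarrow> int n = k * int m" by (rule of_int_eq_iff)
    finally show "real n * (2 * pi / real m) = of_int (2 * k) * pi \<longleftrightarrow> int n = k * int m" .
  qed
  also have "\<dots> \<longleftrightarrow> m dvd n" by (metis dvd_def int_dvd_int_iff mult.commute)
  finally show ?thesis .
qed

lemma zeta_nonzero [simp]: "zeta \<noteq> 0" by (simp add: zeta_def)

lemma norm_zeta [simp]: "norm zeta = 1" by (simp add: zeta_def)

lemma zeta_power_cong: "[i = j] (mod m) \<Longrightarrow> zeta ^ i = zeta ^ j"
proof (induction i j rule: linorder_wlog)
  case (le i j)
  then have "m dvd j - i" using cong_altdef_nat[of i j m] cong_sym by blast
  then have "zeta ^ (j - i) = 1" by (simp add: zeta_power_eq_1_iff)
  then have "zeta ^ (i + (j - i)) = zeta ^ i" by (simp only: power_add mult_1_right)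
  then show ?case using le by simp
qed (simp add: cong_sym_eq)

definition chr :: "nat \<Rightarrow> nat \<Rightarrow> complex" where
  "chr t n = (if l dvd n then 0 else zeta ^ (t * dlog n))"

lemma dirichlet_char_chr: "dirichlet_char l (chr t)"
proof
  fix m' n
  show "chr t (m' * n) = chr t m' * chr t n"
  proof (cases "l dvd m' \<or> l dvd n")
    case False
    then have "[t * dlog (m' * n) = t * (dlog m' + dlog n)] (mod m)"
      using dlog_mult by (intro cong_mult) auto
    then have "zeta ^ (t * dlog (m' * n)) = zeta ^ (t * (dlog m' + dlog n))" by (rule zeta_power_cong)
    then show ?thesis using False by (simp add: chr_def power_add distrib_left)
  qed (auto simp: chr_def)
  show "chr t (n mod l) = chr t n"
    by (simp add: chr_def dlog_mod dvd_mod_iff)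
  show "chr t n = 0 \<longleftrightarrow> l dvd n" by (simp add: chr_def)
qed (rule prime_l)

lemmas chr_mult = dirichlet_char.mult[OF dirichlet_char_chr]
lemmas chr_mod = dirichlet_char.periodic[OF dirichlet_char_chr]
lemmas chr_zero_iff = dirichlet_char.zero_iff[OF dirichlet_char_chr]
lemmas norm_chr = dirichlet_char.norm_X[OF dirichlet_char_chr]

lemma chr_0 [simp]: "chr t 0 = 0" and chr_1 [simp]: "chr t (Suc 0) = 1"
  using dirichlet_char.X_0[OF dirichlet_char_chr] dirichlet_char.X_1[OF dirichlet_char_chr] by auto

lemma chr_mult_left: "\<not> l dvd n \<Longrightarrow> chr (s * t) n = chr t n ^ s"
  by (simp add: chr_def power_mult[symmetric] mult_ac)

lemma chr_cnj: "\<not> l dvd n \<Longrightarrow> chr t n * cnj (chr t n) = 1"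
  using norm_chr[of n t] by (simp add: complex_norm_square[symmetric])

text \<open>Both sides say that m divides \<open>t * dlog n\<close>, as \<open>zeta\<close> and
  \<open>g\<close> both have order m. This exchange turns conditions on values of
  \<open>chr t\<close> into divisibility of t by orders in G.\<close>

lemma chr_eq_1_iff: "\<not> l dvd n \<Longrightarrow> chr t n = 1 \<longleftrightarrow> n ^ t mod l = 1"
proof -
  assume n: "\<not> l dvd n"
  have "chr t n = 1 \<longleftrightarrow> m dvd t * dlog n" using n by (simp add: chr_def zeta_power_eq_1_iff)
  also have "\<dots> \<longleftrightarrow> [dlog n * t = 0] (mod m)" by (simp add: cong_0_iff mult.commute)
  also have "\<dots> \<longleftrightarrow> g ^ (dlog n * t) mod l = 1" using g_power_cong_iff[of _ 0] l_gt_3 by simp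
  also have "g ^ (dlog n * t) mod l = (g ^ dlog n mod l) ^ t mod l" by (simp add: power_mult power_mod)
  also have "\<dots> = n ^ t mod l" using n by (simp add: g_power_dlog power_mod)
  finally show ?thesis .
qed

lemma chr_minus_1: "chr t m = (-1) ^ t"
proof -
  have "g ^ (m div 2) mod l = m mod l"
    using primroot_power_half[OF prime_l odd_l primroot] m_less by (simp add: m_def)
  then have "[dlog m = m div 2] (mod m)"
    by (rule dlog_unique[OF not_dvd_m])
  then have "zeta ^ (t * dlog m) = zeta ^ (t * (m div 2))"
    by (intro zeta_power_cong cong_mult) auto
  also have "\<dots> = (zeta ^ (m div 2)) ^ t" by (simp add: mult.commute flip: power_mult)
  also have "zeta ^ (m div 2) = cis pi"
  proof -
    have "real (m div 2) * (2 * pi / real m) = pi" using even_m m_pos by (auto elim!: evenE)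
    then show ?thesis unfolding zeta_power by (simp only:)
  qed
  finally show ?thesis using not_dvd_m by (simp add: chr_def)
qed

lemma sum_units:
  fixes h :: "nat \<Rightarrow> 'a :: comm_monoid_add"
  assumes "\<And>n. h (n mod l) = h n" "\<not> l dvd c"
  shows "(\<Sum>a<l. h (c * a)) = (\<Sum>a<l. h a)"
proof -
  have "coprime c l" using assms(2) coprime_l_iff coprime_commute by blast
  from sum.reindex_bij_betw[OF bij_betw_mult_mod[OF this], of h] l_gt_3 show ?thesis
    by (simp add: assms(1))
qed

lemma chr_orthogonal:
  assumes "\<not> l dvd a" "\<not> l dvd b"
  shows "(\<Sum>t<m. chr t a * cnj (chr t b)) = (if [a = b] (mod l) then of_nat m else 0)"
proof -
  define w where "w = zeta ^ dlog a * cnj (zeta ^ dlog b)"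
  have eq: "chr t a * cnj (chr t b) = w ^ t" for t
    using assms by (simp add: chr_def w_def power_mult_distrib power_mult[symmetric] mult.commute[of t])
  have "w = 1 \<longleftrightarrow> [a = b] (mod l)"
  proof
    have cz: "zeta ^ i * cnj (zeta ^ i) = 1" for i
      by (simp add: complex_norm_square[symmetric] norm_power del: complex_cnj_power)
    assume "w = 1"
    then have "zeta ^ dlog a = zeta ^ dlog b"
      using cz[of "dlog b"] by (metis w_def mult.commute mult.left_commute mult_1_right)
    have "zeta ^ (dlog a + (m - dlog b)) = zeta ^ dlog b * zeta ^ (m - dlog b)"
      using \<open>zeta ^ dlog a = zeta ^ dlog b\<close> by (simp add: power_add)
    also have "\<dots> = zeta ^ m" using dlog_less[OF assms(2)] by (simp flip: power_add)
    also have "\<dots> = 1" by (simp add: zeta_power_eq_1_iff)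
    finally have "m dvd dlog a + (m - dlog b)" by (simp add: zeta_power_eq_1_iff)
    then obtain q where q: "dlog a + (m - dlog b) = m * q" by (elim dvdE)
    have "dlog a < m" "dlog b < m" using assms dlog_less by auto
    then have "q = 1"
    proof -
      have "m * q > 0" "m * q < m * 2"
        using q \<open>dlog a < m\<close> \<open>dlog b < m\<close> by linarith+
      then show ?thesis by (metis One_nat_def less_2_cases mult_0_right nat_mult_less_cancel_disj less_irrefl)
    qed
    then have "dlog a = dlog b" using q \<open>dlog b < m\<close> by simp
    then show "[a = b] (mod l)" using assms g_power_dlog by (metis cong_def)
  next
    assume "[a = b] (mod l)"
    then have "dlog a = dlog b" by (metis cong_def dlog_mod)
    then show "w = 1" by (simp add: w_def complex_norm_square[symmetric] norm_power del: complex_cnj_power)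
  qed
  moreover have "w ^ m = 1"
  proof -
    have "zeta ^ (dlog x * m) = 1" for x by (simp add: zeta_power_eq_1_iff)
    then show ?thesis
      by (simp only: w_def power_mult_distrib power_mult[symmetric] complex_cnj_power[symmetric]) simp
  qed
  ultimately show ?thesis
    using geometric_sum[of w "m"] by (auto simp: eq)
qed

lemma fourier_zero:
  fixes h :: "nat \<Rightarrow> complex"
  assumes "\<And>t. t < m \<Longrightarrow> (\<Sum>a<l. h a * chr t a) = 0" "b < l" "b > 0"
  shows "h b = 0"
proof -
  have b: "\<not> l dvd b" using assms by (auto dest: dvd_imp_le)
  have "0 = (\<Sum>t<m. (\<Sum>a<l. h a * chr t a) * cnj (chr t b))" using assms(1) by simp
  also have "\<dots> = (\<Sum>a<l. h a * (\<Sum>t<m. chr t a * cnj (chr t b)))"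
    unfolding sum_distrib_right sum_distrib_left by (subst sum.swap) (simp add: mult.assoc)
  also have "\<dots> = (\<Sum>a<l. if a = b then h a * of_nat m else 0)"
  proof (rule sum.cong[OF refl])
    fix a assume a: "a \<in> {..<l}"
    show "h a * (\<Sum>t<m. chr t a * cnj (chr t b)) = (if a = b then h a * of_nat m else 0)"
    proof (cases "a = 0")
      case False
      then have "\<not> l dvd a" using a by (auto dest: dvd_imp_le)
      then show ?thesis using a assms(2) by (simp add: chr_orthogonal b cong_def)
    qed (use assms in simp)
  qed
  also have "\<dots> = h b * of_nat m" using assms by (simp add: sum.delta)
  finally show ?thesis using m_pos by simp
qed

end

section \<open>Fourier coefficients of the indicator of the CM type\<close>

text \<open>Squared norms in 1 + u = v give u + cnj u = -1, hence u^2 + u + 1 = 0, and then v =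
  -u^2. The last condition is written as a product because, for an odd character, -(u v) is again a
  value of that character.\<close>

lemma one_plus_unit_eq_unit_iff:
  fixes u v :: complex
  assumes u: "norm u = 1" and v: "norm v = 1"
  shows "1 + u = v \<longleftrightarrow> u ^ 3 = 1 \<and> u \<noteq> 1 \<and> - (u * v) = 1"
proof
  assume e: "1 + u = v"
  have cu: "u * cnj u = 1" and cv: "v * cnj v = 1" using u v by (simp_all add: complex_norm_square[symmetric])
  have "(1 + u) * (1 + cnj u) = 1" using cv e by (metis complex_cnj_add complex_cnj_one)
  then have "u + cnj u = -1" using cu by (simp add: algebra_simps add_eq_0_iff)
  then have "u * (u + cnj u) = - u" by simp
  then have q: "u ^ 2 + u + 1 = 0" using cu by (simp add: power2_eq_square algebra_simps eq_neg_iff_add_eq_0)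
  have "u ^ 3 - 1 = (u - 1) * (u ^ 2 + u + 1)" by (simp add: power2_eq_square power3_eq_cube algebra_simps)
  then have "u ^ 3 = 1" using q by simp
  moreover have "u \<noteq> 1" using q by auto
  moreover have "- (u * v) = 1 - (u ^ 2 + u + 1)" unfolding e[symmetric] by (simp add: power2_eq_square algebra_simps)
  ultimately show "u ^ 3 = 1 \<and> u \<noteq> 1 \<and> - (u * v) = 1" using q by simp
next
  assume a: "u ^ 3 = 1 \<and> u \<noteq> 1 \<and> - (u * v) = 1"
  have "u ^ 3 - 1 = (u - 1) * (u ^ 2 + u + 1)" by (simp add: power2_eq_square power3_eq_cube algebra_simps)
  then have q: "u ^ 2 + u + 1 = 0" using a by simp
  have "u * (1 + u - v) = (u ^ 2 + u + 1) - 1 + - (u * v)" by (simp add: power2_eq_square algebra_simps)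
  also have "\<dots> = 0" using q a by simp
  finally have "1 + u - v = 0" using u by auto
  then show "1 + u = v" by simp
qed

locale fermat_quotient = primroot_mod +
  fixes k :: nat
  assumes k_ge_1: "1 \<le> k" and k_le: "k \<le> l - 2"
begin

lemma not_dvd_k: "\<not> l dvd k" and not_dvd_Suc_k: "\<not> l dvd Suc k"
  using k_ge_1 k_le l_gt_3 by (auto dest!: dvd_imp_le)

text \<open>The value 0 on multiples of l makes periodicity, oddness and the sawtooth identity hold
  for all natural numbers without exceptions.\<close>

definition F :: "nat \<Rightarrow> real" where
  "F n = (if l dvd n then 0 else if n mod l + k * n mod l < l then - 1 / 2 else 1 / 2)"

text \<open>The first periodic Bernoulli function at n / l, with value 0 at its jumps.\<close>

definition saw :: "nat \<Rightarrow> real" where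
  "saw n = (if l dvd n then 0 else real (n mod l) / real l - 1 / 2)"

lemma F_mod: "F (n mod l) = F n"
  by (simp add: F_def dvd_mod_iff mod_mult_right_eq)

lemma saw_mod: "saw (n mod l) = saw n"
  by (simp add: saw_def dvd_mod_iff)

text \<open>For n prime to l and s the sum of the two residues, the residue of (k + 1) n is s or s -
  l, according to the case of \<open>F\<close>. It is not 0, since l divides neither n nor k + 1, so
  all three sawtooth values follow the generic formula.\<close>

lemma F_eq_saw: "F n = saw n + saw (k * n) - saw (Suc k * n)"
proof (cases "l dvd n")
  case False
  define s where "s = n mod l + k * n mod l"
  have e: "Suc k * n mod l = s mod l" by (simp add: s_def mod_add_eq)
  have s: "s < 2 * l" unfolding s_def using l_gt_3 mod_less_divisor[of l n] mod_less_divisor[of l "k * n"] by linarith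
  have nd: "\<not> l dvd Suc k * n" using False not_dvd_Suc_k by (simp del: mult_Suc)
  have "real (Suc k * n mod l) = (if s < l then real s else real s - real l)"
  proof (cases "s < l")
    case False
    then have "s mod l = s - l" using s by (simp add: mod_if)
    then show ?thesis using False e by (simp add: of_nat_diff del: mult_Suc)
  qed (simp add: e del: mult_Suc)
  then have "saw (Suc k * n) = (if s < l then real s else real s - real l) / real l - 1 / 2"
    using nd by (simp only: saw_def if_False)
  moreover have "saw n + saw (k * n) = real s / real l - 1"
    using False not_dvd_k by (simp add: saw_def s_def add_divide_distrib)
  moreover have "F n = (if s < l then - 1 / 2 else 1 / 2)"
    using False by (simp add: F_def s_def)
  ultimately show ?thesis using l_gt_3 by (simp add: diff_divide_distrib)
qed (simp add: F_def saw_def)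

lemma m_mult_mod: "\<not> l dvd n \<Longrightarrow> m * n mod l = l - n mod l"
proof -
  assume n: "\<not> l dvd n"
  define r where "r = n mod l"
  have r: "0 < r" "r < l" using n l_gt_3 by (auto simp: r_def dvd_eq_mod_eq_0)
  have "m * n mod l = m * r mod l" by (simp add: r_def mod_mult_right_eq)
  also have "m * r = (l - r) + (r - 1) * l"
    using r by (cases r) (auto simp: m_def algebra_simps diff_mult_distrib)
  also have "\<dots> mod l = (l - r) mod l" by (rule mod_mult_self1)
  also have "\<dots> = l - r" using r by simp
  finally show ?thesis by (simp add: r_def)
qed

lemma saw_minus: "saw (m * n) = - saw n"
proof (cases "l dvd n")
  case False
  have "real (m * n mod l) = real l - real (n mod l)"
    using m_mult_mod[OF False] l_gt_3 by (simp add: of_nat_diff)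
  then show ?thesis using False not_dvd_m l_gt_3 by (simp add: saw_def diff_divide_distrib)
qed (simp add: saw_def)

lemma F_minus: "F (m * n) = - F n"
  using saw_minus[of n] saw_minus[of "k * n"] saw_minus[of "Suc k * n"]
  by (simp add: F_eq_saw mult.left_commute del: mult_Suc)

lemma F_cases: "\<not> l dvd n \<Longrightarrow> F n = 1 / 2 \<or> F n = - 1 / 2"
  by (simp add: F_def)

lemma sum_shift_chr:
  fixes h :: "nat \<Rightarrow> complex"
  assumes "\<And>n. h (n mod l) = h n" "\<not> l dvd c"
  shows "(\<Sum>a<l. h (c * a) * chr t a) = cnj (chr t c) * (\<Sum>a<l. h a * chr t a)"
proof -
  have "(\<Sum>a<l. h a * chr t a) = (\<Sum>a<l. h (c * a) * chr t (c * a))"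
    by (rule sum_units[symmetric]) (use assms chr_mod in auto)
  also have "\<dots> = chr t c * (\<Sum>a<l. h (c * a) * chr t a)"
    by (simp add: chr_mult sum_distrib_left mult.left_commute)
  finally have "cnj (chr t c) * (\<Sum>a<l. h a * chr t a) = (chr t c * cnj (chr t c)) * (\<Sum>a<l. h (c * a) * chr t a)"
    by simp
  then show ?thesis using chr_cnj[OF assms(2)] by simp
qed

definition Fhat :: "nat \<Rightarrow> complex" where
  "Fhat t = (\<Sum>a<l. of_real (F a) * chr t a)"

lemma Fhat_even: "even t \<Longrightarrow> Fhat t = 0"
proof -
  assume t: "even t"
  have "- Fhat t = (\<Sum>a<l. of_real (F (m * a)) * chr t a)"
    by (simp add: F_minus Fhat_def sum_negf)
  also have "\<dots> = cnj (chr t m) * Fhat t"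
    unfolding Fhat_def by (rule sum_shift_chr) (auto simp: F_mod not_dvd_m)
  also have "chr t m = 1" using chr_minus_1[of t] t by (simp add: m_def)
  finally show ?thesis by simp
qed

lemma sum_saw_chr_nonzero:
  assumes "odd t"
  shows "(\<Sum>a<l. of_real (saw a) * chr t a) \<noteq> 0"
proof -
  interpret X: dirichlet_char l "chr t" by (rule dirichlet_char_chr)
  have m1: "chr t (l - 1) = -1" using chr_minus_1[of t] assms by (simp add: m_def)
  have "(\<Sum>a<l. chr t a) = 0"
    by (rule X.sum_period[of "l - 1"]) (use not_dvd_m m1 in \<open>auto simp: m_def\<close>)
  moreover have "of_real (saw a) * chr t a = of_nat a * chr t a / of_nat l - chr t a / 2" if "a < l" for a
    using that l_gt_3 by (cases "l dvd a") (auto simp: saw_def chr_def algebra_simps)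
  ultimately have "(\<Sum>a<l. of_real (saw a) * chr t a) = (\<Sum>a<l. of_nat a * chr t a) / of_nat l"
    by (simp add: sum_subtractf sum_divide_distrib[symmetric])
  then show ?thesis using X.sum_mult_X_nonzero[OF m1] l_gt_3 by simp
qed

lemma Fhat_eq:
  "Fhat t = (1 + cnj (chr t k) - cnj (chr t (Suc k))) * (\<Sum>a<l. of_real (saw a) * chr t a)"
proof -
  have "Fhat t = (\<Sum>a<l. of_real (saw a) * chr t a) + (\<Sum>a<l. of_real (saw (k * a)) * chr t a)
       - (\<Sum>a<l. of_real (saw (Suc k * a)) * chr t a)"
    by (simp add: Fhat_def F_eq_saw sum.distrib sum_subtractf ring_distribs del: mult_Suc)
  also have "(\<Sum>a<l. of_real (saw (k * a)) * chr t a) = cnj (chr t k) * (\<Sum>a<l. of_real (saw a) * chr t a)"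
    by (rule sum_shift_chr) (auto simp: saw_mod not_dvd_k)
  also have "(\<Sum>a<l. of_real (saw (Suc k * a)) * chr t a) = cnj (chr t (Suc k)) * (\<Sum>a<l. of_real (saw a) * chr t a)"
    by (rule sum_shift_chr) (auto simp: saw_mod not_dvd_Suc_k)
  finally show ?thesis by (simp add: algebra_simps)
qed

text \<open>As \<open>m = l - 1\<close> is congruent to \<open>-1\<close>, \<open>x\<close> represents \<open>-k\<^sup>2 - k\<close>.\<close>

definition x :: nat where "x = m * (k * Suc k)"

lemma not_dvd_x: "\<not> l dvd x"
  using not_dvd_m not_dvd_k not_dvd_Suc_k by (simp add: x_def del: mult_Suc_right)

text \<open>In terms of values: \<open>chr t\<close> is odd, \<open>chr t x = 1\<close>, and
  \<open>chr t k\<close> has order exactly 3.\<close>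

definition bad :: "nat \<Rightarrow> bool" where
  "bad t \<longleftrightarrow> odd t \<and> ord l x dvd t \<and> ord l k dvd 3 * t \<and> \<not> ord l k dvd t"

lemma chr_eq_1_ord: "\<not> l dvd n \<Longrightarrow> chr t n = 1 \<longleftrightarrow> ord l n dvd t"
  using chr_eq_1_iff[of n t] ord_divides'[of n t l] l_gt_3 by (simp add: cong_def)

lemma Fhat_zero_iff:
  assumes "odd t"
  shows "Fhat t = 0 \<longleftrightarrow> bad t"
proof -
  have "Fhat t = 0 \<longleftrightarrow> 1 + cnj (chr t k) - cnj (chr t (Suc k)) = 0"
    using sum_saw_chr_nonzero[OF assms] by (simp add: Fhat_eq)
  also have "\<dots> \<longleftrightarrow> 1 + chr t k = chr t (Suc k)"
    by (metis complex_cnj_add complex_cnj_cancel_iff complex_cnj_one eq_iff_diff_eq_0)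
  also have "\<dots> \<longleftrightarrow> chr t k ^ 3 = 1 \<and> chr t k \<noteq> 1 \<and> - (chr t k * chr t (Suc k)) = 1"
    by (rule one_plus_unit_eq_unit_iff[OF norm_chr[OF not_dvd_k] norm_chr[OF not_dvd_Suc_k]])
  also have "- (chr t k * chr t (Suc k)) = chr t x"
    using chr_minus_1[of t] assms by (simp add: x_def chr_mult del: mult_Suc_right)
  also have "chr t k ^ 3 = chr (3 * t) k" by (rule chr_mult_left[OF not_dvd_k, symmetric])
  also have "chr (3 * t) k = 1 \<and> chr t k \<noteq> 1 \<and> chr t x = 1 \<longleftrightarrow> bad t"
    using assms by (auto simp: bad_def chr_eq_1_ord not_dvd_k not_dvd_x)
  finally show ?thesis .
qed

section \<open>Subgroups of G, averages over them and their stabilisers\<close>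

definition H :: "nat \<Rightarrow> nat set" where
  "H f = {h \<in> {1..<l}. h ^ f mod l = 1}"

lemma finite_H [simp]: "finite (H f)" by (simp add: H_def)

lemma H_not_dvd: "h \<in> H f \<Longrightarrow> \<not> l dvd h"
  by (auto simp: H_def dest: dvd_imp_le)

lemma one_in_H: "1 \<in> H f" using l_gt_3 by (simp add: H_def)

lemma mult_mod_range: "\<not> l dvd a \<Longrightarrow> a mod l \<in> {1..<l}"
  using l_gt_3 by (auto simp: dvd_eq_mod_eq_0)

lemma H_mult:
  assumes "a \<in> H f" "b \<in> H f"
  shows "a * b mod l \<in> H f"
proof -
  have "(a * b mod l) ^ f mod l = ((a ^ f mod l) * (b ^ f mod l)) mod l"
    by (simp add: power_mod power_mult_distrib mod_mult_eq)
  also have "\<dots> = 1" using assms l_gt_3 by (simp add: H_def)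
  finally have "(a * b mod l) ^ f mod l = 1" .
  moreover have "a * b mod l \<in> {1..<l}"
    using H_not_dvd[OF assms(1)] H_not_dvd[OF assms(2)] by (intro mult_mod_range) simp
  ultimately show ?thesis by (simp add: H_def)
qed

lemma H_eq_image:
  assumes "f dvd m"
  shows "H f = (\<lambda>j. g ^ (m div f * j) mod l) ` {..<f}" (is "_ = ?h ` _")
    and "inj_on (\<lambda>j. g ^ (m div f * j) mod l) {..<f}"
proof -
  obtain q where q: "m = f * q" using assms by (elim dvdE)
  then have f: "f > 0" "q > 0" using m_pos by auto
  have mq: "m div f = q" using q f by simp
  have pw: "g ^ i mod l = 1 \<longleftrightarrow> m dvd i" for i
    using g_power_cong_iff[of i 0] l_gt_3 by (simp add: cong_0_iff)
  show "H f = ?h ` {..<f}"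
  proof (intro equalityI subsetI)
    fix h assume h: "h \<in> H f"
    then have nd: "\<not> l dvd h" by (rule H_not_dvd)
    have hl: "h < l" "h ^ f mod l = 1" using h by (auto simp: H_def)
    have "g ^ (dlog h * f) mod l = (g ^ dlog h mod l) ^ f mod l" by (simp add: power_mult power_mod)
    also have "\<dots> = 1" using g_power_dlog[OF nd] hl by (simp add: power_mod)
    finally have "f * q dvd dlog h * f" using pw q by simp
    then have "q dvd dlog h" using f by (simp add: mult.commute)
    then obtain j where j: "dlog h = q * j" by (elim dvdE)
    have "j < f" using dlog_less[OF nd] q f by (simp add: j mult.commute[of q])
    moreover have "h = ?h j" using g_power_dlog[OF nd] hl by (simp add: j mq)
    ultimately show "h \<in> ?h ` {..<f}" by blast
  next
    fix h assume "h \<in> ?h ` {..<f}"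
    then obtain j where j: "h = g ^ (q * j) mod l" by (auto simp: mq)
    have "h ^ f mod l = g ^ (q * j * f) mod l" by (simp add: j power_mod power_mult)
    also have "\<dots> = 1" using q by (subst pw) (simp add: mult_ac)
    finally show "h \<in> H f" using mult_mod_range[OF not_dvd_g_power[of "q * j"]] by (simp add: H_def j)
  qed
  show "inj_on ?h {..<f}"
  proof (rule inj_onI)
    fix i j assume ij: "i \<in> {..<f}" "j \<in> {..<f}" "?h i = ?h j"
    then have "[q * i = q * j] (mod m)" using g_power_cong_iff by (simp add: mq)
    moreover have "q * i < m" "q * j < m" using ij q f by (auto simp: mult.commute[of f])
    ultimately show "i = j" using f by (simp add: cong_def)
  qed
qed

lemma card_H: "f dvd m \<Longrightarrow> card (H f) = f"
  using H_eq_image[of f] by (simp add: card_image)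

lemma chr_trivial_on_H_iff:
  assumes "f dvd m"
  shows "(\<forall>h\<in>H f. chr t h = 1) \<longleftrightarrow> f dvd t"
proof
  obtain q where q: "m = f * q" using assms by (elim dvdE)
  then have f: "f > 0" "q > 0" using m_pos by auto
  have mq: "m div f = q" using q f by simp
  assume tr: "\<forall>h\<in>H f. chr t h = 1"
  define h where "h = g ^ q mod l"
  have nd: "\<not> l dvd g ^ q" by (rule not_dvd_g_power)
  have "h ^ f mod l = g ^ (q * f) mod l" by (simp add: h_def power_mod power_mult)
  also have "\<dots> = 1" using g_power_cong_iff[of "q * f" 0] l_gt_3 q by (simp add: cong_0_iff mult.commute)
  finally have "h \<in> H f" using mult_mod_range[OF nd] by (simp add: H_def h_def)
  then have "chr t h = 1" using tr by blast
  then have "chr t (g ^ q) = 1" by (simp add: h_def chr_mod)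
  then have "g ^ (q * t) mod l = 1" using chr_eq_1_iff[OF nd] by (simp add: power_mult)
  then have "m dvd q * t" using g_power_cong_iff[of "q * t" 0] l_gt_3 by (simp add: cong_0_iff)
  then show "f dvd t" using q f by simp
next
  assume "f dvd t"
  then obtain s where "t = f * s" by (elim dvdE)
  moreover have "h ^ (f * s) mod l = (h ^ f mod l) ^ s mod l" for h s
    by (simp add: power_mod power_mult)
  ultimately show "\<forall>h\<in>H f. chr t h = 1"
    using l_gt_3 by (auto simp: chr_eq_1_iff H_not_dvd) (auto simp: H_def)
qed

text \<open>Multiplication by \<open>u0\<close> is injective, so it permutes the finite set
  \<open>U\<close>, and it multiplies the sum by \<open>chr t u0\<close>. The formulation by closure
  serves \<open>H f\<close> and stabilisers alike.\<close>

lemma sum_chr_closed: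
  assumes U: "U \<subseteq> {1..<l}" "\<And>a b. a \<in> U \<Longrightarrow> b \<in> U \<Longrightarrow> a * b mod l \<in> U"
    and u0: "u0 \<in> U" "chr t u0 \<noteq> 1"
  shows "(\<Sum>u\<in>U. chr t u) = 0"
proof -
  have fin: "finite U" using U(1) finite_subset by blast
  have "u0 \<in> {1..<l}" using U(1) u0(1) by blast
  then have nd: "\<not> l dvd u0" by (auto dest: dvd_imp_le)
  have "coprime u0 l" using nd coprime_l_iff[of u0] by (simp add: coprime_commute)
  then have "inj_on (\<lambda>u. u0 * u mod l) {..<l}"
    using bij_betw_mult_mod[of u0 l] l_gt_3 by (simp add: bij_betw_def)
  then have inj: "inj_on (\<lambda>u. u0 * u mod l) U"
    by (rule inj_on_subset) (use U(1) in auto)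
  have "(\<lambda>u. u0 * u mod l) ` U \<subseteq> U" using U(2)[OF u0(1)] by auto
  then have im: "(\<lambda>u. u0 * u mod l) ` U = U" using inj fin by (simp add: endo_inj_surj)
  have "(\<Sum>u\<in>U. chr t u) = (\<Sum>u\<in>U. chr t (u0 * u mod l))"
    by (subst im[symmetric], subst sum.reindex[OF inj]) simp
  also have "\<dots> = chr t u0 * (\<Sum>u\<in>U. chr t u)"
    by (simp add: chr_mod chr_mult sum_distrib_left)
  finally have "(1 - chr t u0) * (\<Sum>u\<in>U. chr t u) = 0" by (simp add: algebra_simps)
  then show ?thesis using u0(2) by simp
qed

lemma sum_cnj_chr_H:
  assumes "h0 \<in> H f" "chr t h0 \<noteq> 1"
  shows "(\<Sum>h\<in>H f. cnj (chr t h)) = 0"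
proof -
  have "(\<Sum>h\<in>H f. chr t h) = 0"
    using H_mult assms by (intro sum_chr_closed[of "H f" h0]) (auto simp: H_def)
  then show ?thesis by (simp flip: cnj_sum)
qed

definition Fsum :: "nat \<Rightarrow> nat \<Rightarrow> real" where
  "Fsum f a = (\<Sum>h\<in>H f. F (a * h))"

lemma Fsum_mod: "Fsum f (n mod l) = Fsum f n"
  unfolding Fsum_def
proof (rule sum.cong[OF refl])
  fix h show "F (n mod l * h) = F (n * h)"
    by (metis F_mod mod_mult_left_eq)
qed

text \<open>Averaging is a projection up to scale: the first factor vanishes unless
  \<open>chr t\<close> is trivial on \<open>H f\<close>, which for f dividing \<open>m\<close> means
  that f divides t.\<close>

lemma sum_Fsum_chr: "(\<Sum>a<l. of_real (Fsum f a) * chr t a) = (\<Sum>h\<in>H f. cnj (chr t h)) * Fhat t"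
proof -
  have "(\<Sum>a<l. of_real (Fsum f a) * chr t a) = (\<Sum>h\<in>H f. \<Sum>a<l. of_real (F (h * a)) * chr t a)"
    unfolding Fsum_def of_real_sum sum_distrib_right by (subst sum.swap) (simp add: mult.commute)
  also have "\<dots> = (\<Sum>h\<in>H f. cnj (chr t h) * Fhat t)"
    unfolding Fhat_def by (intro sum.cong refl sum_shift_chr) (auto simp: F_mod H_not_dvd)
  finally show ?thesis by (simp add: sum_distrib_right)
qed

definition W :: "nat \<Rightarrow> nat set" where
  "W f = {w \<in> {1..<l}. \<forall>a\<in>{1..<l}. Fsum f (a * w) = Fsum f a}"

lemma W_not_dvd: "w \<in> W f \<Longrightarrow> \<not> l dvd w"
  by (auto simp: W_def dest: dvd_imp_le)

text \<open>Translation by w multiplies the coefficient of \<open>Fsum f\<close> at t by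
  \<open>cnj (chr t w)\<close>; invariance forces this factor to be 1 wherever the coefficient is
  non-zero.\<close>

lemma chr_W:
  assumes w: "w \<in> W f" and f: "f dvd m" "f dvd t" and t: "Fhat t \<noteq> 0"
  shows "chr t w = 1"
proof -
  let ?S = "\<Sum>a<l. of_real (Fsum f a) * chr t a"
  have tr: "chr t h = 1" if "h \<in> H f" for h using chr_trivial_on_H_iff[OF f(1)] f(2) that by blast
  have "?S = of_nat (card (H f)) * Fhat t" by (simp add: sum_Fsum_chr tr)
  then have S: "?S \<noteq> 0" using t one_in_H[of f] by auto
  have "?S = (\<Sum>a<l. of_real (Fsum f (w * a)) * chr t a)"
  proof (rule sum.cong[OF refl])
    fix a assume "a \<in> {..<l}"
    then show "of_real (Fsum f a) * chr t a = of_real (Fsum f (w * a)) * chr t a"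
      using w by (cases "a = 0") (auto simp: W_def mult.commute)
  qed
  also have "\<dots> = cnj (chr t w) * ?S"
    by (rule sum_shift_chr) (auto simp: Fsum_mod W_not_dvd[OF w])
  finally have "cnj (chr t w) = 1" using S by simp
  then show ?thesis by (metis complex_cnj_cnj complex_cnj_one)
qed

text \<open>Uniqueness of Fourier coefficients gives the converse of the preceding lemma: if f does
  not divide t, averaging kills the coefficient; if it does, either \<open>Fhat t\<close> or
  \<open>chr t w - 1\<close> vanishes.\<close>

lemma W_I:
  assumes w: "w \<in> {1..<l}" and f: "f dvd m"
    and tr: "\<And>t. t < m \<Longrightarrow> f dvd t \<Longrightarrow> Fhat t \<noteq> 0 \<Longrightarrow> chr t w = 1"
  shows "w \<in> W f"
proof -
  have nd: "\<not> l dvd w" using w by (auto dest: dvd_imp_le)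
  define h where "h a = complex_of_real (Fsum f (w * a) - Fsum f a)" for a
  have "(\<Sum>a<l. h a * chr t a) = 0" if t: "t < m" for t
  proof -
    have "(\<Sum>a<l. h a * chr t a) = (\<Sum>a<l. of_real (Fsum f (w * a)) * chr t a) - (\<Sum>a<l. of_real (Fsum f a) * chr t a)"
      by (simp add: h_def left_diff_distrib sum_subtractf)
    also have "(\<Sum>a<l. of_real (Fsum f (w * a)) * chr t a) = cnj (chr t w) * (\<Sum>a<l. of_real (Fsum f a) * chr t a)"
      by (rule sum_shift_chr) (auto simp: Fsum_mod nd)
    finally have e: "(\<Sum>a<l. h a * chr t a) = (cnj (chr t w) - 1) * ((\<Sum>h\<in>H f. cnj (chr t h)) * Fhat t)"
      unfolding sum_Fsum_chr by (simp only: left_diff_distrib mult_1_left)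
    show ?thesis
    proof (cases "f dvd t")
      case True
      then show ?thesis using tr[OF t] e by (cases "Fhat t = 0") auto
    next
      case False
      then obtain h0 where "h0 \<in> H f" "chr t h0 \<noteq> 1" using chr_trivial_on_H_iff[OF f] by blast
      then show ?thesis using e sum_cnj_chr_H by simp
    qed
  qed
  then have "h a = 0" if "a \<in> {1..<l}" for a using fourier_zero[of h a] that by simp
  then show ?thesis using w by (auto simp: W_def h_def mult.commute)
qed

text \<open>Both claims come from \<open>lcm f (ord l k) = 3 * f\<close>: the quotient of the lcm by
  f divides 3, and it is not 1 because \<open>ord l k\<close> does not divide f.\<close>

lemma dvd_m_if_bad:
  assumes "f dvd m" "bad f"
  shows "3 * f dvd m" and "ord l k dvd t \<Longrightarrow> f dvd t \<Longrightarrow> 3 * f dvd t"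
proof -
  have b: "ord l k dvd 3 * f" "\<not> ord l k dvd f" using assms(2) by (auto simp: bad_def)
  have f: "f > 0" using assms m_pos by (auto intro: Nat.gr0I)
  have "lcm f (ord l k) dvd 3 * f" using b by simp
  moreover obtain c where c: "lcm f (ord l k) = f * c" using dvd_lcm1 by (metis dvdE)
  ultimately have "c dvd 3" using f by (simp add: mult.commute)
  moreover have "c \<noteq> 1" using c b(2) by (metis dvd_lcm2 mult.right_neutral)
  ultimately have "c = 3" using prime_nat_iff[of 3] by auto
  then have L: "lcm f (ord l k) = 3 * f" using c by simp
  have "ord l k dvd m"
    using order_divides_totient[of l k] coprime_l_iff not_dvd_k prime_l by (simp add: totient_prime m_def)
  then show "3 * f dvd m" using assms(1) L by (metis lcm_least)
  show "ord l k dvd t \<Longrightarrow> f dvd t \<Longrightarrow> 3 * f dvd t" using L by (metis lcm_least)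
qed

text \<open>\<open>chr t\<close> has kernel \<open>H t\<close> for \<open>t\<close> dividing \<open>m\<close>, so it suffices to look at \<open>chr f\<close> and \<open>chr (3 * f)\<close>.\<close>

theorem bad_iff_W_eq_H:
  assumes f: "odd f" "f dvd m"
  shows "bad f \<longleftrightarrow> 3 * f dvd m \<and> W f = H (3 * f)"
proof
  assume b: "bad f"
  note d = dvd_m_if_bad[OF f(2) b]
  have "W f \<subseteq> H (3 * f)"
  proof
    fix w assume w: "w \<in> W f"
    have "\<not> bad (3 * f)" using b by (auto simp: bad_def)
    then have "Fhat (3 * f) \<noteq> 0" using Fhat_zero_iff[of "3 * f"] f by simp
    then have "chr (3 * f) w = 1" using chr_W[OF w f(2)] by simp
    then show "w \<in> H (3 * f)" using w chr_eq_1_iff[OF W_not_dvd[OF w]] by (simp add: H_def W_def)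
  qed
  moreover have "H (3 * f) \<subseteq> W f"
  proof
    fix w assume w: "w \<in> H (3 * f)"
    show "w \<in> W f"
    proof (rule W_I[OF _ f(2)])
      show "w \<in> {1..<l}" using w by (simp add: H_def)
      fix t assume t: "f dvd t" "Fhat t \<noteq> 0"
      then have "odd t" using Fhat_even by blast
      then have "\<not> bad t" using Fhat_zero_iff t by simp
      moreover have "ord l x dvd t" using b t dvd_trans by (auto simp: bad_def)
      moreover have "ord l k dvd 3 * t"
        using b t(1) by (auto simp: bad_def intro: dvd_trans mult_dvd_mono)
      \<comment> \<open>An odd multiple t of f inherits all conditions of \<open>bad\<close> except
        the last, so it is the last one that fails.\<close>
      ultimately have "ord l k dvd t" using \<open>odd t\<close> by (simp add: bad_def)
      then have "3 * f dvd t" using d(2) t by blast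
      then show "chr t w = 1" using chr_trivial_on_H_iff[OF d(1)] w by blast
    qed
  qed
  ultimately show "3 * f dvd m \<and> W f = H (3 * f)" using d(1) by blast
next
  assume a: "3 * f dvd m \<and> W f = H (3 * f)"
  show "bad f"
  proof (rule ccontr)
    assume "\<not> bad f"
    then have F: "Fhat f \<noteq> 0" using Fhat_zero_iff f by simp
    have "W f \<subseteq> H f"
    proof
      fix w assume w: "w \<in> W f"
      then have "chr f w = 1" using chr_W[OF w f(2) _ F] by simp
      then show "w \<in> H f" using w chr_eq_1_iff[OF W_not_dvd[OF w]] by (simp add: H_def W_def)
    qed
    then have "card (H (3 * f)) \<le> card (H f)" using a by (simp add: card_mono)
    then have "3 * f \<le> f" using card_H[of f] card_H[of "3 * f"] a f by simp
    then show False using f by (cases f) auto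
  qed
qed

lemma W_1_eq:
  assumes "\<not> bad 1"
  shows "W 1 = {1}"
proof
  have F: "Fhat 1 \<noteq> 0" using Fhat_zero_iff[of 1] assms by simp
  show "W 1 \<subseteq> {1}"
  proof
    fix w assume w: "w \<in> W 1"
    then have "chr 1 w = 1" using chr_W[OF w _ _ F] by simp
    then show "w \<in> {1}" using w chr_eq_1_iff[OF W_not_dvd[OF w]] by (simp add: W_def)
  qed
  show "{1} \<subseteq> W 1" using l_gt_3 by (auto simp: W_def)
qed

text \<open>If k has order 3, l divides (k - 1)(k^2 + k + 1) but not k - 1, so -k^2 - k is congruent
  to 1 and the condition on \<open>ord l x\<close> holds automatically.\<close>

lemma bad_1_iff: "bad 1 \<longleftrightarrow> ord l k = 3"
proof
  assume "bad 1"
  then have "ord l k dvd 3" "ord l k \<noteq> 1" by (auto simp: bad_def)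
  then show "ord l k = 3" using prime_nat_iff[of 3] by auto
next
  assume o: "ord l k = 3"
  have "[k ^ 3 = 1] (mod l)" using ord[of k l] o by simp
  then have "int l dvd int k ^ 3 - 1"
    by (metis cong_iff_dvd_diff cong_int_iff of_nat_1 of_nat_power)
  then have "int l dvd (int k - 1) * (int k ^ 2 + int k + 1)"
    by (simp add: power2_eq_square power3_eq_cube algebra_simps)
  moreover have "\<not> int l dvd int k - 1"
  proof
    assume "int l dvd int k - 1"
    then have "[k ^ 1 = 1] (mod l)" by (metis cong_iff_dvd_diff cong_int_iff of_nat_1 power_one_right)
    then have "ord l k dvd 1" using ord_divides'[of k 1 l] by simp
    then show False using o by simp
  qed
  moreover have "prime (int l)" using prime_l by simp
  ultimately have q: "int l dvd int k ^ 2 + int k + 1" using prime_dvd_mult_iff by blast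
  have im: "int m = int l - 1" using l_gt_3 by (simp add: m_def of_nat_diff)
  have "int x - 1 = int l * (int k * (int k + 1)) - (int k ^ 2 + int k + 1)"
    by (simp add: x_def im algebra_simps power2_eq_square)
  then have "int l dvd int x - 1" using q by (metis dvd_diff dvd_triv_left)
  then have "[x ^ 1 = 1] (mod l)" by (metis cong_iff_dvd_diff cong_int_iff of_nat_1 power_one_right)
  then have "ord l x dvd 1" using ord_divides'[of x 1 l] by simp
  then show "bad 1" using o by (simp add: bad_def)
qed

end

section \<open>Divisibility\<close>

text \<open>The part of a prime to 3 divides t in any case, so only the power of 3 is in
  question.\<close>

lemma dvd_iff_multiplicity_3_le:
  fixes a t :: nat
  assumes "a dvd 3 * t" "t > 0"
  shows "a dvd t \<longleftrightarrow> multiplicity 3 a \<le> multiplicity 3 t"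
proof
  assume "a dvd t"
  then show "multiplicity 3 a \<le> multiplicity 3 t" using assms(2) by (intro dvd_imp_multiplicity_le) auto
next
  assume le: "multiplicity 3 a \<le> multiplicity 3 t"
  have a0: "a \<noteq> 0" using assms by (auto intro: Nat.gr0I)
  obtain a' where a': "a = 3 ^ multiplicity 3 a * a'" "\<not> 3 dvd a'"
    using multiplicity_decompose'[of a "3 :: nat"] a0 by auto
  have cop: "coprime a' 3" using a'(2) using prime_imp_coprime[of "3::nat" a'] by (simp add: coprime_commute)
  have "a' dvd 3 * t" using a'(1) assms(1) by (metis dvd_mult_left mult.commute)
  then have "a' dvd t" using cop by (simp add: coprime_dvd_mult_right_iff)
  moreover have "3 ^ multiplicity 3 a dvd t" using le by (rule multiplicity_dvd')
  moreover have "coprime (3 ^ multiplicity 3 a) a'" using cop by (simp add: coprime_commute)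
  ultimately show "a dvd t" using a'(1) by (metis divides_mult)
qed

context
  fixes a b :: nat
  assumes pos: "a > 0" "b > 0"
    and odd_ab: "odd a" "odd b" and v3: "multiplicity 3 a < multiplicity 3 b"
begin

lemma three_dvd_lcm: "3 dvd lcm a b"
proof -
  have "3 dvd b" using v3 by (metis not_dvd_imp_multiplicity_0 not_less_zero)
  then show ?thesis by (rule dvd_lcmI2)
qed

lemma multiplicity_3_lcm: "multiplicity 3 (lcm a b) = multiplicity 3 b"
  using v3 pos by (simp add: multiplicity_lcm)

lemma odd_lcm: "odd (lcm a b)"
proof -
  have "lcm a b dvd a * b" by simp
  moreover have "odd (a * b)" using odd_ab by simp
  ultimately show ?thesis using dvd_trans by blast
qed

lemma lcm_div_3: "odd (lcm a b div 3)" "\<not> lcm a b dvd lcm a b div 3"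
proof -
  obtain N' where N': "lcm a b = 3 * N'" using three_dvd_lcm by (elim dvdE)
  moreover have "lcm a b > 0" using pos by (simp add: lcm_pos_nat)
  ultimately show "odd (lcm a b div 3)" "\<not> lcm a b dvd lcm a b div 3"
    using odd_lcm by (auto dest: dvd_imp_le)
qed

text \<open>In 3-adic valuations both sides force v_3(b) = v_3(t) + 1; then v_3(a) < v_3(b) gives
  v_3(a) \<le> v_3(t), so that a | t follows from a | 3t.\<close>

lemma lcm_div_3_dvd_iff:
  assumes t: "odd t"
  shows "a dvd t \<and> b dvd 3 * t \<and> \<not> b dvd t \<longleftrightarrow> lcm a b div 3 dvd t \<and> \<not> lcm a b dvd t"
proof -
  have t0: "t > 0" using t by (cases t) auto
  obtain N' where N': "lcm a b = 3 * N'" using three_dvd_lcm by (elim dvdE)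
  have "lcm a b div 3 dvd t \<longleftrightarrow> lcm a b dvd 3 * t" by (simp add: N')
  then have e: "lcm a b div 3 dvd t \<longleftrightarrow> a dvd 3 * t \<and> b dvd 3 * t" by simp
  show ?thesis
  proof
    assume "a dvd t \<and> b dvd 3 * t \<and> \<not> b dvd t"
    then show "lcm a b div 3 dvd t \<and> \<not> lcm a b dvd t" unfolding e by auto
  next
    assume A: "lcm a b div 3 dvd t \<and> \<not> lcm a b dvd t"
    then have d: "a dvd 3 * t" "b dvd 3 * t" "lcm a b dvd 3 * t" using e by auto
    have "\<not> multiplicity 3 (lcm a b) \<le> multiplicity 3 t"
      using A dvd_iff_multiplicity_3_le[OF d(3) t0] by blast
    then have "multiplicity 3 t < multiplicity 3 b" using multiplicity_3_lcm by simp
    then have "\<not> b dvd t" using dvd_iff_multiplicity_3_le[OF d(2) t0] by simp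
    moreover have "multiplicity 3 (lcm a b) \<le> multiplicity 3 (3 * t)"
      using d(3) t0 by (intro dvd_imp_multiplicity_le) auto
    then have "multiplicity 3 b \<le> Suc (multiplicity 3 t)"
      using multiplicity_3_lcm t0 by (simp add: multiplicity_times_same)
    then have "a dvd t" using dvd_iff_multiplicity_3_le[OF d(1) t0] v3 by simp
    ultimately show "a dvd t \<and> b dvd 3 * t \<and> \<not> b dvd t" using d by simp
  qed
qed

end

text \<open>A single exponent t of this shape already forces v_3(a) \<le> v_3(t) < v_3(b), and
  oddness passes to divisors. With the preceding lemma this settles when bad exponents
  exist.\<close>

lemma multiplicity_3_less:
  fixes a b t :: nat
  assumes t: "odd t" "a dvd t" "b dvd 3 * t" "\<not> b dvd t"
  shows "odd a" "odd b" "multiplicity 3 a < multiplicity 3 b"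
proof -
  have t0: "t > 0" using t(1) by (cases t) auto
  have "odd (3 * t)" using t(1) by simp
  then show "odd a" "odd b" using t dvd_trans by blast+
  have "a dvd 3 * t" using t(2) by simp
  then have "multiplicity 3 a \<le> multiplicity 3 t" using dvd_iff_multiplicity_3_le t0 t(2) by blast
  then show "multiplicity 3 a < multiplicity 3 b"
    using dvd_iff_multiplicity_3_le[OF t(3) t0] t(4) by simp
qed

lemma card_odd_not_3_dvd: "card {s. s < 6 * q \<and> odd s \<and> \<not> 3 dvd s} = 2 * (q :: nat)"
proof (induction q)
  case (Suc q)
  have "{s. s < 6 * Suc q \<and> odd s \<and> \<not> 3 dvd s} =
        insert (6 * q + 1) (insert (6 * q + 5) {s. s < 6 * q \<and> odd s \<and> \<not> 3 dvd s})"
    (is "?A = ?B")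
  proof (intro equalityI subsetI)
    fix s assume s: "s \<in> ?A"
    show "s \<in> ?B"
    proof (cases "s < 6 * q")
      case False
      then obtain r where r: "s = 6 * q + r" "r < 6" using s by (metis (no_types, lifting) add_diff_inverse_nat mem_Collect_eq mult_Suc_right nat_add_left_cancel_less add.commute)
      have "odd r" "\<not> 3 dvd r" using s r by auto
      then have "r = 1 \<or> r = 5" using r(2) by presburger
      then show ?thesis using r by auto
    qed (use s in simp)
  next
    fix s assume "s \<in> ?B"
    then show "s \<in> ?A" by auto presburger+
  qed
  then show ?case using Suc.IH by simp
qed simp

text \<open>Writing t = (N/3) s turns the conditions into s odd, s prime to 3 and s < 3m/N. As N is
  odd and m even, m/N is even, so the range of s consists of full blocks of length 6, each
  contributing the residues 1 and 5.\<close>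

lemma card_bad:
  fixes N m :: nat
  assumes "odd N" "3 dvd N" "N dvd m" "even m" "m > 0"
  shows "card {t. t < m \<and> odd t \<and> N div 3 dvd t \<and> \<not> N dvd t} = m div N"
proof -
  obtain N' where N': "N = 3 * N'" using assms(2) by (elim dvdE)
  obtain r where r: "m = N * r" using assms(3) by (elim dvdE)
  then have "even r" using assms by simp
  then obtain q where q: "r = 2 * q" by (elim evenE)
  have n0: "N' > 0" "odd N'" using N' assms by (auto intro: Nat.gr0I)
  have "{t. t < m \<and> odd t \<and> N div 3 dvd t \<and> \<not> N dvd t} = (\<lambda>s. N' * s) ` {s. s < 6 * q \<and> odd s \<and> \<not> 3 dvd s}"
    (is "?A = ?B")
  proof (intro equalityI subsetI)
    fix t assume t: "t \<in> ?A"
    then obtain s where s: "t = N' * s" using N' by (auto elim!: dvdE)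
    then have "s < 6 * q" "odd s" "\<not> 3 dvd s"
      using t n0 by (auto simp: N' r q mult.assoc[symmetric] mult.commute[of 3 N'])
    then show "t \<in> ?B" using s by blast
  next
    fix t assume "t \<in> ?B"
    then show "t \<in> ?A" using n0 by (auto simp: N' r q mult.commute[of 3 N'])
  qed
  moreover have "inj_on (\<lambda>s. N' * s) {s. s < 6 * q \<and> odd s \<and> \<not> 3 dvd s}"
    using n0 by (auto simp: inj_on_def)
  ultimately show ?thesis using n0 by (simp add: card_image card_odd_not_3_dvd r q N')
qed

section \<open>Convolution matrices\<close>

lemma rank_mat_sum_outer_le:
  fixes u w :: "'b \<Rightarrow> nat \<Rightarrow> real"
  assumes "finite T"
  shows "vec_space.rank n (mat n n (\<lambda>(i, j). \<Sum>t\<in>T. u t i * w t j)) \<le> card T"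
  using assms
proof (induction T rule: finite_induct)
  case empty
  have "mat n n (\<lambda>(i, j). \<Sum>t\<in>{}. u t i * w t j) = 0\<^sub>m n n" by auto
  then show ?case by (simp only: vec_space.rank_0I card.empty)
next
  case (insert x T)
  let ?A = "mat n n (\<lambda>(i, j). u x i * w x j)"
  let ?B = "mat n n (\<lambda>(i, j). \<Sum>t\<in>T. u t i * w t j)"
  have "mat n n (\<lambda>(i, j). \<Sum>t\<in>insert x T. u t i * w t j) = ?A + ?B"
    using insert.hyps by auto
  moreover have "vec_space.rank n (?A + ?B) \<le> vec_space.rank n ?A + vec_space.rank n ?B"
    by (rule vec_space.rank_subadditive) auto
  moreover have "vec_space.rank n ?A \<le> 1"
    by (rule vec_space.rank_le_1_product_entries[where nc = n]) auto
  ultimately show ?case using insert by simp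
qed

section \<open>Real matrices of convolution by odd functions\<close>

context fermat_quotient
begin

lemma chr_reflect:
  assumes "t \<le> m" "\<not> l dvd a"
  shows "chr (m - t) a = cnj (chr t a)"
proof -
  have "chr (m - t) a * chr t a = zeta ^ (m * dlog a)"
    using assms by (simp add: chr_def power_add[symmetric] distrib_right[symmetric])
  also have "\<dots> = 1" by (simp add: zeta_power_eq_1_iff)
  finally have "chr (m - t) a * (chr t a * cnj (chr t a)) = cnj (chr t a)"
    by (simp add: mult.assoc[symmetric])
  then show ?thesis using chr_cnj[OF assms(2)] by simp
qed

lemma Fhat_reflect: "t \<le> m \<Longrightarrow> Fhat (m - t) = cnj (Fhat t)"
  unfolding Fhat_def cnj_sum
proof (rule sum.cong[OF refl])
  fix a assume "t \<le> m"
  then show "of_real (F a) * chr (m - t) a = cnj (of_real (F a) * chr t a)"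
    using chr_reflect[of t a] by (cases "l dvd a") (auto simp: F_def)
qed

lemma bad_reflect: "t \<le> m \<Longrightarrow> bad t \<Longrightarrow> bad (m - t)"
  using Fhat_zero_iff[of t] Fhat_zero_iff[of "m - t"] Fhat_reflect[of t] even_m
  by (auto simp: bad_def[of t])

lemma chr_orthogonal':
  assumes "s < m" "t < m"
  shows "(\<Sum>a<l. chr t a * cnj (chr s a)) = (if s = t then of_nat m else 0)"
proof (cases "s = t")
  case True
  have "(\<Sum>a<l. chr t a * cnj (chr t a)) = (\<Sum>a\<in>{1..<l}. chr t a * cnj (chr t a))"
    by (rule sum.mono_neutral_right) (auto simp: Suc_le_eq)
  also have "\<dots> = (\<Sum>a\<in>{1..<l}. 1)"
    by (intro sum.cong refl chr_cnj) (auto dest: dvd_imp_le)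
  finally show ?thesis using True by (simp add: m_def)
next
  case False
  have X: "dirichlet_char l (\<lambda>a. chr t a * cnj (chr s a))"
    by unfold_locales (auto simp: prime_l chr_mult chr_mod chr_zero_iff)
  have g: "\<not> l dvd g" using not_dvd_g_power[of 1] by simp
  have "[dlog g = 1] (mod m)" by (rule dlog_unique[OF g]) simp
  then have c: "chr t g = zeta ^ t" for t
    using zeta_power_cong[OF cong_mult[OF cong_refl], of "dlog g" 1 t] g by (simp add: chr_def)
  have "chr t g * cnj (chr s g) \<noteq> 1"
  proof
    assume "chr t g * cnj (chr s g) = 1"
    then have "chr t g * (chr (m - s) g) = 1" using chr_reflect[OF less_imp_le[OF assms(1)] g] by simp
    then have "zeta ^ (t + (m - s)) = 1" by (simp add: c power_add)
    then have "m dvd t + (m - s)" by (simp only: zeta_power_eq_1_iff)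
    then obtain q where q: "t + (m - s) = m * q" by (elim dvdE)
    consider "q = 0" | "q = 1" | "q \<ge> 2" by linarith
    then show False
    proof cases
      case 3
      then have "m * 2 \<le> m * q" by simp
      then show ?thesis using q assms by linarith
    qed (use q assms False in auto)
  qed
  then have "(\<Sum>a<l. chr t a * cnj (chr s a)) = 0"
    by (rule dirichlet_char.sum_period[OF X g])
  then show ?thesis using False by simp
qed

lemma fourier_inversion:
  assumes "\<not> l dvd b"
  shows "of_nat m * of_real (F b) = (\<Sum>t<m. Fhat t * cnj (chr t b))"
proof -
  have "(\<Sum>t<m. Fhat t * cnj (chr t b)) = (\<Sum>a<l. of_real (F a) * (\<Sum>t<m. chr t a * cnj (chr t b)))"
    unfolding Fhat_def sum_distrib_right sum_distrib_left by (subst sum.swap) (simp add: mult.assoc)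
  also have "\<dots> = (\<Sum>a<l. if a = b mod l then of_real (F a) * of_nat m else 0)"
  proof (rule sum.cong[OF refl])
    fix a assume a: "a \<in> {..<l}"
    show "of_real (F a) * (\<Sum>t<m. chr t a * cnj (chr t b)) = (if a = b mod l then of_real (F a) * of_nat m else 0)"
    proof (cases "a = 0")
      case False
      then have "\<not> l dvd a" using a by (auto dest: dvd_imp_le)
      then show ?thesis using a by (simp add: chr_orthogonal assms cong_def)
    qed (use assms in \<open>simp add: F_def dvd_eq_mod_eq_0\<close>)
  qed
  also have "\<dots> = of_real (F b) * of_nat m" using l_gt_3 by (simp add: sum.delta F_mod)
  finally show ?thesis by simp
qed

lemma sum_Im_reflect:
  assumes T: "T \<subseteq> {0<..<m}" "\<And>t. t \<in> T \<Longrightarrow> m - t \<in> T" and y: "\<And>t. t \<in> T \<Longrightarrow> y (m - t) = cnj (y t)"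
  shows "(\<Sum>t\<in>T. Im (y t)) = 0"
proof -
  have "(\<Sum>t\<in>T. Im (y t)) = (\<Sum>t\<in>T. Im (y (m - t)))"
    by (rule sum.reindex_bij_witness[of _ "\<lambda>t. m - t" "\<lambda>t. m - t"]) (use T in auto)
  also have "\<dots> = - (\<Sum>t\<in>T. Im (y t))" using y by (simp add: sum_negf)
  finally show ?thesis by simp
qed

text \<open>
  Splitting a conjugation-invariant sum of complex rank-one terms into the same number of real ones:
  for \<open>P = (1 - \<i>) z\<close> and \<open>Q = (1 + \<i>) z'\<close> the products \<open>Re P * Re Q\<close> and \<open>Re (z z')\<close> differ by
  \<open>Im (z * cnj z')\<close>, which cancels between conjugate characters.
\<close>

lemma sum_chr_eq_sum_outer:
  assumes T: "T \<subseteq> {0<..<m}" "\<And>t. t \<in> T \<Longrightarrow> m - t \<in> T" and z: "\<And>t. t \<in> T \<Longrightarrow> z (m - t) = cnj (z t)"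
    and ab: "\<not> l dvd a" "\<not> l dvd b"
  shows "(\<Sum>t\<in>T. Re (z t * cnj (chr t (a * b)))) =
         (\<Sum>t\<in>T. Re ((1 - \<i>) * (z t * cnj (chr t a))) * Re ((1 + \<i>) * cnj (chr t b)))"
proof -
  have id: "Re ((1 - \<i>) * p) * Re ((1 + \<i>) * q) = Re (p * q) + Im (p * cnj q)" for p q
    by (simp add: algebra_simps)
  have "(\<Sum>t\<in>T. Im (z t * cnj (chr t a) * chr t b)) = 0"
  proof (rule sum_Im_reflect[OF T])
    fix t assume "t \<in> T"
    then show "z (m - t) * cnj (chr (m - t) a) * chr (m - t) b = cnj (z t * cnj (chr t a) * chr t b)"
      using T(1) ab by (auto simp: z chr_reflect less_imp_le)
  qed
  then have "(\<Sum>t\<in>T. Re ((1 - \<i>) * (z t * cnj (chr t a))) * Re ((1 + \<i>) * cnj (chr t b))) =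
      (\<Sum>t\<in>T. Re (z t * cnj (chr t a) * cnj (chr t b)))"
    by (simp only: id sum.distrib complex_cnj_cnj add_0_right)
  also have "\<dots> = (\<Sum>t\<in>T. Re (z t * cnj (chr t (a * b))))"
    by (simp only: chr_mult complex_cnj_mult mult.assoc)
  finally show ?thesis ..
qed

text \<open>The matrix is convolution by \<open>K\<close> on odd U-invariant functions. The odd
  characters trivial on \<open>U\<close> diagonalise it, and \<open>Khat\<close> says that their
  eigenvalues are non-zero. The \<open>s i\<close> meet every U-coset up to sign, and the
  \<open>r j\<close> lie in different ones even up to sign. The lemma is applied with
  \<open>U = W 1\<close> when k is a primitive cube root of unity, and with \<open>U = {1}\<close>
  and a perturbed \<open>K\<close> to compute the rank.\<close>

lemma det_convolution_nonzero:
  fixes K :: "nat \<Rightarrow> real" and r s :: "nat \<Rightarrow> nat"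
  assumes K_mod: "\<And>a. K (a mod l) = K a" and K_minus: "\<And>a. K (m * a) = - K a"
    and U: "U \<subseteq> {1..<l}" "1 \<in> U" "\<And>a b. a \<in> U \<Longrightarrow> b \<in> U \<Longrightarrow> a * b mod l \<in> U"
    and K_U: "\<And>a u. u \<in> U \<Longrightarrow> K (a * u) = K a"
    and r: "\<And>i. i < n \<Longrightarrow> \<not> l dvd r i"
    and cover: "\<And>d. \<not> l dvd d \<Longrightarrow> \<exists>i<n. \<exists>u\<in>U. [d = s i * u] (mod l) \<or> [d = m * (s i * u)] (mod l)"
    and uniq: "\<And>i j u. i < n \<Longrightarrow> j < n \<Longrightarrow> u \<in> U \<Longrightarrow> [r i * u = r j] (mod l) \<Longrightarrow> i = j \<and> u = 1"
    and sep: "\<And>i j u. i < n \<Longrightarrow> j < n \<Longrightarrow> u \<in> U \<Longrightarrow> \<not> [m * (r i * u) = r j] (mod l)"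
    and Khat: "\<And>t. odd t \<Longrightarrow> t < m \<Longrightarrow> (\<forall>u\<in>U. chr t u = 1) \<Longrightarrow> (\<Sum>a<l. of_real (K a) * chr t a) \<noteq> 0"
  shows "det (mat n n (\<lambda>(i, j). K (s i * r j))) \<noteq> 0"
proof
  let ?A = "mat n n (\<lambda>(i, j). K (s i * r j))"
  assume "det ?A = 0"
  then obtain v where v: "v \<in> carrier_vec n" "v \<noteq> 0\<^sub>v n" "?A *\<^sub>v v = 0\<^sub>v n"
    using det_0_iff_vec_prod_zero_field[of ?A n] by auto
  define y where "y j = v $ j" for j
  have fin: "finite U" using U(1) finite_subset by blast
  have nU: "\<not> l dvd u" if "u \<in> U" for u
  proof -
    have "u \<in> {1..<l}" using U(1) that by blast
    then show ?thesis by (auto dest: dvd_imp_le)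
  qed
  have row: "(\<Sum>j<n. K (s i * r j) * y j) = 0" if "i < n" for i
  proof -
    have "(?A *\<^sub>v v) $ i = (\<Sum>j<n. K (s i * r j) * y j)"
      using that v(1) by (simp add: scalar_prod_def y_def lessThan_atLeast0)
    then show ?thesis using v(3) that by simp
  qed
  have K_cong: "K a = K b" if "[a = b] (mod l)" for a b using that K_mod by (metis cong_def)
  \<comment> \<open>By \<open>cover\<close>, oddness and U-invariance of \<open>K\<close>, the
    equation at any unit d is one of the n rows up to sign.\<close>
  have all: "(\<Sum>j<n. K (d * r j) * y j) = 0" if d: "\<not> l dvd d" for d
  proof -
    obtain i u where iu: "i < n" "u \<in> U" "[d = s i * u] (mod l) \<or> [d = m * (s i * u)] (mod l)"
      using cover[OF d] by blast
    from iu(3) consider "\<And>j. K (d * r j) = K (s i * r j)" | "\<And>j. K (d * r j) = - K (s i * r j)"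
    proof (elim disjE)
      assume "[d = s i * u] (mod l)"
      then have "[d * r j = s i * u * r j] (mod l)" for j by (rule cong_scalar_right)
      then have "K (d * r j) = K (s i * u * r j)" for j by (rule K_cong)
      then have "K (d * r j) = K (s i * r j * u)" for j by (simp only: mult_ac)
      then show ?thesis using that(1) K_U[OF iu(2)] by simp
    next
      assume "[d = m * (s i * u)] (mod l)"
      then have "[d * r j = m * (s i * u) * r j] (mod l)" for j by (rule cong_scalar_right)
      then have "K (d * r j) = K (m * (s i * u) * r j)" for j by (rule K_cong)
      then have "K (d * r j) = K (m * (s i * r j * u))" for j by (simp only: mult_ac)
      then show ?thesis using that(2) K_U[OF iu(2)] K_minus by simp
    qed
    then show ?thesis using row[OF iu(1)] by cases (auto simp: sum_negf)
  qed
  \<comment> \<open>The Fourier transform, in conjugate characters, of the vector y placed at the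
    points \<open>r j\<close>; summing the equations over d against \<open>chr t\<close> gives
    \<open>V t\<close> times a coefficient of \<open>K\<close>.\<close>
  define V where "V t = (\<Sum>j<n. of_real (y j) * cnj (chr t (r j)))" for t
  have V0: "V t = 0" if t: "odd t" "t < m" "\<forall>u\<in>U. chr t u = 1" for t
  proof -
    have "0 = (\<Sum>d<l. of_real (\<Sum>j<n. K (d * r j) * y j) * chr t d)"
    proof (rule sum.neutral[symmetric], rule ballI)
      fix d assume "d \<in> {..<l}"
      show "of_real (\<Sum>j<n. K (d * r j) * y j) * chr t d = 0"
        using all[of d] by (cases "l dvd d") (auto simp: chr_def)
    qed
    also have "\<dots> = (\<Sum>j<n. of_real (y j) * (\<Sum>d<l. of_real (K (r j * d)) * chr t d))"
      unfolding of_real_sum sum_distrib_right sum_distrib_left by (subst sum.swap) (simp add: mult_ac)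
    also have "\<dots> = (\<Sum>j<n. of_real (y j) * (cnj (chr t (r j)) * (\<Sum>d<l. of_real (K d) * chr t d)))"
    proof (rule sum.cong[OF refl])
      fix j assume "j \<in> {..<n}"
      then have "(\<Sum>d<l. of_real (K (r j * d)) * chr t d) = cnj (chr t (r j)) * (\<Sum>d<l. of_real (K d) * chr t d)"
        by (intro sum_shift_chr) (auto simp: K_mod r)
      then show "of_real (y j) * (\<Sum>d<l. of_real (K (r j * d)) * chr t d) =
          of_real (y j) * (cnj (chr t (r j)) * (\<Sum>d<l. of_real (K d) * chr t d))" by simp
    qed
    also have "\<dots> = V t * (\<Sum>d<l. of_real (K d) * chr t d)"
      by (simp add: V_def sum_distrib_right mult.assoc)
    finally show ?thesis using Khat[OF t] by simp
  qed
  have y0: "y i = 0" if i: "i < n" for i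
  proof -
    \<comment> \<open>The left factor is the transform of the odd U-invariant function supported on
      the coset of \<open>r i\<close> and its negative. It vanishes unless \<open>chr t\<close> is
      odd and trivial on \<open>U\<close>, and in that case \<open>V t = 0\<close>.\<close>
    have z: "(\<Sum>u\<in>U. chr t (r i * u) - chr t (m * (r i * u))) * V t = 0" if t: "t < m" for t
    proof (cases "odd t \<and> (\<forall>u\<in>U. chr t u = 1)")
      case True
      then show ?thesis using V0 t by simp
    next
      case False
      have e: "(\<Sum>u\<in>U. chr t (r i * u) - chr t (m * (r i * u))) = (1 - chr t m) * chr t (r i) * (\<Sum>u\<in>U. chr t u)"
        unfolding sum_distrib_left by (rule sum.cong[OF refl]) (simp add: chr_mult algebra_simps)
      show ?thesis
      proof (cases "odd t")
        case True
        then obtain u0 where "u0 \<in> U" "chr t u0 \<noteq> 1" using False by blast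
        then have "(\<Sum>u\<in>U. chr t u) = 0" using U by (intro sum_chr_closed[of U u0])
        then show ?thesis by (simp add: e)
      next
        case False
        then have "chr t m = 1" using chr_minus_1[of t] by simp
        then show ?thesis by (simp add: e)
      qed
    qed
    \<comment> \<open>The sum of these products over all t is now evaluated by orthogonality:
      \<open>uniq\<close> leaves only j = i and u = 1, and \<open>sep\<close> removes the negative
      half.\<close>
    have "0 = (\<Sum>t<m. (\<Sum>u\<in>U. chr t (r i * u) - chr t (m * (r i * u))) * V t)"
      by (rule sum.neutral[symmetric]) (use z in blast)
    also have "\<dots> = (\<Sum>t<m. \<Sum>j<n. \<Sum>u\<in>U. of_real (y j) * (chr t (r i * u) * cnj (chr t (r j)) - chr t (m * (r i * u)) * cnj (chr t (r j))))"
      unfolding V_def sum_distrib_left sum_distrib_right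
      by (simp add: algebra_simps)
    also have "\<dots> = (\<Sum>j<n. \<Sum>u\<in>U. \<Sum>t<m. of_real (y j) * (chr t (r i * u) * cnj (chr t (r j)) - chr t (m * (r i * u)) * cnj (chr t (r j))))"
      by (subst sum.swap, rule sum.cong[OF refl], rule sum.swap)
    also have "\<dots> = (\<Sum>j<n. \<Sum>u\<in>U. if j = i \<and> u = 1 then of_real (y j) * of_nat m else 0)"
    proof (intro sum.cong refl)
      fix j u assume j: "j \<in> {..<n}" and u: "u \<in> U"
      have nd: "\<not> l dvd r i * u" "\<not> l dvd m * (r i * u)" "\<not> l dvd r j"
        using r[of i] r[of j] i j nU[OF u] not_dvd_m by auto
      have "[r i * u = r j] (mod l) \<longleftrightarrow> j = i \<and> u = 1" using uniq[of i j u] i j u by auto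
      moreover have "\<not> [m * (r i * u) = r j] (mod l)" using sep[of i j u] i j u by simp
      ultimately show "(\<Sum>t<m. of_real (y j) * (chr t (r i * u) * cnj (chr t (r j)) - chr t (m * (r i * u)) * cnj (chr t (r j))))
          = (if j = i \<and> u = 1 then of_real (y j) * of_nat m else 0)"
        by (simp only: sum_distrib_left[symmetric] sum_subtractf chr_orthogonal[OF nd(1,3)] chr_orthogonal[OF nd(2,3)]) simp
    qed
    also have "\<dots> = (\<Sum>j<n. if j = i then of_real (y j) * of_nat m else 0)"
    proof (rule sum.cong[OF refl])
      fix j
      show "(\<Sum>u\<in>U. if j = i \<and> u = 1 then of_real (y j) * of_nat m else 0) = (if j = i then of_real (y j) * of_nat m else (0 :: complex))"
        using fin U(2) by (cases "j = i") (simp_all add: sum.delta)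
    qed
    also have "\<dots> = of_real (y i) * of_nat m" using i by (simp add: sum.delta)
    finally show ?thesis using m_pos by simp
  qed
  have "v = 0\<^sub>v n" using v(1) y0 by (intro eq_vecI) (auto simp: y_def)
  then show False using v(2) by simp
qed

lemma card_odd_less_m: "card {t. t < m \<and> odd t} = m div 2"
proof -
  have "{t. t < 2 * q \<and> odd t} = (\<lambda>i. 2 * i + 1) ` {..<q}" for q :: nat
    by (auto elim!: oddE)
  moreover have "inj_on (\<lambda>i. 2 * i + 1) {..<q}" for q :: nat by (auto simp: inj_on_def)
  ultimately have "card {t. t < 2 * q \<and> odd t} = q" for q :: nat by (simp add: card_image)
  from this[of "m div 2"] show ?thesis using even_m by simp
qed

text \<open>
  The lower bound on the rank comes from adding the projection onto the bad characters, which has rank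
  at most \<open>card Bd\<close> and makes all odd Fourier coefficients nonzero.
\<close>

theorem rank_convolution_F:
  fixes r s :: "nat \<Rightarrow> nat"
  defines "n \<equiv> m div 2"
  assumes r: "\<And>i. i < n \<Longrightarrow> \<not> l dvd r i" and s: "\<And>i. i < n \<Longrightarrow> \<not> l dvd s i"
    and cover: "\<And>d. \<not> l dvd d \<Longrightarrow> \<exists>i<n. [d = s i] (mod l) \<or> [d = m * s i] (mod l)"
    and uniq: "\<And>i j. i < n \<Longrightarrow> j < n \<Longrightarrow> [r i = r j] (mod l) \<Longrightarrow> i = j"
    and sep: "\<And>i j. i < n \<Longrightarrow> j < n \<Longrightarrow> \<not> [m * r i = r j] (mod l)"
  shows "vec_space.rank n (mat n n (\<lambda>(i, j). - F (s i * r j))) + card {t. t < m \<and> bad t} = n"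
proof -
  let ?D = "mat n n (\<lambda>(i, j). - F (s i * r j))"
  define Bd where "Bd = {t. t < m \<and> bad t}"
  define Gd where "Gd = {t. t < m \<and> odd t \<and> \<not> bad t}"
  have fin: "finite Bd" "finite Gd" by (auto simp: Bd_def Gd_def)
  have "Bd \<union> Gd = {t. t < m \<and> odd t}" "Bd \<inter> Gd = {}" by (auto simp: Bd_def Gd_def bad_def)
  then have cardBG: "card Bd + card Gd = n"
    using card_Un_disjoint[OF fin] card_odd_less_m by (simp add: n_def)
  have odd_reflect: "odd (m - t)" if "odd t" "t < m" for t using even_m that by simp
  have BT: "Bd \<subseteq> {0<..<m}" "\<And>t. t \<in> Bd \<Longrightarrow> m - t \<in> Bd"
  proof -
    show sub: "Bd \<subseteq> {0<..<m}" by (auto simp: Bd_def bad_def odd_pos)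
    fix t assume t: "t \<in> Bd"
    then have "t > 0" using sub by auto
    then show "m - t \<in> Bd" using t bad_reflect[of t] m_pos by (auto simp: Bd_def)
  qed
  have GT: "Gd \<subseteq> {0<..<m}" "\<And>t. t \<in> Gd \<Longrightarrow> m - t \<in> Gd"
  proof -
    show "Gd \<subseteq> {0<..<m}" by (auto simp: Gd_def odd_pos)
    fix t assume t: "t \<in> Gd"
    have "\<not> bad (m - t)" using bad_reflect[of "m - t"] t by (auto simp: Gd_def)
    then show "m - t \<in> Gd" using t odd_reflect by (auto simp: Gd_def odd_pos m_pos)
  qed
  have upper: "vec_space.rank n ?D \<le> card Gd"
  proof -
    let ?z = "\<lambda>t. - Fhat t / of_nat m"
    have "?D = mat n n (\<lambda>(i, j). \<Sum>t\<in>Gd. Re ((1 - \<i>) * (?z t * cnj (chr t (s i)))) * Re ((1 + \<i>) * cnj (chr t (r j))))"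
    proof (rule cong_mat, simp, simp)
      fix i j assume ij: "i < n" "j < n"
      have nd: "\<not> l dvd s i * r j" using r s ij by simp
      have sub: "(\<Sum>t<m. Fhat t * cnj (chr t (s i * r j))) = (\<Sum>t\<in>Gd. Fhat t * cnj (chr t (s i * r j)))"
      proof (rule sum.mono_neutral_right)
        have "Fhat t = 0" if "t < m" "t \<notin> Gd" for t
          using that Fhat_even[of t] Fhat_zero_iff[of t] by (auto simp: Gd_def)
        then show "\<forall>t\<in>{..<m} - Gd. Fhat t * cnj (chr t (s i * r j)) = 0" by simp
      qed (auto simp: Gd_def)
      have "of_real (- F (s i * r j)) = (\<Sum>t\<in>Gd. ?z t * cnj (chr t (s i * r j)))"
        using fourier_inversion[OF nd] m_pos unfolding sub
        by (simp add: sum_negf sum_divide_distrib[symmetric] field_simps)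
      then have "- F (s i * r j) = Re (\<Sum>t\<in>Gd. ?z t * cnj (chr t (s i * r j)))"
        by (metis Re_complex_of_real)
      also have "\<dots> = (\<Sum>t\<in>Gd. Re (?z t * cnj (chr t (s i * r j))))" by (rule Re_sum)
      also have "\<dots> = (\<Sum>t\<in>Gd. Re ((1 - \<i>) * (?z t * cnj (chr t (s i)))) * Re ((1 + \<i>) * cnj (chr t (r j))))"
      proof (rule sum_chr_eq_sum_outer[OF GT])
        show "?z (m - t) = cnj (?z t)" if "t \<in> Gd" for t
          using that by (simp add: Gd_def Fhat_reflect)
      qed (use r s ij in auto)
      finally show "(case (i, j) of (i, j) \<Rightarrow> - F (s i * r j)) = (case (i, j) of (i, j) \<Rightarrow>
          \<Sum>t\<in>Gd. Re ((1 - \<i>) * (?z t * cnj (chr t (s i)))) * Re ((1 + \<i>) * cnj (chr t (r j))))" by simp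
    qed
    then show ?thesis using rank_mat_sum_outer_le[OF fin(2)] by (simp only:)
  qed
  \<comment> \<open>1/m times the sum of the conjugates of the bad characters: among exponents below
    m, its coefficients are 1 on \<open>Bd\<close> and 0 elsewhere. The sum is real because
    \<open>Bd\<close> is closed under conjugation.\<close>
  define b where "b a = (\<Sum>t\<in>Bd. Re ((1 / of_nat m) * cnj (chr t a)))" for a
  let ?B = "mat n n (\<lambda>(i, j). b (s i * r j))"
  have rankB: "vec_space.rank n ?B \<le> card Bd"
  proof -
    let ?z = "\<lambda>t::nat. 1 / of_nat m :: complex"
    have "?B = mat n n (\<lambda>(i, j). \<Sum>t\<in>Bd. Re ((1 - \<i>) * (?z t * cnj (chr t (s i)))) * Re ((1 + \<i>) * cnj (chr t (r j))))"
    proof (rule cong_mat, simp, simp)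
      fix i j assume ij: "i < n" "j < n"
      have "b (s i * r j) = (\<Sum>t\<in>Bd. Re ((1 - \<i>) * (?z t * cnj (chr t (s i)))) * Re ((1 + \<i>) * cnj (chr t (r j))))"
        unfolding b_def by (rule sum_chr_eq_sum_outer[OF BT]) (use r s ij in auto)
      then show "(case (i, j) of (i, j) \<Rightarrow> b (s i * r j)) = (case (i, j) of (i, j) \<Rightarrow>
          \<Sum>t\<in>Bd. Re ((1 - \<i>) * (?z t * cnj (chr t (s i)))) * Re ((1 + \<i>) * cnj (chr t (r j))))" by simp
    qed
    then show ?thesis using rank_mat_sum_outer_le[OF fin(1)] by (simp only:)
  qed
  have b_complex: "of_real (b a) = (\<Sum>t\<in>Bd. (1 / of_nat m) * cnj (chr t a))" for a
  proof (rule complex_eqI)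
    have "(\<Sum>t\<in>Bd. Im ((1 / of_nat m) * cnj (chr t a))) = 0"
    proof (rule sum_Im_reflect[OF BT])
      fix t assume "t \<in> Bd"
      then show "(1 / of_nat m) * cnj (chr (m - t) a) = cnj ((1 / of_nat m) * cnj (chr t a))"
        using chr_reflect[of t a] by (cases "l dvd a") (auto simp: Bd_def chr_def)
    qed
    then show "Im (of_real (b a)) = Im (\<Sum>t\<in>Bd. (1 / of_nat m) * cnj (chr t a))" by (simp only: Im_sum Im_complex_of_real)
    show "Re (of_real (b a)) = Re (\<Sum>t\<in>Bd. (1 / of_nat m) * cnj (chr t a))" by (simp only: b_def Re_sum Re_complex_of_real)
  qed
  define K where "K a = - F a + b a" for a
  have Khat: "(\<Sum>a<l. of_real (K a) * chr t a) = - Fhat t + (if bad t then 1 else 0)" if t: "t < m" for t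
  proof -
    have "(\<Sum>a<l. of_real (b a) * chr t a) = (\<Sum>u\<in>Bd. (1 / of_nat m) * (\<Sum>a<l. chr t a * cnj (chr u a)))"
      unfolding b_complex sum_distrib_right sum_distrib_left by (subst sum.swap) (simp add: mult_ac)
    also have "\<dots> = (\<Sum>u\<in>Bd. if u = t then 1 else 0)"
      using t m_pos by (intro sum.cong refl) (auto simp: Bd_def chr_orthogonal')
    also have "\<dots> = (if bad t then 1 else 0)" using fin(1) t by (simp add: sum.delta' Bd_def)
    finally show ?thesis by (simp add: K_def Fhat_def left_diff_distrib sum.distrib sum_negf algebra_simps sum_subtractf)
  qed
  have "det (mat n n (\<lambda>(i, j). K (s i * r j))) \<noteq> 0"
  proof (rule det_convolution_nonzero[where U = "{1}"])
    show "K (a mod l) = K a" for a by (simp add: K_def b_def F_mod chr_mod)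
    show "K (m * a) = - K a" for a
    proof -
      have "b (m * a) = - b a"
        unfolding b_def sum_negf[symmetric]
      proof (rule sum.cong[OF refl])
        fix t assume "t \<in> Bd"
        then have "odd t" by (simp add: Bd_def bad_def)
        then have "chr t (m * a) = - chr t a" using chr_minus_1[of t] by (simp add: chr_mult)
        then show "Re (1 / of_nat m * cnj (chr t (m * a))) = - Re (1 / of_nat m * cnj (chr t a))" by simp
      qed
      then show ?thesis by (simp add: K_def F_minus)
    qed
    show "(\<Sum>a<l. of_real (K a) * chr t a) \<noteq> 0" if "odd t" "t < m" for t
      using Khat[OF that(2)] Fhat_zero_iff[OF that(1)] by auto
    show "\<exists>i<n. \<exists>u\<in>{1}. [d = s i * u] (mod l) \<or> [d = m * (s i * u)] (mod l)" if "\<not> l dvd d" for d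
      using cover[OF that] by simp
    show "\<And>i j u. i < n \<Longrightarrow> j < n \<Longrightarrow> u \<in> {1} \<Longrightarrow> [r i * u = r j] (mod l) \<Longrightarrow> i = j \<and> u = 1"
      using uniq by simp
    show "\<And>i j u. i < n \<Longrightarrow> j < n \<Longrightarrow> u \<in> {1} \<Longrightarrow> \<not> [m * (r i * u) = r j] (mod l)"
      using sep by simp
  qed (use l_gt_3 r in auto)
  then have "vec_space.rank n (mat n n (\<lambda>(i, j). K (s i * r j))) = n"
    using vec_space.det_rank_iff[of "mat n n (\<lambda>(i, j). K (s i * r j))" n] by simp
  moreover have "mat n n (\<lambda>(i, j). K (s i * r j)) = ?D + ?B" by (auto simp: K_def)
  moreover have "vec_space.rank n (?D + ?B) \<le> vec_space.rank n ?D + vec_space.rank n ?B"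
    by (rule vec_space.rank_subadditive) auto
  ultimately show ?thesis using upper rankB cardBG by (simp add: Bd_def)
qed

end

section \<open>Cosets of the stabiliser\<close>

context fermat_quotient
begin

section \<open>Transfer between the group \<open>GG l\<close> and natural numbers modulo
  \<open>l\<close>\<close>

sublocale GG: comm_group "GG l"
  by (rule comm_group_GG[OF prime_l])

lemma carrier_eq: "carrier (GG l) = int ` {1..<l}"
proof (intro equalityI subsetI)
  fix a assume "a \<in> carrier (GG l)"
  then have "1 \<le> a" "a \<le> int l - 1" by (auto simp: carrier_GG[OF prime_l])
  then have "nat a \<in> {1..<l}" "a = int (nat a)" by auto
  then show "a \<in> int ` {1..<l}" by blast
qed (auto simp: carrier_GG[OF prime_l])

lemma mult_int: "int a \<otimes>\<^bsub>GG l\<^esub> int b = int (a * b mod l)"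
  by (simp add: mult_GG zmod_int)

lemma one_GG: "\<one>\<^bsub>GG l\<^esub> = 1"
  by (simp add: GG_def units_of_def residue_ring_def)

lemma pow_int: "a \<in> {1..<l} \<Longrightarrow> int a [^]\<^bsub>GG l\<^esub> (n :: nat) = int (a ^ n mod l)"
proof (induction n)
  case 0
  then show ?case using l_gt_3 by (simp add: one_GG)
next
  case (Suc n)
  then show ?case by (simp add: mult_int mod_mult_right_eq mult.commute)
qed

lemma int_mod_carrier: "\<not> l dvd a \<Longrightarrow> int (a mod l) \<in> carrier (GG l)"
  using mult_mod_range carrier_eq by blast

lemma G_ord_eq:
  assumes "\<not> l dvd a"
  shows "G_ord l (int (a mod l)) = ord l a"
proof -
  have "G_ord l (int (a mod l)) dvd n \<longleftrightarrow> ord l a dvd n" for n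
  proof -
    have "G_ord l (int (a mod l)) dvd n \<longleftrightarrow> int (a mod l) [^]\<^bsub>GG l\<^esub> n = \<one>\<^bsub>GG l\<^esub>"
      unfolding G_ord_def using GG.pow_eq_id[OF int_mod_carrier[OF assms]] by simp
    also have "\<dots> \<longleftrightarrow> int (a ^ n mod l) = int 1"
      by (simp add: pow_int[OF mult_mod_range[OF assms]] one_GG power_mod)
    also have "\<dots> \<longleftrightarrow> a ^ n mod l = 1" by (simp only: of_nat_eq_iff)
    also have "\<dots> \<longleftrightarrow> ord l a dvd n" using ord_divides'[of a n l] l_gt_3 by (simp add: cong_def)
    finally show ?thesis .
  qed
  then show ?thesis by (meson dvd_antisym dvd_refl)
qed

lemma G_ord_k: "G_ord l (int k) = ord l k"
  using G_ord_eq[OF not_dvd_k] k_le l_gt_3 by simp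

lemma G_ord_x: "G_ord l ((- (int k)\<^sup>2 - int k) mod int l) = ord l x"
proof -
  have im: "int m = int l - 1" using l_gt_3 by (simp add: m_def of_nat_diff)
  have "int x = int l * (int k * (int k + 1)) + (- (int k)\<^sup>2 - int k)"
    by (simp add: x_def im algebra_simps power2_eq_square)
  then have "int (x mod l) = (- (int k)\<^sup>2 - int k) mod int l" by (simp add: zmod_int)
  then show ?thesis using G_ord_eq[OF not_dvd_x] by simp
qed

lemma E_fun_eq:
  assumes "\<not> l dvd a"
  shows "real (E_fun l k (int (a mod l))) = F a + 1 / 2"
proof -
  have "int (a mod l) \<in> M_set l k \<longleftrightarrow> a mod l + k * a mod l < l"
    using int_mod_carrier[OF assms] by (simp add: M_set_def mult_int mod_mult_right_eq flip: of_nat_add)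
  then show ?thesis using assms by (simp add: E_fun_def F_def)
qed

lemma M_set_iff:
  assumes "\<not> l dvd a"
  shows "int (a mod l) \<in> M_set l k \<longleftrightarrow> F a = - 1 / 2"
  using E_fun_eq[OF assms] by (auto simp: E_fun_def split: if_splits)

lemma subgroup_H: "subgroup (int ` H f) (GG l)"
proof (rule GG.subgroupI)
  show "int ` H f \<subseteq> carrier (GG l)" unfolding carrier_eq by (auto simp: H_def)
  show "int ` H f \<noteq> {}" using one_in_H by blast
  show "a \<otimes>\<^bsub>GG l\<^esub> b \<in> int ` H f" if "a \<in> int ` H f" "b \<in> int ` H f" for a b
    using that H_mult by (auto simp: mult_int)
  fix a assume "a \<in> int ` H f"
  then obtain h where h: "h \<in> H f" "a = int h" by blast
  have ac: "a \<in> carrier (GG l)" using h unfolding carrier_eq by (auto simp: H_def)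
  then have ic: "inv\<^bsub>GG l\<^esub> a \<in> carrier (GG l)" by simp
  then obtain b where b: "b \<in> {1..<l}" "inv\<^bsub>GG l\<^esub> a = int b" unfolding carrier_eq by blast
  have "a [^]\<^bsub>GG l\<^esub> f = \<one>\<^bsub>GG l\<^esub>" using h pow_int[of h f] by (simp add: H_def one_GG)
  then have "inv\<^bsub>GG l\<^esub> a [^]\<^bsub>GG l\<^esub> f = \<one>\<^bsub>GG l\<^esub>" using ac by (simp add: GG.nat_pow_inv)
  then have "int (b ^ f mod l) = int 1" using pow_int[OF b(1)] b(2) by (simp add: one_GG)
  then have "b \<in> H f" using b(1) by (simp only: of_nat_eq_iff H_def mem_Collect_eq)
  then show "inv\<^bsub>GG l\<^esub> a \<in> int ` H f" using b by blast
qed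

text \<open>By Lagrange, every element of a subgroup of order f is a root of h^f = 1, so the
  subgroup lies in \<open>H f\<close>; equal cardinalities then give the uniqueness that
  \<open>THE\<close> in \<open>H_grp\<close> relies on.\<close>

lemma H_grp_eq:
  assumes "f dvd m"
  shows "H_grp l f = int ` H f"
  unfolding H_grp_def
proof (rule the_equality)
  have c: "card (int ` H f) = f" using card_H[OF assms] by (simp add: card_image)
  then show "subgroup (int ` H f) (GG l) \<and> card (int ` H f) = f" using subgroup_H by simp
  fix A assume A: "subgroup A (GG l) \<and> card A = f"
  interpret A: group "GG l\<lparr>carrier := A\<rparr>"
    by (rule subgroup.subgroup_is_group) (use A GG.is_group in auto)
  have sub: "A \<subseteq> carrier (GG l)" using A subgroup.subset by blast
  have "A \<subseteq> int ` H f"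
  proof
    fix a assume a: "a \<in> A"
    then obtain h where h: "h \<in> {1..<l}" "a = int h" using sub unfolding carrier_eq by blast
    have "a [^]\<^bsub>GG l\<lparr>carrier := A\<rparr>\<^esub> order (GG l\<lparr>carrier := A\<rparr>) = \<one>\<^bsub>GG l\<^esub>"
      using A.pow_order_eq_1[of a] a by simp
    then have "a [^]\<^bsub>GG l\<^esub> f = \<one>\<^bsub>GG l\<^esub>"
      using A by (simp add: order_def GG.nat_pow_consistent[symmetric])
    then have "int (h ^ f mod l) = int 1" using pow_int[OF h(1)] h(2) by (simp add: one_GG)
    then have "h \<in> H f" using h(1) by (simp only: of_nat_eq_iff H_def mem_Collect_eq)
    then show "a \<in> int ` H f" using h by blast
  qed
  then show "A = int ` H f" using A c by (intro card_subset_eq) auto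
qed

lemma Ef_fun_eq:
  assumes "f dvd m" "\<not> l dvd a"
  shows "real (Ef_fun l k f (int (a mod l))) = Fsum f a + real (card (H f)) / 2"
proof -
  have "real (Ef_fun l k f (int (a mod l))) = (\<Sum>h\<in>H f. real (E_fun l k (int (a * h mod l))))"
    by (simp add: Ef_fun_def H_grp_eq[OF assms(1)] sum.reindex mult_int mod_mult_left_eq)
  also have "\<dots> = (\<Sum>h\<in>H f. F (a * h) + 1 / 2)"
    using assms(2) H_not_dvd by (intro sum.cong refl E_fun_eq) auto
  finally show ?thesis by (simp add: Fsum_def sum.distrib)
qed

lemma Wf_grp_eq:
  assumes "f dvd m"
  shows "Wf_grp l k f = int ` W f"
proof -
  have "int w \<in> Wf_grp l k f \<longleftrightarrow> w \<in> W f" if w: "w \<in> {1..<l}" for w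
  proof -
    have nw: "\<not> l dvd w" using w by (auto dest: dvd_imp_le)
    have "Ef_fun l k f (int a \<otimes>\<^bsub>GG l\<^esub> int w) = Ef_fun l k f (int a) \<longleftrightarrow> Fsum f (a * w) = Fsum f a"
      if a: "a \<in> {1..<l}" for a
    proof -
      have na: "\<not> l dvd a" using a by (auto dest: dvd_imp_le)
      have "Ef_fun l k f (int a \<otimes>\<^bsub>GG l\<^esub> int w) = Ef_fun l k f (int a) \<longleftrightarrow>
        real (Ef_fun l k f (int (a * w mod l))) = real (Ef_fun l k f (int (a mod l)))"
        using a by (simp add: mult_int)
      also have "\<dots> \<longleftrightarrow> Fsum f (a * w) = Fsum f a"
        using na nw by (simp add: Ef_fun_eq[OF assms])
      finally show ?thesis .
    qed
    then show ?thesis using w unfolding Wf_grp_def W_def carrier_eq by auto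
  qed
  moreover have "Wf_grp l k f \<subseteq> int ` {1..<l}" unfolding Wf_grp_def carrier_eq by auto
  moreover have "W f \<subseteq> {1..<l}" by (auto simp: W_def)
  ultimately show ?thesis by blast
qed

lemma H_1: "H 1 = {1}" using l_gt_3 by (auto simp: H_def)

text \<open>A subset of the group is stable under w exactly when its indicator is invariant; with
  \<open>H 1 = {1}\<close> this is the case f = 1 of the stabilisers above.\<close>

lemma W_grp_eq: "W_grp l k = int ` W 1"
proof -
  have "W_grp l k = {w \<in> carrier (GG l). \<forall>a\<in>carrier (GG l). E_fun l k (w \<otimes>\<^bsub>GG l\<^esub> a) = E_fun l k a}"
  proof (intro equalityI subsetI)
    fix w assume "w \<in> W_grp l k"
    then show "w \<in> {w \<in> carrier (GG l). \<forall>a\<in>carrier (GG l). E_fun l k (w \<otimes>\<^bsub>GG l\<^esub> a) = E_fun l k a}"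
      using E_fun_W_invariant[OF prime_l] by (auto simp: W_grp_def)
  next
    fix w assume "w \<in> {w \<in> carrier (GG l). \<forall>a\<in>carrier (GG l). E_fun l k (w \<otimes>\<^bsub>GG l\<^esub> a) = E_fun l k a}"
    then have w: "w \<in> carrier (GG l)" and E: "\<And>a. a \<in> carrier (GG l) \<Longrightarrow> E_fun l k (w \<otimes>\<^bsub>GG l\<^esub> a) = E_fun l k a"
      by auto
    have M: "w \<otimes>\<^bsub>GG l\<^esub> a \<in> M_set l k \<longleftrightarrow> a \<in> M_set l k" if "a \<in> carrier (GG l)" for a
      using E[OF that] by (simp add: E_fun_def split: if_splits)
    have Mc: "a \<in> carrier (GG l)" if "a \<in> M_set l k" for a using that by (simp add: M_set_def)
    have "w <#\<^bsub>GG l\<^esub> M_set l k = M_set l k"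
    proof (intro equalityI subsetI)
      fix a assume "a \<in> w <#\<^bsub>GG l\<^esub> M_set l k"
      then show "a \<in> M_set l k" using M Mc by (auto simp: l_coset_def)
    next
      fix a assume a: "a \<in> M_set l k"
      let ?b = "inv\<^bsub>GG l\<^esub> w \<otimes>\<^bsub>GG l\<^esub> a"
      have b: "?b \<in> carrier (GG l)" "w \<otimes>\<^bsub>GG l\<^esub> ?b = a"
        using w Mc[OF a] by (auto simp: GG.m_assoc[symmetric])
      then have "?b \<in> M_set l k" using M[of ?b] a by simp
      then show "a \<in> w <#\<^bsub>GG l\<^esub> M_set l k" using b(2) by (force simp: l_coset_def)
    qed
    then show "w \<in> W_grp l k" using w by (simp add: W_grp_def)
  qed
  also have "\<dots> = Wf_grp l k 1"
  proof -
    have "H_grp l 1 = {1}" using H_grp_eq[of 1] H_1 by simp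
    then have "Ef_fun l k 1 a = E_fun l k a" if "a \<in> carrier (GG l)" for a
      using GG.r_one[OF that] by (simp add: Ef_fun_def one_GG)
    then show ?thesis unfolding Wf_grp_def
      by (intro Collect_cong conj_cong refl ball_cong) (auto simp: GG.m_comm)
  qed
  finally show ?thesis using Wf_grp_eq[of 1] by simp
qed

lemma F0_set_eq: "F0_set l k = {f. odd f \<and> f dvd l - 1 \<and> bad f}"
proof -
  have "3 * f dvd m \<and> Wf_grp l k f = H_grp l (3 * f) \<longleftrightarrow> bad f" if "odd f" "f dvd m" for f
    using bad_iff_W_eq_H[OF that] Wf_grp_eq[OF that(2)] H_grp_eq[of "3 * f"]
    by (auto simp: inj_image_eq_iff)
  then show ?thesis unfolding F0_set_def m_def[symmetric] by auto
qed

lemma W_1_iff: "w \<in> W 1 \<longleftrightarrow> w \<in> {1..<l} \<and> (\<forall>a\<in>{1..<l}. F (a * w) = F a)"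
proof -
  have "Fsum 1 a = F a" for a unfolding Fsum_def H_1 by simp
  then show ?thesis unfolding W_def by simp
qed

lemma F_W_1: "w \<in> W 1 \<Longrightarrow> F (a * w) = F a"
proof -
  assume w: "w \<in> W 1"
  have "F (a mod l * w) = F (a mod l)"
  proof (cases "l dvd a")
    case False
    then show ?thesis using w mult_mod_range[OF False] unfolding W_1_iff by blast
  qed (simp add: dvd_eq_mod_eq_0)
  then show ?thesis by (metis F_mod mod_mult_left_eq)
qed

lemma W_1_mult: "a \<in> W 1 \<Longrightarrow> b \<in> W 1 \<Longrightarrow> a * b mod l \<in> W 1"
proof -
  assume a: "a \<in> W 1" and b: "b \<in> W 1"
  have "F (c * (a * b mod l)) = F c" for c
  proof -
    have "F (c * (a * b mod l)) = F (c * a * b)" by (metis F_mod mod_mult_right_eq mult.assoc)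
    then show ?thesis using F_W_1[OF a] F_W_1[OF b] by simp
  qed
  then show ?thesis using mult_mod_range[of "a * b"] W_not_dvd[OF a] W_not_dvd[OF b]
    unfolding W_1_iff by simp
qed

text \<open>The trivial character is even, so \<open>F\<close> sums to 0 over G and takes its two
  values equally often.\<close>

lemma card_M: "card {a \<in> {1..<l}. F a = - 1 / 2} = m div 2"
proof -
  let ?M = "{a \<in> {1..<l}. F a = - 1 / 2}" and ?P = "{a \<in> {1..<l}. F a = 1 / 2}"
  have u: "?M \<union> ?P = {1..<l}"
  proof -
    have "F a = 1 / 2 \<or> F a = - 1 / 2" if "a \<in> {1..<l}" for a
      using that by (intro F_cases) (auto dest: dvd_imp_le)
    then show ?thesis by blast
  qed
  have "chr 0 a = 1" if "a \<in> {1..<l}" for a using that by (auto simp: chr_def dest: dvd_imp_le)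
  then have "Fhat 0 = (\<Sum>a\<in>{1..<l}. of_real (F a))"
    unfolding Fhat_def by (subst sum.mono_neutral_right[of _ "{1..<l}"]) (auto simp: Suc_le_eq)
  then have "of_real (\<Sum>a\<in>{1..<l}. F a) = (0 :: complex)" using Fhat_even[of 0] by simp
  then have "(\<Sum>a\<in>{1..<l}. F a) = 0" by (simp only: of_real_eq_0_iff)
  moreover have "(\<Sum>a\<in>?M \<union> ?P. F a) = (\<Sum>a\<in>?M. F a) + (\<Sum>a\<in>?P. F a)"
    by (rule sum.union_disjoint) auto
  moreover have "(\<Sum>a\<in>?M. F a) = (\<Sum>a\<in>?M. - 1 / 2)" by (rule sum.cong) auto
  moreover have "(\<Sum>a\<in>?P. F a) = (\<Sum>a\<in>?P. 1 / 2)" by (rule sum.cong) auto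
  ultimately have "card ?M = card ?P" using u by simp
  moreover have "card (?M \<union> ?P) = card ?M + card ?P" by (rule card_Un_disjoint) auto
  ultimately have "card ?M + card ?M = m" using u by (simp only: card_atLeastLessThan m_def)
  then show ?thesis by simp
qed

end

section \<open>The matrix \<open>D_mat\<close> in coset representatives\<close>

locale coset_enumeration = fermat_quotient +
  fixes cs :: "int set list"
  assumes distinct_cs: "distinct cs" and set_cs: "set cs = M_mod_W l k"
begin

text \<open>\<open>r\<close> and \<open>s\<close> repeat the choice of representative made in
  \<open>D_entry\<close>, so that the matrix unfolds to them directly.\<close>

definition r :: "nat \<Rightarrow> nat" where "r i = nat (SOME c. c \<in> cs ! i)"

definition s :: "nat \<Rightarrow> nat" where "s i = nat (inv\<^bsub>GG l\<^esub> (SOME c. c \<in> cs ! i))"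

lemma subgroup_W: "subgroup (W_grp l k) (GG l)"
  by (rule subgroup_W_grp[OF prime_l])

lemma rep_facts:
  assumes i: "i < length cs"
  shows "int (r i) = (SOME c. c \<in> cs ! i)" "r i \<in> {1..<l}" "F (r i) = - 1 / 2"
    "cs ! i = W_grp l k #>\<^bsub>GG l\<^esub> int (r i)"
    "int (s i) = inv\<^bsub>GG l\<^esub> (SOME c. c \<in> cs ! i)" "s i \<in> {1..<l}" "[s i * r i = 1] (mod l)"
proof -
  let ?c = "SOME c. c \<in> cs ! i"
  have "cs ! i \<in> M_mod_W l k" using i set_cs nth_mem by blast
  then have co: "cs ! i \<in> rcosets\<^bsub>GG l\<^esub> (W_grp l k)" and sub: "cs ! i \<subseteq> M_set l k"
    by (auto simp: M_mod_W_def)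
  then obtain b where b: "b \<in> carrier (GG l)" "cs ! i = W_grp l k #>\<^bsub>GG l\<^esub> b" by (auto simp: RCOSETS_def)
  have "b \<in> cs ! i" unfolding b(2) by (rule GG.rcos_self[OF b(1) subgroup_W])
  then have c: "?c \<in> cs ! i" by (rule someI)
  then have cM: "?c \<in> M_set l k" using sub by blast
  then have cc: "?c \<in> carrier (GG l)" by (simp add: M_set_def)
  then obtain a where a: "a \<in> {1..<l}" "?c = int a" unfolding carrier_eq by blast
  then show e: "int (r i) = ?c" and rl: "r i \<in> {1..<l}" by (auto simp: r_def)
  then have nd: "\<not> l dvd r i" by (auto dest: dvd_imp_le)
  show "F (r i) = - 1 / 2" using M_set_iff[OF nd] rl e cM by simp
  show "cs ! i = W_grp l k #>\<^bsub>GG l\<^esub> int (r i)"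
    unfolding e b(2) using c b by (intro GG.repr_independence subgroup_W) auto
  have "inv\<^bsub>GG l\<^esub> ?c \<in> carrier (GG l)" using cc by simp
  then obtain a' where a': "a' \<in> {1..<l}" "inv\<^bsub>GG l\<^esub> ?c = int a'" unfolding carrier_eq by blast
  then show e': "int (s i) = inv\<^bsub>GG l\<^esub> ?c" and "s i \<in> {1..<l}" by (auto simp: s_def)
  have "int (s i) \<otimes>\<^bsub>GG l\<^esub> int (r i) = 1" unfolding e e' using GG.l_inv[OF cc] by (simp add: one_GG)
  then have "int (s i * r i mod l) = int 1" by (simp add: mult_int)
  then show "[s i * r i = 1] (mod l)" using l_gt_3 by (simp only: of_nat_eq_iff cong_def) simp
qed

lemma r_not_dvd: "i < length cs \<Longrightarrow> \<not> l dvd r i" and s_not_dvd: "i < length cs \<Longrightarrow> \<not> l dvd s i"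
  using rep_facts(2,6)[of i] by (auto dest: dvd_imp_le)

lemma D_mat_eq: "D_mat l k cs = mat (length cs) (length cs) (\<lambda>(i, j). - F (s i * r j))"
  unfolding D_mat_def
proof (rule cong_mat, simp, simp)
  fix i j assume ij: "i < length cs" "j < length cs"
  have nd: "\<not> l dvd s i * r j" using r_not_dvd s_not_dvd ij by simp
  have im: "int m = int l - 1" using l_gt_3 by (simp add: m_def of_nat_diff)
  have "G_neg l (int (s i) \<otimes>\<^bsub>GG l\<^esub> int (r j)) = (- int (s i * r j)) mod int l"
    by (simp add: G_neg_eq[OF prime_l] mult_GG mod_simps)
  also have "\<dots> = (- int (s i * r j) + int l * int (s i * r j)) mod int l"
    by (rule mod_mult_self2[symmetric])
  also have "- int (s i * r j) + int l * int (s i * r j) = int (m * (s i * r j))"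
    by (simp add: im algebra_simps)
  finally have "G_neg l (int (s i) \<otimes>\<^bsub>GG l\<^esub> int (r j)) = int (m * (s i * r j) mod l)" by (simp add: zmod_int)
  then have "D_entry l k (cs ! i) (cs ! j) = real (E_fun l k (int (m * (s i * r j) mod l))) - 1 / 2"
    using rep_facts(1)[OF ij(2)] rep_facts(5)[OF ij(1)] by (simp add: D_entry_def)
  also have "\<dots> = F (m * (s i * r j))" using E_fun_eq[of "m * (s i * r j)"] nd not_dvd_m by simp
  finally have "D_entry l k (cs ! i) (cs ! j) = - F (s i * r j)" by (simp only: F_minus)
  then show "(case (i, j) of (i, j) \<Rightarrow> D_entry l k (cs ! i) (cs ! j)) = (case (i, j) of (i, j) \<Rightarrow> - F (s i * r j))"
    by simp
qed

text \<open>M_k is stable under W_k, so the whole coset of c lies in it and is enumerated; its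
  chosen representative differs from c by an element of W_k.\<close>

lemma ex_coset:
  assumes c: "\<not> l dvd c" "F c = - 1 / 2"
  shows "\<exists>i<length cs. \<exists>w\<in>W 1. [r i = w * c] (mod l)"
proof -
  let ?C = "W_grp l k #>\<^bsub>GG l\<^esub> int (c mod l)"
  have cc: "int (c mod l) \<in> carrier (GG l)" by (rule int_mod_carrier[OF c(1)])
  have "?C \<subseteq> M_set l k"
  proof
    fix y assume "y \<in> ?C"
    then obtain w where w: "w \<in> W 1" "y = int w \<otimes>\<^bsub>GG l\<^esub> int (c mod l)"
      unfolding W_grp_eq r_coset_def by blast
    have "y = int (c * w mod l)" using w by (simp add: mult_int mod_mult_right_eq mult.commute)
    moreover have "\<not> l dvd c * w" using c W_not_dvd[OF w(1)] by simp
    ultimately show "y \<in> M_set l k" using M_set_iff[of "c * w"] F_W_1[OF w(1)] c(2) by simp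
  qed
  moreover have "?C \<in> rcosets\<^bsub>GG l\<^esub> (W_grp l k)"
    using cc subgroup.subset[OF subgroup_W] by (intro GG.rcosetsI)
  ultimately have "?C \<in> set cs" unfolding set_cs M_mod_W_def by blast
  then obtain i where i: "i < length cs" "cs ! i = ?C" by (auto simp: in_set_conv_nth)
  have "int (r i) \<in> cs ! i"
    unfolding rep_facts(4)[OF i(1)] using rep_facts(2)[OF i(1)] carrier_eq
    by (intro GG.rcos_self subgroup_W) blast
  then obtain w where w: "w \<in> W 1" "int (r i) = int w \<otimes>\<^bsub>GG l\<^esub> int (c mod l)"
    unfolding i(2) W_grp_eq r_coset_def by blast
  have "int (r i) = int (w * c mod l)" using w(2) by (simp add: mult_int mod_mult_right_eq)
  then have "[r i = w * c] (mod l)" by (simp only: of_nat_eq_iff cong_def mod_mod_trivial)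
  then show ?thesis using i w by blast
qed

lemma cover:
  assumes d: "\<not> l dvd d"
  shows "\<exists>i<length cs. \<exists>u\<in>W 1. [d = s i * u] (mod l) \<or> [d = m * (s i * u)] (mod l)"
proof -
  \<comment> \<open>The inverse of d by Fermat's theorem. As \<open>F\<close> is odd, c or -c lies
    in M_k; \<open>e\<close> records the sign, and the congruence for the representative of that
    coset is solved for d.\<close>
  define c where "c = d ^ (m - 1)"
  have "d * c = d ^ m" using m_pos by (simp add: c_def power_eq_if)
  then have dc: "[d * c = 1] (mod l)" using fermat_theorem[OF prime_l d] by (simp add: m_def)
  have nc: "\<not> l dvd c" using d prime_l by (auto simp: c_def dest: prime_dvd_power_nat)
  obtain e where e: "e = 1 \<or> e = m" "F (e * c) = - 1 / 2"
    using F_cases[OF nc] F_minus[of c] by fastforce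
  then have "\<not> l dvd e * c" using nc not_dvd_m not_dvd_Suc_0 by auto
  then obtain i w where iw: "i < length cs" "w \<in> W 1" "[r i = w * (e * c)] (mod l)"
    using ex_coset e(2) by blast
  have "[d * (s i * r i) = d * 1] (mod l)" using rep_facts(7)[OF iw(1)] by (intro cong_mult cong_refl)
  moreover have "[d * (s i * r i) = d * (s i * (w * (e * c)))] (mod l)"
    using iw(3) by (intro cong_mult cong_refl)
  moreover have "d * (s i * (w * (e * c))) = e * (s i * w) * (d * c)" by (simp only: mult_ac)
  moreover have "[e * (s i * w) * (d * c) = e * (s i * w) * 1] (mod l)" using dc by (intro cong_mult cong_refl)
  ultimately have "[d = e * (s i * w)] (mod l)" by (metis cong_sym cong_trans mult_1_right)
  then show ?thesis using e(1) iw by (metis mult_1)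
qed

lemma uniq:
  assumes ij: "i < length cs" "j < length cs" and u: "u \<in> W 1" and e: "[r i * u = r j] (mod l)"
  shows "i = j \<and> u = 1"
proof -
  have "int (r j) = int u \<otimes>\<^bsub>GG l\<^esub> int (r i)"
    using e rep_facts(2)[OF ij(2)] by (simp add: mult_int cong_def mult.commute)
  then have "int (r j) \<in> W_grp l k #>\<^bsub>GG l\<^esub> int (r i)"
    unfolding W_grp_eq r_coset_def using u by blast
  then have "W_grp l k #>\<^bsub>GG l\<^esub> int (r i) = W_grp l k #>\<^bsub>GG l\<^esub> int (r j)"
    using rep_facts(2)[OF ij(1)] carrier_eq by (intro GG.repr_independence subgroup_W) auto
  then have "cs ! i = cs ! j" using rep_facts(4) ij by simp
  then have "i = j" using distinct_cs ij nth_eq_iff_index_eq by blast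
  then have "[r i * u = r i * 1] (mod l)" using e by simp
  then have "[u = 1] (mod l)"
    using cong_mult_lcancel_nat[of "r i" l u 1] coprime_l_iff[of "r i"] r_not_dvd[OF ij(1)]
    by (simp add: coprime_commute)
  then show ?thesis using \<open>i = j\<close> u l_gt_3 by (simp add: cong_def W_def)
qed

text \<open>\<open>F\<close> is -1/2 at both representatives and invariant under W_k, whereas the
  factor \<open>m\<close> changes its sign.\<close>

lemma sep:
  assumes ij: "i < length cs" "j < length cs" and u: "u \<in> W 1"
  shows "\<not> [m * (r i * u) = r j] (mod l)"
proof
  assume "[m * (r i * u) = r j] (mod l)"
  then have "F (m * (r i * u)) = F (r j)" by (metis F_mod cong_def)
  then show False using rep_facts(3)[OF ij(1)] rep_facts(3)[OF ij(2)] F_W_1[OF u] by (simp add: F_minus)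
qed

text \<open>Here W_k = H_3 contains k. A character trivial on W_k has value 1 at k, not a value of
  order 3, so no exponent that matters for the matrix is bad.\<close>

lemma det_nonzero_if_prim:
  assumes "bad 1"
  shows "det (D_mat l k cs) \<noteq> 0"
  unfolding D_mat_eq
proof (rule det_convolution_nonzero[where U = "W 1"])
  show "W 1 \<subseteq> {1..<l}" by (auto simp: W_def)
  show "1 \<in> W 1" using l_gt_3 by (auto simp: W_def)
  fix t assume t: "odd t" "t < m" "\<forall>u\<in>W 1. chr t u = 1"
  have "W 1 = H 3" using bad_iff_W_eq_H[of 1] assms by simp
  moreover have "k \<in> H 3"
  proof -
    have "[k ^ 3 = 1] (mod l)" using ord[of k l] bad_1_iff assms by simp
    then show ?thesis using k_ge_1 k_le l_gt_3 by (auto simp: H_def cong_def)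
  qed
  ultimately have "chr t k = 1" using t(3) by blast
  then have "ord l k dvd t" using chr_eq_1_ord[OF not_dvd_k] by simp
  then have "\<not> bad t" by (simp add: bad_def)
  then have "Fhat t \<noteq> 0" using Fhat_zero_iff[OF t(1)] by simp
  then show "(\<Sum>a<l. of_real (- F a) * chr t a) \<noteq> 0" by (simp add: Fhat_def sum_negf)
qed (use cover uniq sep r_not_dvd W_1_mult F_W_1 in \<open>auto simp: F_mod F_minus\<close>)

lemma length_cs:
  assumes "\<not> bad 1"
  shows "length cs = m div 2"
proof -
  let ?M = "{a \<in> {1..<l}. F a = - 1 / 2}"
  have "inj_on r {..<length cs}"
  proof (rule inj_onI)
    fix i j assume "i \<in> {..<length cs}" "j \<in> {..<length cs}" "r i = r j"
    then show "i = j" using uniq[of i j 1] l_gt_3 by (auto simp: W_def)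
  qed
  moreover have "r ` {..<length cs} = ?M"
  proof (intro equalityI subsetI)
    fix a assume "a \<in> r ` {..<length cs}"
    then show "a \<in> ?M" using rep_facts(2,3) by auto
  next
    fix a assume a: "a \<in> ?M"
    then have "\<not> l dvd a" by (auto dest: dvd_imp_le)
    then obtain i w where iw: "i < length cs" "w \<in> W 1" "[r i = w * a] (mod l)"
      using ex_coset a by blast
    then have "w = 1" using W_1_eq[OF assms] by simp
    then have "r i = a" using iw rep_facts(2)[OF iw(1)] a by (simp add: cong_def)
    then show "a \<in> r ` {..<length cs}" using iw by blast
  qed
  ultimately show ?thesis using card_M card_image[of r "{..<length cs}"] by simp
qed

lemma rank_D_mat:
  assumes "\<not> bad 1"
  shows "vec_space.rank (length cs) (D_mat l k cs) + card {t. t < m \<and> bad t} = length cs"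
  unfolding D_mat_eq unfolding length_cs[OF assms]
proof (rule rank_convolution_F)
  have W1: "W 1 = {1}" by (rule W_1_eq[OF assms])
  note L = length_cs[OF assms, symmetric]
  show "\<exists>i<m div 2. [d = s i] (mod l) \<or> [d = m * s i] (mod l)" if "\<not> l dvd d" for d
    using cover[OF that] unfolding W1 L by simp
  show "i = j" if "i < m div 2" "j < m div 2" "[r i = r j] (mod l)" for i j
    using uniq[of i j 1] that unfolding W1 L by simp
  show "\<not> [m * r i = r j] (mod l)" if "i < m div 2" "j < m div 2" for i j
    using sep[of i j 1] that unfolding W1 L by simp
qed (use r_not_dvd s_not_dvd length_cs[OF assms] in auto)

end

theorem theorem4p10:
  fixes l k :: nat and cs :: "int set list"
  assumes "prime l" and "l > 3" and "1 \<le> k" and "k \<le> l - 2"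
    and "distinct cs" and "set cs = M_mod_W l k"
  shows
    "(det (D_mat l k cs) = 0 \<longleftrightarrow>
        \<not> primitive_cubic_root l k \<and> F0_set l k \<noteq> {}) \<and>
     (\<not> primitive_cubic_root l k \<and> F0_set l k \<noteq> {} \<longleftrightarrow>
        \<not> primitive_cubic_root l k \<and>
        (odd (G_ord l ((- (int k)\<^sup>2 - int k) mod int l)) \<and> odd (G_ord l (int k))) \<and>
        multiplicity 3 (G_ord l (int k)) > multiplicity 3 (G_ord l ((- (int k)\<^sup>2 - int k) mod int l))) \<and>
     (det (D_mat l k cs) = 0 \<longrightarrow>
        F0_set l k =
          {f. odd f \<and> f dvd l - 1 \<and> N_num l k div 3 dvd f \<and> \<not> N_num l k dvd f} \<and>
        real (vec_space.rank (length cs) (D_mat l k cs)) =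
          (real l - 1) / 2 * (1 - 2 / real (N_num l k)))"
proof -
  have "l > 1" using assms(2) by simp
  then obtain g where "residue_primroot l g" using prime_primitive_root_exists assms(1) by blast
  then interpret coset_enumeration l g k cs using assms by unfold_locales auto
  define a b where "a = ord l x" and "b = ord l k"
  \<comment> \<open>Conditions (b) and (c) of the theorem.\<close>
  define R where "R \<longleftrightarrow> odd a \<and> odd b \<and> multiplicity 3 b > multiplicity 3 a"
  have N: "N_num l k = lcm a b" by (simp add: N_num_def G_ord_x G_ord_k a_def b_def)
  have pos: "a > 0" "b > 0"
    using not_dvd_x not_dvd_k coprime_l_iff by (auto simp: a_def b_def)
  have ab: "a dvd m" "b dvd m"
    using order_divides_totient[of l] coprime_l_iff not_dvd_x not_dvd_k prime_l
    by (auto simp: totient_prime m_def a_def b_def)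
  then have Nm: "lcm a b dvd m" by simp
  have bad_eq: "bad t \<longleftrightarrow> odd t \<and> a dvd t \<and> b dvd 3 * t \<and> \<not> b dvd t" for t
    by (simp add: bad_def a_def b_def)
  have prim: "primitive_cubic_root l k \<longleftrightarrow> bad 1"
    unfolding primitive_cubic_root_def G_ord_k bad_1_iff by (rule refl)
  have badR: "bad t \<longleftrightarrow> odd t \<and> lcm a b div 3 dvd t \<and> \<not> lcm a b dvd t" if R for t
    using lcm_div_3_dvd_iff[of a b t] pos that unfolding R_def bad_eq by blast
  have R_if: R if "bad t" for t
    using multiplicity_3_less[of t a b] that unfolding R_def bad_eq by blast
  \<comment> \<open>This bad exponent also divides \<open>m\<close>, and it is below
    \<open>m\<close> because it is odd and \<open>m\<close> is even. Hence bad exponents below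
    \<open>m\<close> and bad divisors of \<open>m\<close> exist under the same condition
    \<open>R\<close>, which links the determinant to \<open>F0_set\<close>.\<close>
  have wit: "bad (lcm a b div 3) \<and> lcm a b div 3 dvd m \<and> lcm a b div 3 < m" if R
  proof -
    have "3 dvd lcm a b" using three_dvd_lcm[of a b] pos that by (simp add: R_def)
    then have d: "lcm a b div 3 dvd m" using Nm by (metis dvd_div_mult_self dvd_mult_left)
    moreover have "bad (lcm a b div 3)" using badR[OF that] lcm_div_3[of a b] pos that by (simp add: R_def)
    moreover have "lcm a b div 3 < m"
      using dvd_imp_le[OF d m_pos] \<open>bad (lcm a b div 3)\<close> even_m by (cases "lcm a b div 3 = m") (auto simp: bad_def)
    ultimately show ?thesis by simp
  qed
  have F0: "F0_set l k \<noteq> {} \<longleftrightarrow> R"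
    using wit R_if unfolding F0_set_eq m_def[symmetric] by (auto simp: bad_def)
  have fin: "finite {t. t < m \<and> bad t}" by simp
  have det0: "det (D_mat l k cs) = 0 \<longleftrightarrow> \<not> bad 1 \<and> R"
  proof (cases "bad 1")
    case True
    then show ?thesis using det_nonzero_if_prim by simp
  next
    case False
    have "D_mat l k cs \<in> carrier_mat (length cs) (length cs)" by (simp add: D_mat_def)
    then have "det (D_mat l k cs) = 0 \<longleftrightarrow> vec_space.rank (length cs) (D_mat l k cs) \<noteq> length cs"
      using vec_space.det_rank_iff by blast
    also have "\<dots> \<longleftrightarrow> card {t. t < m \<and> bad t} \<noteq> 0" using rank_D_mat[OF False] by linarith
    also have "\<dots> \<longleftrightarrow> {t. t < m \<and> bad t} \<noteq> {}" using fin by (simp only: card_eq_0_iff) simp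
    also have "\<dots> \<longleftrightarrow> R" using wit R_if by blast
    finally show ?thesis using False by simp
  qed
  have last: "F0_set l k = {f. odd f \<and> f dvd l - 1 \<and> N_num l k div 3 dvd f \<and> \<not> N_num l k dvd f} \<and>
        real (vec_space.rank (length cs) (D_mat l k cs)) = (real l - 1) / 2 * (1 - 2 / real (N_num l k))"
    if nb: "\<not> bad 1" and R: R
  proof
    show "F0_set l k = {f. odd f \<and> f dvd l - 1 \<and> N_num l k div 3 dvd f \<and> \<not> N_num l k dvd f}"
      unfolding F0_set_eq N using badR[OF R] by auto
    have "card {t. t < m \<and> bad t} = m div lcm a b"
      using card_bad[of "lcm a b" m] odd_lcm[of a b] three_dvd_lcm[of a b] pos R Nm even_m m_pos
      by (simp add: R_def badR[OF R])
    then have rk: "real (vec_space.rank (length cs) (D_mat l k cs)) + real (m div lcm a b) = real (m div 2)"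
      using rank_D_mat[OF nb] length_cs[OF nb] by (metis of_nat_add)
    have 1: "real (m div lcm a b) = real m / real (lcm a b)" using Nm by (rule real_of_nat_div)
    have 2: "real (m div 2) = real m / 2" using even_m by (simp add: real_of_nat_div)
    have 3: "real m = real l - 1" using l_gt_3 by (simp add: m_def of_nat_diff)
    have "real (vec_space.rank (length cs) (D_mat l k cs)) = (real l - 1) / 2 - (real l - 1) / real (lcm a b)"
      using rk unfolding 1 2 3 by (simp only: eq_diff_eq)
    moreover have "y / 2 - y / n = y / 2 * (1 - 2 / n)" for y n :: real by (simp add: right_diff_distrib)
    ultimately show "real (vec_space.rank (length cs) (D_mat l k cs)) = (real l - 1) / 2 * (1 - 2 / real (N_num l k))"
      unfolding N by (simp only:)
  qed
  show ?thesis
    unfolding prim G_ord_x G_ord_k a_def[symmetric] b_def[symmetric] det0 F0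
    using last by (auto simp: R_def)
qed

end
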